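(* As $x\to\infty$ through even integers, $$\sum_{i=1}^{x/2} c(2i)=\frac{x^2\ln\ln x}{2\ln^2 x}+O\!\left(\frac{x^2}{\ln^2 x}\right).$$
   Context: For an even positive integer $n$, $c(n)$ denotes the number of Chen partitions of $n$, i.e. decompositions of $n$ as a sum of a prime and a number which is either a prime or an odd semiprime: $c(n)=g(n)+s(n)$, where $g(n)$ is the number of unordered pairs $\{p,q\}$ of primes with $p+q=n$, and $s(n)$ is the number of pairs $(p,m)$ with $p$ prime and $m$ an odd semiprime (a product $m=p_1p_2$ of two, not necessarily distinct, odd primes) such that $p+m=n$. *)

theory Defs
  imports "HOL-Computational_Algebra.Primes" "HOL-Library.Landau_Symbols"
begin

definition odd_semiprime :: "nat \<Rightarrow> bool" where
  "odd_semiprime m \<longleftrightarrow> (\<exists>p1 p2. prime p1 \<and> prime p2 \<and> odd p1 \<and> odd p2 \<and> m = p1 * p2)"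

definition goldbach_count :: "nat \<Rightarrow> nat" where
  "goldbach_count n = card {(p, q). prime p \<and> prime q \<and> p \<le> q \<and> p + q = n}"

definition semiprime_count :: "nat \<Rightarrow> nat" where
  "semiprime_count n = card {(p, m). prime p \<and> odd_semiprime m \<and> p + m = n}"

definition chen_count :: "nat \<Rightarrow> nat" where
  "chen_count n = goldbach_count n + semiprime_count n"

end

theory Submission
  imports Defs "HOL-Complex_Analysis.Complex_Analysis" "HOL-Probability.Probability"
    "HOL-Number_Theory.Prime_Powers" "HOL-Real_Asymp.Real_Asymp"
begin

text \<open>
  Apart from the Goldbach pairs, of which Chebyshev's bound allows only O(x^2 / ln^2 x), the sum
  counts triples p, q \<le> r of odd primes with p + q r \<le> x. For fixed q \<le> sqrt x there are
  about x^2 / (2 q ln x ln (x / q)) of them, and Mertens' second theorem evaluates the sum of these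
  terms over q. As the main term exceeds the permitted error only by the factor ln ln x, this needs
  the prime number theorem with some saving; we use \<pi>(x) = x / ln x (1 + O((ln x)^(-1/48))).

  To get it, consider the Dirichlet series of (\<Lambda>(n) - 1) ln n on Re s > 1. The pole at 1
  cancels, and the 3-4-1 inequality bounds the series by a power of 1 + |t|, uniformly as
  Re s \<rightarrow> 1. Smoothing on the scale ln n with a Gaussian of width \<epsilon> therefore costs
  only a power of 1 / \<epsilon>, whereas the extra weight ln n makes the main term larger than this
  by a factor ln x; so \<epsilon> may be taken to be a small negative power of ln x.
\<close>

section \<open>Dirichlet series over the half-plane\<close>

text \<open>Origin of the exponent 1/48. The series over (\<Lambda>(n) - 1) ln n is bounded by a
  multiple of T^11 with T = 1 + |t|: three factors of size T, and two divisions by zeta, which is at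
  least c / T^4. Smoothing at width \<epsilon> costs \<epsilon>^(-11), and division by the Gaussian
  mass, proportional to \<epsilon>, makes it \<epsilon>^(-12), against a main term ln x. With
  \<epsilon> = (ln x)^(-1/24) this is harmless, and the saving left is that of a summation limit
  displaced by a factor exp (2 sqrt \<epsilon>). Any fixed power is enough. In the count of triples
  the relative error is multiplied by the sum of 1 / q over q \<le> sqrt x, which is ln ln x + O(1),
  and ln ln x times a negative power of ln x is bounded. A relative error o(1) would leave o(ln ln
  x), which need not be bounded. Zeta is not continued and no contour is moved. The Gaussian is a
  characteristic function, so smoothing is an expectation over a vertical line inside the half-plane
  of absolute convergence; zeta and its derivatives are controlled by comparing their series with
  integrals.\<close>

text \<open>The term for n = 0 vanishes, because \<^term>\<open>0 powr z = (0::complex)\<close>.\<close>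

definition dser :: "(nat \<Rightarrow> real) \<Rightarrow> complex \<Rightarrow> complex" where
  "dser a s = (\<Sum>n. of_real (a n) * of_nat n powr (-s))"

lemma norm_nat_powr: "norm (of_nat n powr (s::complex)) = real n powr Re s"
  by (cases "n = 0") (auto simp: norm_powr_real_powr)

lemma summable_ln_power_powr:
  fixes \<sigma> :: real
  assumes "\<sigma> > 1"
  shows "summable (\<lambda>n. ln (real n) ^ k * real n powr (-\<sigma>))"
proof (rule summable_comparison_test_bigo)
  have "summable (\<lambda>n. real n powr (-((1+\<sigma>)/2)))"
    using assms by (subst summable_real_powr_iff) auto
  then show "summable (\<lambda>n. norm (real n powr (-((1+\<sigma>)/2))))" by simp
  show "(\<lambda>n. ln (real n) ^ k * real n powr (-\<sigma>)) \<in> O(\<lambda>n. real n powr (-((1+\<sigma>)/2)))"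
    using assms by real_asymp
qed

lemma summable_dser_abs:
  fixes \<sigma> :: real
  assumes "\<And>n. n > 0 \<Longrightarrow> \<bar>a n\<bar> \<le> ln (real n) ^ k" "\<sigma> > 1"
  shows "summable (\<lambda>n. \<bar>a n\<bar> * real n powr (-\<sigma>))"
proof (rule summable_comparison_test)
  show "summable (\<lambda>n. ln (real n) ^ k * real n powr (-\<sigma>))"
    by (rule summable_ln_power_powr) fact
  show "\<exists>N. \<forall>n\<ge>N. norm (\<bar>a n\<bar> * real n powr (-\<sigma>)) \<le> ln (real n) ^ k * real n powr (-\<sigma>)"
    using assms(1) by (intro exI[of _ 1]) (auto intro!: mult_right_mono)
qed

lemma summable_dser_norm:
  assumes "\<And>n. n > 0 \<Longrightarrow> \<bar>a n\<bar> \<le> ln (real n) ^ k" "Re s > 1"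
  shows "summable (\<lambda>n. norm (complex_of_real (a n) * of_nat n powr (-s)))"
  using summable_dser_abs[OF assms] by (simp add: norm_mult norm_nat_powr)

lemma dser_sums:
  assumes "\<And>n. n > 0 \<Longrightarrow> \<bar>a n\<bar> \<le> ln (real n) ^ k" "Re s > 1"
  shows "(\<lambda>n. complex_of_real (a n) * of_nat n powr (-s)) sums dser a s"
  unfolding dser_def by (intro summable_sums summable_norm_cancel[OF summable_dser_norm[OF assms]])

lemma dser_has_sum:
  assumes "\<And>n. n > 0 \<Longrightarrow> \<bar>a n\<bar> \<le> ln (real n) ^ k" "Re s > 1"
  shows "((\<lambda>n. complex_of_real (a n) * of_nat n powr (-s)) has_sum dser a s) {0<..}"
proof -
  have "((\<lambda>n. complex_of_real (a n) * of_nat n powr (-s)) has_sum dser a s) UNIV"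
    by (rule norm_summable_imp_has_sum[OF summable_dser_norm[OF assms] dser_sums[OF assms]])
  then show ?thesis
    by (subst has_sum_cong_neutral[where T = UNIV]) auto
qed

text \<open>Absolute convergence allows the double series to be regrouped along n = d e, with (n, d)
  standing for the pair (d, n div d). The growth of \<open>c\<close> is a hypothesis of its own
  because a convolution does not inherit logarithmic growth: the divisor function is the convolution
  of two constant sequences.\<close>

lemma dser_mult:
  assumes a: "\<And>n. n > 0 \<Longrightarrow> \<bar>a n\<bar> \<le> ln (real n) ^ k"
    and b: "\<And>n. n > 0 \<Longrightarrow> \<bar>b n\<bar> \<le> ln (real n) ^ m" and s: "Re s > 1"
    and c: "\<And>n. n > 0 \<Longrightarrow> c n = (\<Sum>d | d dvd n. a d * b (n div d))"
    and c_bd: "\<And>n. n > 0 \<Longrightarrow> \<bar>c n\<bar> \<le> ln (real n) ^ j"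
  shows "dser a s * dser b s = dser c s"
proof -
  define A where "A = (\<lambda>n. complex_of_real (a n) * of_nat n powr (-s))"
  define B where "B = (\<lambda>n. complex_of_real (b n) * of_nat n powr (-s))"
  have hA: "(A has_sum dser a s) {0<..}" and hB: "(B has_sum dser b s) {0<..}"
    unfolding A_def B_def using dser_has_sum[OF a s] dser_has_sum[OF b s] by auto
  have sA: "A summable_on {0<..}" and sB: "B summable_on {0<..}"
    using hA hB by (auto simp: summable_on_def)
  then have nA: "(\<lambda>n. norm (A n)) summable_on {0<..}" and nB: "(\<lambda>n. norm (B n)) summable_on {0<..}"
    by (simp_all flip: summable_on_iff_abs_summable_on_complex)
  have "(\<lambda>(x,y). norm (A x * B y)) summable_on ({0<..} \<times> {0<..})"
    using Infinite_Sum.abs_summable_on_Sigma_iff[of "\<lambda>(x,y). A x * B y" "{0<..}" "\<lambda>_. {0<..}"] nA nB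
    by (simp add: norm_mult case_prod_unfold infsum_cmult_right' abs_mult summable_on_cmult_left summable_on_cmult_right)
  then have "(\<lambda>(x,y). A x * B y) summable_on ({0<..} \<times> {0<..})"
    by (subst summable_on_iff_abs_summable_on_complex) (simp add: case_prod_unfold)
  moreover have "(\<Sum>\<^sub>\<infinity>(x,y)\<in>{0<..}\<times>{0<..}. A x * B y) = dser a s * dser b s"
    using calculation
    by (subst infsum_Sigma'_banach[symmetric])
       (auto simp: infsum_cmult_right' infsum_cmult_left' infsumI[OF hA] infsumI[OF hB])
  ultimately have "((\<lambda>(x,y). A x * B y) has_sum (dser a s * dser b s)) ({0<..} \<times> {0<..})"
    using has_sum_infsum by metis
  moreover have "bij_betw (\<lambda>(n,d). (d, n div d)) (SIGMA n:{(0::nat)<..}. {d. d dvd n}) ({0<..} \<times> {0<..})"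
    by (rule bij_betwI[where g = "\<lambda>(d,e). (d * e, d)"]) (auto simp: div_greater_zero_iff dvd_imp_le dest: dvd_pos_nat)
  ultimately have "((\<lambda>(n,d). A d * B (n div d)) has_sum (dser a s * dser b s)) (SIGMA n:{0<..}. {d. d dvd n})"
    using has_sum_reindex_bij_betw[of "\<lambda>(n,d). (d, n div d)" "SIGMA n:{0<..}. {d. d dvd n}" "{0<..} \<times> {0<..}"
        "\<lambda>(x,y). A x * B y"] by (simp add: case_prod_unfold)
  then have "((\<lambda>n. \<Sum>d | d dvd n. A d * B (n div d)) has_sum (dser a s * dser b s)) {0<..}"
    by (rule has_sum_SigmaD) (auto intro!: has_sum_finite)
  moreover have "(\<Sum>d | d dvd n. A d * B (n div d)) = of_real (c n) * of_nat n powr (-s)"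
    if "n > 0" for n
  proof -
    have "A d * B (n div d) = of_real (a d * b (n div d)) * of_nat n powr (-s)" if "d dvd n" for d
    proof -
      obtain e where e: "n = d * e" using \<open>d dvd n\<close> by auto
      with \<open>n > 0\<close> have "d > 0" "e > 0" by (auto intro: Nat.gr0I)
      then show ?thesis
        unfolding A_def B_def e by (simp add: powr_times_real)
    qed
    then show ?thesis using \<open>n > 0\<close> by (simp add: c sum_distrib_right)
  qed
  ultimately have "((\<lambda>n. of_real (c n) * of_nat n powr (-s)) has_sum (dser a s * dser b s)) {0<..}"
    by (subst has_sum_cong[symmetric]) auto
  moreover have "((\<lambda>n. of_real (c n) * of_nat n powr (-s)) has_sum dser c s) {0<..}"
    using dser_has_sum[OF c_bd s] by simp
  ultimately show ?thesis by (rule has_sum_unique)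
qed

lemma has_field_derivative_dser:
  assumes a: "\<And>n. n > 0 \<Longrightarrow> \<bar>a n\<bar> \<le> ln (real n) ^ k" and s: "Re s > 1"
  shows "(dser a has_field_derivative - dser (\<lambda>n. a n * ln (real n)) s) (at s)"
proof -
  \<comment> \<open>Halfway between 1 and Re s, so that the terms have one summable majorant on an
    open half-plane around \<open>s\<close>.\<close>
  define \<sigma> where "\<sigma> = (1 + Re s) / 2"
  define S where "S = {s. Re s > \<sigma>}"
  have \<sigma>: "\<sigma> > 1" "\<sigma> < Re s" using s by (auto simp: \<sigma>_def)
  have a': "\<bar>a n * ln (real n)\<bar> \<le> ln (real n) ^ Suc k" if "n > 0" for n
    using mult_right_mono[OF a[OF that], of "ln (real n)"] that by (simp add: abs_mult mult_ac)
  have S: "open S" unfolding S_def by (rule open_halfspace_Re_gt)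
  obtain g g' where gg: "\<forall>x\<in>S. ((\<lambda>n. of_real (a n) * of_nat n powr (-x)) sums g x) \<and>
      ((\<lambda>n. of_real (a n) * (- of_real (ln (real n)) * of_nat n powr (-x))) sums g' x) \<and>
      (g has_field_derivative g' x) (at x)"
  proof (rule series_and_derivative_comparison[OF S])
    show "summable (\<lambda>n. \<bar>a n\<bar> * real n powr (-\<sigma>))"
      by (rule summable_dser_abs[OF a \<sigma>(1)])
    show "((\<lambda>x. complex_of_real (a n) * of_nat n powr (-x)) has_field_derivative
        of_real (a n) * (- of_real (ln (real n)) * of_nat n powr (-x))) (at x)" for n and x :: complex
    proof (cases "n = 0")
      case False
      have "((\<lambda>x. exp (-x * of_real (ln (real n)))) has_field_derivative
          - of_real (ln (real n)) * exp (-x * of_real (ln (real n)))) (at x)"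
        by (auto intro!: derivative_eq_intros)
      then have "((\<lambda>x. of_nat n powr (-x)) has_field_derivative
          - of_real (ln (real n)) * of_nat n powr (-x)) (at x)"
        using False by (simp add: powr_def Ln_of_nat)
      then show ?thesis by (rule DERIV_cmult)
    qed auto
    show "\<forall>\<^sub>F n in sequentially. \<forall>y\<in>S. norm (of_real (a n) * of_nat n powr (-y)) \<le> \<bar>a n\<bar> * real n powr (-\<sigma>)"
      using eventually_gt_at_top[of 0]
      by eventually_elim (auto simp: norm_mult norm_nat_powr S_def intro!: mult_left_mono powr_mono)
  qed blast
  have g: "(\<lambda>n. of_real (a n) * of_nat n powr (-x)) sums g x"
      "(\<lambda>n. of_real (a n) * (- of_real (ln (real n)) * of_nat n powr (-x))) sums g' x"
      "(g has_field_derivative g' x) (at x)" if "x \<in> S" for x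
    using gg that by blast+
  have sS: "s \<in> S" using \<sigma> by (simp add: S_def)
  have "g x = dser a x" if "x \<in> S" for x
    using sums_unique2[OF g(1)[OF that] dser_sums[OF a]] that \<sigma> by (simp add: S_def)
  moreover have "g' s = - dser (\<lambda>n. a n * ln (real n)) s"
  proof (rule sums_unique2)
    show "(\<lambda>n. - (of_real (a n * ln (real n)) * of_nat n powr (-s))) sums g' s"
      using g(2)[OF sS] by (simp add: mult_ac)
  qed (rule sums_minus[OF dser_sums[OF a' s]])
  ultimately show ?thesis
    using has_field_derivative_transform_within_open[OF g(3)[OF sS] S sS, of "dser a"] by simp
qed

section \<open>The zeta function near the line of abscissa one\<close>

text \<open>On Re s > 1 this is (-1)^k times the k-th derivative of the Riemann zeta
  function.\<close>

definition zsum :: "nat \<Rightarrow> complex \<Rightarrow> complex" where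
  "zsum k = dser (\<lambda>n. ln (real n) ^ k)"

text \<open>Up to the factor 2 + |s|, the n-th term dominates the derivative of ln^k u u^(-s) on
  [n + 1, n + 2] for k \<le> 2; the sum is the total error of replacing the series by an
  integral.\<close>

definition zeta_err :: real where
  "zeta_err = (\<Sum>n. (1 + ln (real (n + 2)))\<^sup>2 / (real (n + 1))\<^sup>2)"

lemma summable_zeta_err: "summable (\<lambda>n. (1 + ln (real (n + 2)))\<^sup>2 / (real (n + 1))\<^sup>2)"
proof (rule summable_comparison_test_bigo)
  have "summable (\<lambda>n. real n powr (-3/2))"
    by (subst summable_real_powr_iff) auto
  then show "summable (\<lambda>n. norm (real n powr (-3/2)))" by simp
  show "(\<lambda>n. (1 + ln (real (n + 2)))\<^sup>2 / (real (n + 1))\<^sup>2) \<in> O(\<lambda>n. real n powr (-3/2))"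
    by real_asymp
qed

text \<open>
  The premise on \<^term>\<open>p\<close> says that -u^(1-s) p(ln u) is an antiderivative of ln^k u u^(-s).
\<close>

lemma zsum_approx_aux:
  fixes p p' :: "real \<Rightarrow> complex"
  assumes s: "1 < Re s" and k: "k \<le> 2"
    and p: "\<And>l. (p has_vector_derivative p' l) (at l)"
    and pp': "\<And>l. (s - 1) * p l - p' l = of_real l ^ k"
    and M: "\<And>l. l \<ge> 0 \<Longrightarrow> norm (p l) \<le> M * (1 + l)\<^sup>2"
  shows "norm (zsum k s - p 0) \<le> (2 + norm s) * zeta_err"
proof -
  define E where "E = (\<lambda>u::real. exp (- s * of_real (ln u)))"
  define f where "f = (\<lambda>u::real. of_real (ln u ^ k) * E u)"
  define \<Phi> where "\<Phi> = (\<lambda>u::real. - (of_real u * E u * p (ln u)))"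
  define f' where "f' = (\<lambda>u::real. of_real (real k * ln u ^ (k - 1) / u) * E u - of_real (ln u ^ k / u) * s * E u)"
  have E: "(E has_vector_derivative - (s / of_real u) * E u) (at u within S)" if "u > 0" for u S
  proof -
    have "((\<lambda>u. - s * of_real (ln u)) has_vector_derivative - s * of_real (1 / u)) (at u within S)"
      using that
      by (intro has_vector_derivative_mult_right has_vector_derivative_of_real)
         (auto intro!: derivative_eq_intros simp flip: has_real_derivative_iff_has_vector_derivative simp: divide_inverse)
    then have "((exp \<circ> (\<lambda>u. - s * of_real (ln u))) has_vector_derivative (- s * of_real (1 / u)) * exp (- s * of_real (ln u))) (at u within S)"
      by (rule field_vector_diff_chain_within) (auto intro!: derivative_eq_intros)
    then show ?thesis by (simp add: E_def o_def)
  qed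
  have f: "(f has_vector_derivative f' u) (at u within S)" if "u > 0" for u S
  proof -
    have "((\<lambda>u. ln u ^ k) has_real_derivative real k * ln u ^ (k - 1) / u) (at u within S)"
      using that by (auto intro!: derivative_eq_intros)
    then have "((\<lambda>u. of_real (ln u ^ k) :: complex) has_vector_derivative of_real (real k * ln u ^ (k - 1) / u)) (at u within S)"
      by (rule has_vector_derivative_of_real)
    from has_vector_derivative_mult[OF this E[OF that, of S]]
    show ?thesis unfolding f_def f'_def
      by (rule has_vector_derivative_eq_rhs) (simp add: algebra_simps)
  qed
  have Phi: "(\<Phi> has_vector_derivative f u) (at u within S)" if u: "u > 0" for u S
  proof -
    have "((p \<circ> ln) has_vector_derivative ((1 / u) *\<^sub>R p' (ln u))) (at u within S)"
      by (rule vector_diff_chain_within)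
        (use u p in \<open>auto intro!: derivative_eq_intros simp: has_vector_derivative_at_within simp flip: has_real_derivative_iff_has_vector_derivative\<close>)
    then have "((\<lambda>u. p (ln u)) has_vector_derivative ((1 / u) *\<^sub>R p' (ln u))) (at u within S)"
      by (simp add: o_def)
    then have "(\<Phi> has_vector_derivative 
      - (of_real u * E u * ((1 / u) *\<^sub>R p' (ln u)) + (of_real u * (- (s / of_real u) * E u) + of_real 1 * E u) * p (ln u))) (at u within S)"
      unfolding \<Phi>_def using u
      by (intro has_vector_derivative_minus has_vector_derivative_mult E has_vector_derivative_of_real)
         (auto intro!: derivative_eq_intros)
    also have "- (of_real u * E u * ((1 / u) *\<^sub>R p' (ln u)) + (of_real u * (- (s / of_real u) * E u) + of_real 1 * E u) * p (ln u))
       = E u * ((s - 1) * p (ln u) - p' (ln u))"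
      using u by (simp add: scaleR_conv_of_real field_simps)
    also have "\<dots> = f u"
      by (simp add: pp' f_def)
    finally show ?thesis .
  qed
  have nE: "norm (E u) = u powr (- Re s)" if "u > 0" for u
    using that by (simp add: E_def powr_def)
  have f'_le: "norm (f' u) \<le> (2 + norm s) * ((1 + ln (real (n + 2)))\<^sup>2 / (real (n + 1))\<^sup>2)"
    if u: "u \<in> {real (n+1)..real (n+2)}" for n u
  proof -
    have u1: "u \<ge> 1" using u by auto
    define l where "l = 1 + ln (real (n + 2))"
    have l: "ln u \<ge> 0" "1 + ln u \<le> l" "1 \<le> l"
      using u u1 by (auto simp: l_def)
    have "k = 0 \<or> k = 1 \<or> k = 2" using k by auto
    then have lk: "ln u ^ k \<le> l\<^sup>2" "real k * ln u ^ (k-1) \<le> 2 * l\<^sup>2"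
      using l mult_mono[of "ln u" l "ln u" l] mult_mono[of 1 l "ln u" l] mult_mono[of 1 l 1 l]
      by (auto simp: power2_eq_square)
    have "norm (f' u) \<le> (real k * ln u ^ (k-1)) * (u powr (- Re s) / u) + ln u ^ k * norm s * (u powr (- Re s) / u)"
      unfolding f'_def using u1 l nE[of u]
      by (intro order_trans[OF norm_triangle_ineq4]) (auto simp: norm_mult norm_divide norm_power)
    also have "\<dots> \<le> 2 * l\<^sup>2 * (u powr (- Re s) / u) + l\<^sup>2 * norm s * (u powr (- Re s) / u)"
      using lk u1 by (intro add_mono mult_right_mono) auto
    also have "\<dots> = (2 + norm s) * l\<^sup>2 * (u powr (- Re s) / u)" by (simp add: algebra_simps)
    also have "u powr (- Re s) / u \<le> 1 / (real (n+1))\<^sup>2"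
    proof -
      have "u powr (- Re s) \<le> u powr (-1)" using u1 s by (intro powr_mono) auto
      then have "u powr (- Re s) / u \<le> 1 / u / u" 
        using u1 by (intro divide_right_mono) (auto simp: powr_minus divide_inverse)
      also have "\<dots> = 1 / u\<^sup>2" by (simp add: power2_eq_square)
      also have "\<dots> \<le> 1 / (real (n+1))\<^sup>2" using u by (intro divide_left_mono power_mono) auto
      finally show ?thesis .
    qed
    finally show ?thesis unfolding l_def[symmetric] by (simp add: mult_left_mono)
  qed
  have diff: "norm (f (real (n+1)) - (\<Phi> (real (n+2)) - \<Phi> (real (n+1))))
      \<le> (2 + norm s) * ((1 + ln (real (n + 2)))\<^sup>2 / (real (n + 1))\<^sup>2)" (is "_ \<le> ?B") for n
  proof -
    have *: "norm (f u - f (real (n+1))) \<le> ?B" if u: "u \<in> {real (n+1)..real (n+2)}" for u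
    proof -
      have "norm (f u - f (real (n+1))) \<le> ?B * norm (u - real (n+1))"
      proof (rule differentiable_bound[where S = "{real (n+1)..real (n+2)}" and f' = "\<lambda>u h. h *\<^sub>R f' u"])
        show "(f has_derivative (\<lambda>h. h *\<^sub>R f' x)) (at x within {real (n + 1)..real (n + 2)})"
          if "x \<in> {real (n + 1)..real (n + 2)}" for x
          using f[of x] that by (auto simp: has_vector_derivative_def)
        show "onorm (\<lambda>h. h *\<^sub>R f' x) \<le> ?B" if "x \<in> {real (n + 1)..real (n + 2)}" for x
        proof (rule onorm_le)
          show "norm (h *\<^sub>R f' x) \<le> ?B * norm h" for h
            using mult_left_mono[OF f'_le[OF that], of "\<bar>h\<bar>"]
            by (simp only: norm_scaleR real_norm_def mult.commute abs_ge_zero)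
        qed
      qed (use u in auto)
      also have "\<dots> \<le> ?B * 1"
        using u by (intro mult_left_mono) auto
      finally show ?thesis by simp
    qed
    \<comment> \<open>The derivative of \<open>h\<close> is f u - f (n + 1), which has just been
      bounded. A second mean value estimate thus compares f (n + 1) with the increment of the
      antiderivative, without any integration.\<close>
    define h where "h = (\<lambda>u::real. \<Phi> u - of_real u * f (real (n+1)))"
    have "norm (h (real (n+2)) - h (real (n+1))) \<le> ?B * norm (real (n+2) - real (n+1))"
    proof (rule differentiable_bound[where S = "{real (n+1)..real (n+2)}" and f' = "\<lambda>u y. y *\<^sub>R (f u - f (real (n+1)))"])
      show "(h has_derivative (\<lambda>y. y *\<^sub>R (f x - f (real (n+1))))) (at x within {real (n + 1)..real (n + 2)})"
        if "x \<in> {real (n + 1)..real (n + 2)}" for x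
        unfolding h_def has_vector_derivative_def[symmetric]
        using that by (auto intro!: derivative_eq_intros Phi)
      show "onorm (\<lambda>y. y *\<^sub>R (f x - f (real (n+1)))) \<le> ?B" if "x \<in> {real (n + 1)..real (n + 2)}" for x
      proof (rule onorm_le)
        show "norm (h *\<^sub>R (f x - f (real (n+1)))) \<le> ?B * norm h" for h
          using mult_left_mono[OF *[OF that], of "\<bar>h\<bar>"]
          by (simp only: norm_scaleR real_norm_def mult.commute abs_ge_zero)
      qed
    qed auto
    also have "h (real (n+2)) - h (real (n+1)) = - (f (real (n+1)) - (\<Phi> (real (n+2)) - \<Phi> (real (n+1))))"
      by (simp add: h_def algebra_simps)
    finally show ?thesis by (simp only: norm_minus_cancel) simp
  qed
  have lim: "(\<lambda>n. \<Phi> (real (n+1))) \<longlonglongrightarrow> 0"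
  proof (rule Lim_null_comparison)
    show "\<forall>\<^sub>F n in sequentially. norm (\<Phi> (real (n+1))) \<le> real (n+1) powr (1 - Re s) * (M * (1 + ln (real (n+1)))\<^sup>2)"
    proof (rule always_eventually, rule allI)
      fix n
      have "norm (\<Phi> u) = u powr (1 - Re s) * norm (p (ln u))" if "u > 0" for u
        using nE[of u] that by (simp add: \<Phi>_def norm_mult powr_diff powr_minus divide_inverse)
      from this[of "real (n+1)"]
      have "norm (\<Phi> (real (n+1))) = real (n+1) powr (1 - Re s) * norm (p (ln (real (n+1))))"
        by simp
      also have "\<dots> \<le> real (n+1) powr (1 - Re s) * (M * (1 + ln (real (n+1)))\<^sup>2)"
        by (intro mult_left_mono M) auto
      finally show "norm (\<Phi> (real (n+1))) \<le> \<dots>" .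
    qed
    have "(\<lambda>n. real (n+1) powr (1 - Re s) * (1 + ln (real (n+1)))\<^sup>2) \<longlonglongrightarrow> 0"
      using s by real_asymp
    from tendsto_mult_left[OF this, of M]
    show "(\<lambda>n. real (n+1) powr (1 - Re s) * (M * (1 + ln (real (n+1)))\<^sup>2)) \<longlonglongrightarrow> 0"
      by (simp add: mult_ac)
  qed
  \<comment> \<open>The increments of \<open>\<Phi>\<close> telescope to the value of the integral
    over u \<ge> 1, which is - \<Phi> 1 = p 0.\<close>
  have "(\<lambda>n. \<Phi> (real (Suc n + 1)) - \<Phi> (real (n + 1))) sums (0 - \<Phi> (real (0 + 1)))"
    by (rule telescope_sums[OF lim])
  then have S2: "(\<lambda>n. \<Phi> (real (n + 2)) - \<Phi> (real (n + 1))) sums p 0"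
    by (simp add: \<Phi>_def E_def)
  have "(\<lambda>n. complex_of_real (ln (real n) ^ k) * of_nat n powr (-s)) sums zsum k s"
    unfolding zsum_def by (rule dser_sums[OF _ s]) auto
  then have "(\<lambda>n. complex_of_real (ln (real (Suc n)) ^ k) * of_nat (Suc n) powr (-s)) sums zsum k s"
    by (subst sums_Suc_iff) auto
  then have S1: "(\<lambda>n. f (real (n+1))) sums zsum k s"
    unfolding f_def E_def powr_def by (simp add: Ln_of_nat flip: of_nat_Suc)
  have S3: "(\<lambda>n. f (real (n+1)) - (\<Phi> (real (n + 2)) - \<Phi> (real (n + 1)))) sums (zsum k s - p 0)"
    by (rule sums_diff[OF S1 S2])
  have sB: "summable (\<lambda>n. (2 + norm s) * ((1 + ln (real (n + 2)))\<^sup>2 / (real (n + 1))\<^sup>2))"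
    by (rule summable_mult[OF summable_zeta_err])
  have "norm (zsum k s - p 0) \<le> (\<Sum>n. (2 + norm s) * ((1 + ln (real (n + 2)))\<^sup>2 / (real (n + 1))\<^sup>2))"
    unfolding sums_unique[OF S3] by (rule norm_suminf_le[OF diff sB])
  also have "\<dots> = (2 + norm s) * zeta_err"
    unfolding zeta_err_def by (rule suminf_mult[OF summable_zeta_err])
  finally show ?thesis .
qed

text \<open>Repeated integration by parts yields the polynomials \<open>p\<close>, with w = s - 1;
  at l = 0 only the polar part k! / w^(k+1) is left. The errors grow linearly in |s| and stay
  bounded as Re s \<rightarrow> 1, so zeta is controlled up to the line Re s = 1 from within the
  half-plane.\<close>

lemma zsum_approx:
  assumes s: "1 < Re s"
  shows "norm (zsum 0 s - 1 / (s - 1)) \<le> (2 + norm s) * zeta_err"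
    and "norm (zsum 1 s - 1 / (s - 1)\<^sup>2) \<le> (2 + norm s) * zeta_err"
    and "norm (zsum 2 s - 2 / (s - 1) ^ 3) \<le> (2 + norm s) * zeta_err"
proof -
  define w where "w = s - 1"
  have w: "w \<noteq> 0" using s by (auto simp: w_def)
  have l: "1 \<le> (1 + l)\<^sup>2" "l \<le> (1 + l)\<^sup>2" "l\<^sup>2 \<le> (1 + l)\<^sup>2" if "l \<ge> 0" for l :: real
    using that by (auto simp: power2_eq_square algebra_simps)
  have "norm (zsum 0 s - 1 / w) \<le> (2 + norm s) * zeta_err"
  proof (rule zsum_approx_aux[where p = "\<lambda>_. 1 / w" and p' = "\<lambda>_. 0" and M = "norm (1 / w)"])
    show "norm (1 / w) \<le> norm (1 / w) * (1 + l)\<^sup>2" if "l \<ge> 0" for l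
      using mult_left_mono[OF l(1)[OF that], of "norm (1 / w)"] by simp
  qed (use w s in \<open>auto simp flip: w_def\<close>)
  moreover have "norm (zsum 1 s - (of_real 0 / w + 1 / w\<^sup>2)) \<le> (2 + norm s) * zeta_err"
  proof (rule zsum_approx_aux[where p = "\<lambda>l. of_real l / w + 1 / w\<^sup>2" and p' = "\<lambda>_. 1 / w" and M = "norm (1 / w) + norm (1 / w\<^sup>2)"])
    show "norm (of_real l / w + 1 / w\<^sup>2) \<le> (norm (1 / w) + norm (1 / w\<^sup>2)) * (1 + l)\<^sup>2" if "l \<ge> 0" for l
    proof -
      have "norm (of_real l / w + 1 / w\<^sup>2) \<le> norm (1 / w) * l + norm (1 / w\<^sup>2) * 1"
        using that by (intro order_trans[OF norm_triangle_ineq]) (simp add: norm_divide)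
      also have "\<dots> \<le> norm (1 / w) * (1 + l)\<^sup>2 + norm (1 / w\<^sup>2) * (1 + l)\<^sup>2"
        by (intro add_mono mult_left_mono l that norm_ge_zero)
      finally show ?thesis by (simp add: algebra_simps)
    qed
    show "((\<lambda>l. of_real l / w + 1 / w\<^sup>2) has_vector_derivative 1 / w) (at l)" for l
      by (auto intro!: derivative_eq_intros)
    show "(s - 1) * (of_real l / w + 1 / w\<^sup>2) - 1 / w = of_real l ^ 1" for l
      using w by (simp flip: w_def add: field_simps power2_eq_square)
  qed (use w s in \<open>auto simp flip: w_def\<close>)
  moreover have "norm (zsum 2 s - (of_real 0 ^ 2 / w + 2 * of_real 0 / w\<^sup>2 + 2 / w ^ 3)) \<le> (2 + norm s) * zeta_err"
  proof (rule zsum_approx_aux[where p = "\<lambda>l. of_real l ^ 2 / w + 2 * of_real l / w\<^sup>2 + 2 / w ^ 3" and p' = "\<lambda>l. 2 * of_real l / w + 2 / w\<^sup>2"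
        and M = "norm (1 / w) + norm (2 / w\<^sup>2) + norm (2 / w ^ 3)"])
    show "norm (of_real l ^ 2 / w + 2 * of_real l / w\<^sup>2 + 2 / w ^ 3) \<le> (norm (1 / w) + norm (2 / w\<^sup>2) + norm (2 / w ^ 3)) * (1 + l)\<^sup>2" if "l \<ge> 0" for l
    proof -
      have "norm (of_real l ^ 2 / w + 2 * of_real l / w\<^sup>2 + 2 / w ^ 3) \<le> norm (1 / w) * l\<^sup>2 + norm (2 / w\<^sup>2) * l + norm (2 / w ^ 3) * 1"
        using that by (intro norm_triangle_le add_mono) (auto simp: norm_divide norm_mult norm_power)
      also have "\<dots> \<le> norm (1 / w) * (1 + l)\<^sup>2 + norm (2 / w\<^sup>2) * (1 + l)\<^sup>2 + norm (2 / w ^ 3) * (1 + l)\<^sup>2"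
        by (intro add_mono mult_left_mono l that norm_ge_zero)
      finally show ?thesis by (simp add: algebra_simps)
    qed
    show "((\<lambda>l. of_real l ^ 2 / w + 2 * of_real l / w\<^sup>2 + 2 / w ^ 3) has_vector_derivative 2 * of_real l / w + 2 / w\<^sup>2) (at l)" for l
    proof -
      have "((\<lambda>l. of_real (l ^ 2) :: complex) has_vector_derivative of_real (2 * l)) (at l)"
        by (rule has_vector_derivative_of_real) (auto intro!: derivative_eq_intros)
      then have 1: "((\<lambda>l. of_real l ^ 2 :: complex) has_vector_derivative 2 * of_real l) (at l)" by simp
      show ?thesis by (rule derivative_eq_intros 1 refl)+ (simp add: divide_inverse)
    qed
    show "(s - 1) * (of_real l ^ 2 / w + 2 * of_real l / w\<^sup>2 + 2 / w ^ 3) - (2 * of_real l / w + 2 / w\<^sup>2) = of_real l ^ 2" for l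
      using w by (simp flip: w_def add: field_simps power2_eq_square power3_eq_cube)
  qed (use w s in \<open>auto simp flip: w_def\<close>)
  ultimately show "norm (zsum 0 s - 1 / (s - 1)) \<le> (2 + norm s) * zeta_err"
    and "norm (zsum 1 s - 1 / (s - 1)\<^sup>2) \<le> (2 + norm s) * zeta_err"
    and "norm (zsum 2 s - 2 / (s - 1) ^ 3) \<le> (2 + norm s) * zeta_err"
    by (auto simp: w_def)
qed

lemma dser_add:
  assumes "\<And>n. n > 0 \<Longrightarrow> \<bar>a n\<bar> \<le> ln (real n) ^ k" "\<And>n. n > 0 \<Longrightarrow> \<bar>b n\<bar> \<le> ln (real n) ^ m" "Re s > 1"
  shows "dser a s + dser b s = dser (\<lambda>n. a n + b n) s"
  unfolding dser_def using summable_norm_cancel[OF summable_dser_norm[OF assms(1,3)]]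
    summable_norm_cancel[OF summable_dser_norm[OF assms(2,3)]]
  by (subst suminf_add) (auto simp: algebra_simps)

lemma dser_diff:
  assumes "\<And>n. n > 0 \<Longrightarrow> \<bar>a n\<bar> \<le> ln (real n) ^ k" "\<And>n. n > 0 \<Longrightarrow> \<bar>b n\<bar> \<le> ln (real n) ^ m" "Re s > 1"
  shows "dser a s - dser b s = dser (\<lambda>n. a n - b n) s"
  unfolding dser_def using summable_norm_cancel[OF summable_dser_norm[OF assms(1,3)]]
    summable_norm_cancel[OF summable_dser_norm[OF assms(2,3)]]
  by (subst suminf_diff) (auto simp: algebra_simps)

lemma has_field_derivative_zsum:
  assumes "Re s > 1"
  shows "(zsum k has_field_derivative - zsum (Suc k) s) (at s)"
  using has_field_derivative_dser[of "\<lambda>n. ln (real n) ^ k" k s] assms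
  by (simp add: zsum_def mult.commute)

section \<open>Identities for the series of the von Mangoldt function\<close>

lemma mangoldt_abs_le: "n > 0 \<Longrightarrow> \<bar>mangoldt n :: real\<bar> \<le> ln (real n) ^ 1"
  using mangoldt_le[of n] by simp

lemma mangoldt_ln_abs_le: "n > 0 \<Longrightarrow> \<bar>mangoldt n * ln (real n) :: real\<bar> \<le> ln (real n) ^ 2"
  using mangoldt_le[of n] by (simp add: abs_mult power2_eq_square mult_right_mono)

lemma mangoldt_zsum:
  assumes s: "Re s > 1"
  shows "dser mangoldt s * zsum 0 s = zsum 1 s"
  unfolding zsum_def
  by (rule dser_mult[OF mangoldt_abs_le _ s, where m = 0 and j = 1]) (auto simp: mangoldt_sum)

text \<open>On the level of coefficients, ln^2 is the convolution of \<Lambda> ln with 1 plus that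
  of \<Lambda> with ln, because ln d + ln (n / d) = ln n and \<Lambda> convolved with 1 is ln. Both
  convolutions are non-negative, so each is at most ln^2 n; this is the growth bound that
  \<open>dser_mult\<close> requires.\<close>

lemma mangoldt_ln_zsum:
  assumes s: "Re s > 1"
  shows "dser (\<lambda>n. mangoldt n * ln (real n)) s * zsum 0 s + dser mangoldt s * zsum 1 s = zsum 2 s"
proof -
  define c1 where "c1 = (\<lambda>n. \<Sum>d | d dvd n. mangoldt d * ln (real d) :: real)"
  define c2 where "c2 = (\<lambda>n. \<Sum>d | d dvd n. mangoldt d * ln (real (n div d)) :: real)"
  have sum: "c1 n + c2 n = ln (real n) ^ 2" if "n > 0" for n
  proof -
    have "c1 n + c2 n = (\<Sum>d | d dvd n. mangoldt d * ln (real n))"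
      unfolding c1_def c2_def sum.distrib[symmetric]
    proof (intro sum.cong refl)
      fix d assume "d \<in> {d. d dvd n}"
      then obtain e where e: "n = d * e" by auto
      with that have "d > 0" "e > 0" by (auto intro: Nat.gr0I)
      then show "mangoldt d * ln (real d) + mangoldt d * ln (real (n div d)) = mangoldt d * ln (real n)"
        by (simp add: e ln_mult algebra_simps)
    qed
    also have "\<dots> = ln (real n) * ln (real n)"
      using that mangoldt_sum[of n, where 'a = real] by (simp flip: sum_distrib_right)
    finally show ?thesis by (simp add: power2_eq_square)
  qed
  have pos: "c1 n \<ge> 0" "c2 n \<ge> 0" if "n > 0" for n
  proof -
    have "d > 0 \<and> n div d > 0" if "d dvd n" for d
      using that \<open>n > 0\<close> by (auto simp: div_greater_zero_iff dvd_imp_le dest: dvd_pos_nat)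
    then show "c1 n \<ge> 0" "c2 n \<ge> 0"
      unfolding c1_def c2_def
      by (auto intro!: sum_nonneg mult_nonneg_nonneg mangoldt_nonneg ln_ge_zero simp: Suc_le_eq simp del: div_greater_zero_iff)
  qed
  have bd: "\<bar>c1 n\<bar> \<le> ln (real n) ^ 2" "\<bar>c2 n\<bar> \<le> ln (real n) ^ 2" if "n > 0" for n
    using pos[OF that] sum[OF that] by auto
  have "dser (\<lambda>n. mangoldt n * ln (real n)) s * zsum 0 s = dser c1 s"
    unfolding zsum_def by (rule dser_mult[OF mangoldt_ln_abs_le _ s _ bd(1), where m = 0]) (auto simp: c1_def)
  moreover have "dser mangoldt s * zsum 1 s = dser c2 s"
    unfolding zsum_def by (rule dser_mult[OF mangoldt_abs_le _ s _ bd(2), where m = 1]) (auto simp: c2_def)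
  moreover have "dser c1 s + dser c2 s = dser (\<lambda>n. c1 n + c2 n) s"
    by (rule dser_add[OF bd(1) bd(2) s])
  moreover have "dser (\<lambda>n. c1 n + c2 n) s = zsum 2 s"
    unfolding zsum_def dser_def
  proof (rule suminf_cong)
    show "complex_of_real (c1 n + c2 n) * of_nat n powr - s = complex_of_real (ln (real n) ^ 2) * of_nat n powr - s" for n
      using sum[of n] by (cases "n = 0") auto
  qed
  ultimately show ?thesis by simp
qed

section \<open>The 3-4-1 inequality\<close>

lemma norm_zsum_0_minus_1:
  assumes "Re s \<ge> 2"
  shows "norm (zsum 0 s - 1) \<le> 2 powr (2 - Re s) * (\<Sum>n. 1 / (real (n + 2))\<^sup>2)"
proof -
  have "summable (\<lambda>n. 1 / real n ^ 2)"
    using inverse_power_summable[of 2, where 'a = real] by (simp add: inverse_eq_divide)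
  then have summ: "summable (\<lambda>n. 1 / (real (n + 2))\<^sup>2)"
    by (subst summable_iff_shift)
  have "(\<lambda>n. of_nat n powr (-s)) sums zsum 0 s"
    using dser_sums[of "\<lambda>n. ln (real n) ^ 0" 0 s] assms by (simp add: zsum_def)
  then have "(\<lambda>n. of_nat (n + 2) powr (-s)) sums (zsum 0 s - (\<Sum>n<2. of_nat n powr (-s)))"
    by (subst sums_iff_shift')
  also have "(\<Sum>n<2. of_nat n powr (-s)) = 1"
    by (simp add: numeral_2_eq_2)
  finally have S: "(\<lambda>n. of_nat (n + 2) powr (-s)) sums (zsum 0 s - 1)" .
  have "norm (of_nat (n + 2) powr (-s)) \<le> 2 powr (2 - Re s) * (1 / (real (n + 2))\<^sup>2)" for n
  proof -
    have "norm (of_nat (n + 2) powr (-s)) = real (n + 2) powr (- Re s)"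
      by (simp only: norm_nat_powr) simp
    also have "\<dots> = real (n + 2) powr (2 - Re s) * real (n + 2) powr (-2)"
      by (simp flip: powr_add)
    also have "real (n + 2) powr (2 - Re s) \<le> 2 powr (2 - Re s)"
      using assms by (intro powr_mono2') auto
    also have "real (n + 2) powr (-2) = 1 / (real (n + 2))\<^sup>2"
      by (simp add: powr_minus divide_inverse)
    finally show ?thesis by (simp add: divide_right_mono)
  qed
  then have "norm (zsum 0 s - 1) \<le> (\<Sum>n. 2 powr (2 - Re s) * (1 / (real (n + 2))\<^sup>2))"
    unfolding sums_unique[OF S] by (rule norm_suminf_le[OF _ summable_mult[OF summ]])
  also have "\<dots> = 2 powr (2 - Re s) * (\<Sum>n. 1 / (real (n + 2))\<^sup>2)"
    by (rule suminf_mult[OF summ])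
  finally show ?thesis .
qed

lemma zsum_0_tendsto_1: "((\<lambda>\<sigma>. zsum 0 (Complex \<sigma> t)) \<longlongrightarrow> 1) at_top"
proof -
  have "((\<lambda>\<sigma>. zsum 0 (Complex \<sigma> t) - 1) \<longlongrightarrow> 0) at_top"
  proof (rule Lim_null_comparison)
    show "\<forall>\<^sub>F \<sigma> in at_top. norm (zsum 0 (Complex \<sigma> t) - 1) \<le> 2 powr (2 - \<sigma>) * (\<Sum>n. 1 / (real (n + 2))\<^sup>2)"
      using eventually_ge_at_top[of 2]
    proof eventually_elim
      case (elim \<sigma>)
      then show ?case using norm_zsum_0_minus_1[of "Complex \<sigma> t"] by simp
    qed
    have "((\<lambda>\<sigma>::real. 2 powr (2 - \<sigma>)) \<longlongrightarrow> 0) at_top" by real_asymp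
    then show "((\<lambda>\<sigma>::real. 2 powr (2 - \<sigma>) * (\<Sum>n. 1 / (real (n + 2))\<^sup>2)) \<longlongrightarrow> 0) at_top"
      by (rule tendsto_mult_left_zero)
  qed
  then show ?thesis by (simp add: LIM_zero_iff)
qed

lemma zsum_norm2_derivative:
  assumes "\<sigma> > 1"
  shows "((\<lambda>\<sigma>. (norm (zsum 0 (Complex \<sigma> t)))\<^sup>2) has_real_derivative
      - 2 * Re (dser mangoldt (Complex \<sigma> t)) * (norm (zsum 0 (Complex \<sigma> t)))\<^sup>2) (at \<sigma>)"
proof -
  define s where "s = Complex \<sigma> t"
  have s: "Re s > 1" using assms by (simp add: s_def)
  define z where "z = zsum 0 s"
  define d where "d = - zsum 1 s"
  have "((\<lambda>\<sigma>. Complex \<sigma> t) has_vector_derivative 1) (at \<sigma>)"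
    unfolding Complex_eq by (auto intro!: derivative_eq_intros)
  moreover have "(zsum 0 has_field_derivative d) (at (Complex \<sigma> t))"
    using has_field_derivative_zsum[OF s, of 0] by (simp add: d_def s_def)
  ultimately have "((zsum 0 \<circ> (\<lambda>\<sigma>. Complex \<sigma> t)) has_vector_derivative (1 * d)) (at \<sigma>)"
    by (rule field_vector_diff_chain_at)
  then have h: "((\<lambda>\<sigma>. zsum 0 (Complex \<sigma> t)) has_vector_derivative d) (at \<sigma>)" by (simp add: o_def)
  have "((\<lambda>\<sigma>. Re (zsum 0 (Complex \<sigma> t))) has_real_derivative Re d) (at \<sigma>)"
       "((\<lambda>\<sigma>. Im (zsum 0 (Complex \<sigma> t))) has_real_derivative Im d) (at \<sigma>)"
    using bounded_linear.has_vector_derivative[OF bounded_linear_Re h]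
      bounded_linear.has_vector_derivative[OF bounded_linear_Im h]
    by (simp_all add: has_real_derivative_iff_has_vector_derivative)
  then have "((\<lambda>\<sigma>. (Re (zsum 0 (Complex \<sigma> t)))\<^sup>2 + (Im (zsum 0 (Complex \<sigma> t)))\<^sup>2) has_real_derivative
      2 * (Re z * Re d + Im z * Im d)) (at \<sigma>)"
    by (auto intro!: derivative_eq_intros h simp: z_def s_def algebra_simps)
  also have "2 * (Re z * Re d + Im z * Im d) = - 2 * Re (dser mangoldt s) * (norm z)\<^sup>2"
  proof -
    have "d = - (dser mangoldt s * z)" unfolding d_def z_def using mangoldt_zsum[OF s] by simp
    then show ?thesis by (simp add: cmod_power2) (simp add: algebra_simps power2_eq_square)
  qed
  finally show ?thesis by (simp add: cmod_power2 z_def s_def)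
qed

lemma Re_complex_of_real_mult: "Re (complex_of_real a * z) = a * Re z"
  by simp

text \<open>With c = cos (t ln n) the n-th summand is a non-negative multiple of 3 + 4 c + (2 c^2 -
  1) = 2 (1 + c)^2.\<close>

lemma dser_mangoldt_3_4_1:
  assumes "\<sigma> > 1"
  shows "3 * Re (dser mangoldt (Complex \<sigma> 0)) + 4 * Re (dser mangoldt (Complex \<sigma> t))
          + Re (dser mangoldt (Complex \<sigma> (2 * t))) \<ge> 0"
proof -
  have S: "(\<lambda>n. mangoldt n * (real n powr (-\<sigma>) * cos (t * ln (real n)))) sums Re (dser mangoldt (Complex \<sigma> t))" for t
  proof -
    have "(\<lambda>n. complex_of_real (mangoldt n) * of_nat n powr - Complex \<sigma> t) sums dser mangoldt (Complex \<sigma> t)"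
      by (rule dser_sums[OF mangoldt_abs_le]) (use assms in simp_all)
    then have "(\<lambda>n. Re (complex_of_real (mangoldt n) * of_nat n powr - Complex \<sigma> t)) sums Re (dser mangoldt (Complex \<sigma> t))"
      by (rule sums_Re)
    moreover have "Re (complex_of_real (mangoldt n) * of_nat n powr - Complex \<sigma> t) = mangoldt n * (real n powr (-\<sigma>) * cos (t * ln (real n)))" for n
    proof (cases "n = 0")
      case False
      then have "of_nat n powr - Complex \<sigma> t = exp (- Complex \<sigma> t * complex_of_real (ln (real n)))"
        by (simp add: powr_def Ln_of_nat)
      moreover have "Re (exp (- Complex \<sigma> t * complex_of_real (ln (real n)))) = real n powr (-\<sigma>) * cos (t * ln (real n))"
        using False by (simp add: Re_exp powr_def)
      ultimately show ?thesis by (simp only: Re_complex_of_real_mult)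
    qed simp
    ultimately show ?thesis by (simp only:)
  qed
  define f where "f = (\<lambda>t n. mangoldt n * (real n powr (-\<sigma>) * cos (t * ln (real n))))"
  have A: "(\<lambda>n. 3 * f 0 n + 4 * f t n + f (2 * t) n) sums (3 * Re (dser mangoldt (Complex \<sigma> 0)) + 4 * Re (dser mangoldt (Complex \<sigma> t))
          + Re (dser mangoldt (Complex \<sigma> (2 * t))))"
    unfolding f_def by (intro sums_add sums_mult S)
  have B: "0 \<le> 3 * f 0 n + 4 * f t n + f (2 * t) n" for n
  proof -
    define c where "c = cos (t * ln (real n))"
    have c2: "cos (2 * t * ln (real n)) = 2 * c\<^sup>2 - 1"
      using cos_double_cos[of "t * ln (real n)"] by (simp add: c_def mult.assoc)
    have "3 * f 0 n + 4 * f t n + f (2 * t) n = mangoldt n * real n powr (-\<sigma>) * (2 * (1 + c)\<^sup>2)"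
      unfolding f_def c2 c_def[symmetric] by (simp add: power2_eq_square algebra_simps)
    then show ?thesis using mangoldt_nonneg[of n] by simp
  qed
  show ?thesis by (rule sums_le[OF B sums_zero A])
qed

text \<open>
  The product decreases in \<^term>\<open>\<sigma>\<close>, as its logarithmic derivative is minus the preceding expression, and
  it tends to 1. This gives non-vanishing on Re s > 1 without the Euler product.
\<close>

lemma zsum_3_4_1:
  assumes "\<sigma> > 1"
  shows "norm (zsum 0 (Complex \<sigma> 0)) ^ 3 * norm (zsum 0 (Complex \<sigma> t)) ^ 4 * norm (zsum 0 (Complex \<sigma> (2 * t))) \<ge> 1"
proof -
  define g where "g = (\<lambda>t \<sigma>. (norm (zsum 0 (Complex \<sigma> t)))\<^sup>2)"
  define P where "P = (\<lambda>\<sigma>. g 0 \<sigma> ^ 3 * g t \<sigma> ^ 4 * g (2 * t) \<sigma>)"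
  have g: "(g t has_real_derivative (- 2 * Re (dser mangoldt (Complex \<sigma> t)) * g t \<sigma>)) (at \<sigma>)" if "\<sigma> > 1" for t \<sigma>
    using zsum_norm2_derivative[OF that] by (simp add: g_def)
  have g_nonneg: "g t \<sigma> \<ge> 0" for t \<sigma> by (simp add: g_def)
  have dP: "(P has_real_derivative (- 2 * (3 * Re (dser mangoldt (Complex \<sigma> 0)) + 4 * Re (dser mangoldt (Complex \<sigma> t))
          + Re (dser mangoldt (Complex \<sigma> (2 * t)))) * P \<sigma>)) (at \<sigma>)" if "\<sigma> > 1" for \<sigma>
    unfolding P_def
    by (rule derivative_eq_intros g that refl)+ (simp add: algebra_simps power2_eq_square power3_eq_cube power4_eq_xxxx)
  have "P b \<le> P \<sigma>" if "b \<ge> \<sigma>" for b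
  proof (rule DERIV_nonpos_imp_nonincreasing[OF that])
    fix x assume "\<sigma> \<le> x" "x \<le> b"
    then have "x > 1" using assms by auto
    moreover have "P x \<ge> 0" by (simp add: P_def g_nonneg)
    ultimately show "\<exists>y. (P has_real_derivative y) (at x) \<and> y \<le> 0"
      using dP[of x] dser_mangoldt_3_4_1[of x t] by (intro exI conjI) (assumption, simp add: mult_nonpos_nonneg)
  qed
  moreover have "(P \<longlongrightarrow> (norm (1::complex))\<^sup>2 ^ 3 * (norm (1::complex))\<^sup>2 ^ 4 * (norm (1::complex))\<^sup>2) at_top"
    unfolding P_def g_def by (intro tendsto_intros zsum_0_tendsto_1)
  ultimately have "P \<sigma> \<ge> 1"
    by (intro tendsto_upperbound[of P 1 at_top]) (auto intro: eventually_mono[OF eventually_ge_at_top[of \<sigma>]])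
  then have "1\<^sup>2 \<le> (norm (zsum 0 (Complex \<sigma> 0)) ^ 3 * norm (zsum 0 (Complex \<sigma> t)) ^ 4 * norm (zsum 0 (Complex \<sigma> (2 * t))))\<^sup>2"
    by (simp add: P_def g_def power_mult_distrib flip: power_mult)
  then show ?thesis by (rule power2_le_imp_le) simp
qed

section \<open>Bounds for zeta up to the line Re s = 1\<close>

lemma zeta_err_nonneg: "zeta_err \<ge> 0"
  unfolding zeta_err_def by (rule suminf_nonneg[OF summable_zeta_err]) auto

lemma zsum_0_lipschitz:
  assumes "1 < a" "a \<le> b" "\<And>u. a \<le> u \<Longrightarrow> u \<le> b \<Longrightarrow> norm (zsum 1 (Complex u t)) \<le> B"
  shows "norm (zsum 0 (Complex b t) - zsum 0 (Complex a t)) \<le> B * (b - a)"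
proof -
  let ?S = "closed_segment (Complex a t) (Complex b t)"
  have S: "z = Complex (Re z) t \<and> a \<le> Re z \<and> Re z \<le> b" if "z \<in> ?S" for z
    using that assms(2) closed_segment_same_Im[of "Complex a t" "Complex b t"]
    by (auto simp: complex_eq_iff closed_segment_eq_real_ivl)
  have "norm (zsum 0 (Complex b t) - zsum 0 (Complex a t)) \<le> B * norm (Complex b t - Complex a t)"
  proof (rule field_differentiable_bound[where S = ?S and f' = "\<lambda>z. - zsum (Suc 0) z"])
    show "(zsum 0 has_field_derivative - zsum (Suc 0) z) (at z within ?S)" if "z \<in> ?S" for z
      using S[OF that] assms(1) has_field_derivative_zsum[of z 0]
      by (auto intro: has_field_derivative_at_within)
    show "norm (- zsum (Suc 0) z) \<le> B" if "z \<in> ?S" for z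
      using assms(3)[of "Re z"] S[OF that] by simp
  qed auto
  also have "Complex b t - Complex a t = complex_of_real (b - a)" by (simp add: complex_eq_iff)
  finally show ?thesis using assms(2) by (simp only: norm_of_real abs_of_nonneg diff_ge_0_iff_ge)
qed

lemma zsum_approx':
  assumes "1 < \<sigma>" "\<sigma> \<le> 2" and s_def: "s = Complex \<sigma> t"
  shows "norm (zsum 0 s - 1 / (s - 1)) \<le> (4 * zeta_err + 1) * (1 + \<bar>t\<bar>)"
    and "norm (zsum 1 s - 1 / (s - 1)\<^sup>2) \<le> (4 * zeta_err + 1) * (1 + \<bar>t\<bar>)"
    and "norm (zsum 2 s - 2 / (s - 1) ^ 3) \<le> (4 * zeta_err + 1) * (1 + \<bar>t\<bar>)"
proof -
  have "norm s \<le> 2 + \<bar>t\<bar>" using cmod_le[of s] assms(1,2) by (simp add: s_def)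
  then have "2 + norm s \<le> 4 * (1 + \<bar>t\<bar>)" by simp
  then have "(2 + norm s) * zeta_err \<le> 4 * (1 + \<bar>t\<bar>) * zeta_err"
    by (rule mult_right_mono[OF _ zeta_err_nonneg])
  also have "\<dots> \<le> (4 * zeta_err + 1) * (1 + \<bar>t\<bar>)" by (simp add: algebra_simps)
  finally have *: "(2 + norm s) * zeta_err \<le> (4 * zeta_err + 1) * (1 + \<bar>t\<bar>)" .
  have s: "1 < Re s" using assms(1) by (simp add: s_def)
  show "norm (zsum 0 s - 1 / (s - 1)) \<le> (4 * zeta_err + 1) * (1 + \<bar>t\<bar>)"
    and "norm (zsum 1 s - 1 / (s - 1)\<^sup>2) \<le> (4 * zeta_err + 1) * (1 + \<bar>t\<bar>)"
    and "norm (zsum 2 s - 2 / (s - 1) ^ 3) \<le> (4 * zeta_err + 1) * (1 + \<bar>t\<bar>)"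
    using zsum_approx[OF s] * by linarith+
qed

text \<open>Outside the disc of radius r \<le> 1 the polar parts k! / |w|^(k+1) are at most 2 / r^3,
  so only the linear growth of the error terms is left.\<close>

lemma zsum_bound_away_from_pole:
  assumes "0 < r" "r \<le> 1"
  obtains E where "E \<ge> 1"
    "\<And>k \<sigma> t. \<lbrakk>k \<le> 2; 1 < \<sigma>; \<sigma> \<le> 2; norm (Complex \<sigma> t - 1) \<ge> r\<rbrakk> \<Longrightarrow> norm (zsum k (Complex \<sigma> t)) \<le> E * (1 + \<bar>t\<bar>)"
proof
  define D where "D = 4 * zeta_err + 1"
  have D: "D \<ge> 1" using zeta_err_nonneg by (simp add: D_def)
  have r3: "1 / r ^ 3 \<ge> 1" using assms by (simp add: power_le_one)
  show "2 / r ^ 3 + D \<ge> 1" using D r3 by simp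
  fix k :: nat and \<sigma> t :: real
  assume k: "k \<le> 2" and \<sigma>: "1 < \<sigma>" "\<sigma> \<le> 2" and r: "norm (Complex \<sigma> t - 1) \<ge> r"
  define w where "w = Complex \<sigma> t - 1"
  have w: "norm w \<ge> r" "norm w > 0" using r assms by (auto simp: w_def)
  have inv: "c / norm w ^ j \<le> 2 / r ^ 3" if "j \<le> 3" "0 \<le> c" "c \<le> 2" for j :: nat and c
  proof -
    have "c / norm w ^ j \<le> 2 / r ^ j"
      using that w assms by (intro frac_le power_mono) auto
    also have "\<dots> \<le> 2 / r ^ 3"
      using that assms by (intro divide_left_mono power_decreasing) auto
    finally show ?thesis .
  qed
  have "norm (zsum k (Complex \<sigma> t)) \<le> 2 / r ^ 3 + D * (1 + \<bar>t\<bar>)"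
  proof -
    consider "k = 0" | "k = 1" | "k = 2" using k by linarith
    then show ?thesis
    proof cases
      case 1
      have "norm (zsum 0 (Complex \<sigma> t)) \<le> norm (1 / w) + norm (zsum 0 (Complex \<sigma> t) - 1 / w)"
        by (metis norm_triangle_sub)
      also have "\<dots> \<le> 2 / r ^ 3 + D * (1 + \<bar>t\<bar>)"
        using zsum_approx'(1)[OF \<sigma> refl, of t] inv[of 1 1] by (intro add_mono) (auto simp: w_def D_def norm_divide)
      finally show ?thesis using 1 by simp
    next
      case 2
      have "norm (zsum 1 (Complex \<sigma> t)) \<le> norm (1 / w\<^sup>2) + norm (zsum 1 (Complex \<sigma> t) - 1 / w\<^sup>2)"
        by (metis norm_triangle_sub)
      also have "\<dots> \<le> 2 / r ^ 3 + D * (1 + \<bar>t\<bar>)"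
        using zsum_approx'(2)[OF \<sigma> refl, of t] inv[of 2 1] by (intro add_mono) (auto simp: w_def D_def norm_divide norm_power)
      finally show ?thesis using 2 by simp
    next
      case 3
      have "norm (zsum 2 (Complex \<sigma> t)) \<le> norm (2 / w ^ 3) + norm (zsum 2 (Complex \<sigma> t) - 2 / w ^ 3)"
        by (metis norm_triangle_sub)
      also have "\<dots> \<le> 2 / r ^ 3 + D * (1 + \<bar>t\<bar>)"
        using zsum_approx'(3)[OF \<sigma> refl, of t] inv[of 3 2] by (intro add_mono) (auto simp: w_def D_def norm_divide norm_power)
      finally show ?thesis using 3 by simp
    qed
  qed
  also have "\<dots> \<le> 2 / r ^ 3 * (1 + \<bar>t\<bar>) + D * (1 + \<bar>t\<bar>)"
    using assms mult_left_mono[of 1 "1 + \<bar>t\<bar>" "2 / r ^ 3"] by simp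
  also have "\<dots> = (2 / r ^ 3 + D) * (1 + \<bar>t\<bar>)"
    by (simp only: distrib_right)
  finally show "norm (zsum k (Complex \<sigma> t)) \<le> (2 / r ^ 3 + D) * (1 + \<bar>t\<bar>)" .
qed

text \<open>The 3-4-1 inequality alone gives |zeta|^4 \<ge> (\<sigma> - 1)^3 / (Q T), which
  degenerates as \<sigma> \<rightarrow> 1; the bound for the derivative carries the estimate over
  the last stretch of length \<open>\<eta>\<close>. Since \<open>\<eta>\<close> is of order T^(-5),
  the resulting value E T \<eta> has order T^(-4).\<close>

lemma zsum_0_lower_bound:
  assumes r: "0 < r" "r \<le> 1"
  obtains c where "c > 0"
    "\<And>\<sigma> t. \<lbrakk>1 < \<sigma>; \<sigma> \<le> 2; norm (Complex \<sigma> t - 1) \<ge> r\<rbrakk> \<Longrightarrow> norm (zsum 0 (Complex \<sigma> t)) \<ge> c / (1 + \<bar>t\<bar>) ^ 4"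
proof -
  obtain E where E: "E \<ge> 1"
    "\<And>k \<sigma> t. \<lbrakk>k \<le> 2; 1 < \<sigma>; \<sigma> \<le> 2; norm (Complex \<sigma> t - 1) \<ge> r\<rbrakk> \<Longrightarrow> norm (zsum k (Complex \<sigma> t)) \<le> E * (1 + \<bar>t\<bar>)"
    using zsum_bound_away_from_pole[OF r] by blast
  define D where "D = 4 * zeta_err + 1"
  have D: "D \<ge> 1" using zeta_err_nonneg by (simp add: D_def)
  define Q where "Q = (2 * D) ^ 3 * (2 * E)"
  have Q: "Q \<ge> 1" unfolding Q_def using D E(1)
    mult_mono[of 1 "(2 * D) ^ 3" 1 "2 * E"] one_le_power[of "2 * D" 3] by simp
  have far: "norm (zsum 0 (Complex \<sigma> t)) ^ 4 \<ge> (\<sigma> - 1) ^ 3 / (Q * (1 + \<bar>t\<bar>))"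
    if \<sigma>: "1 < \<sigma>" "\<sigma> \<le> 2" and rr: "norm (Complex \<sigma> t - 1) \<ge> r" for \<sigma> t
  proof -
    define x where "x = norm (zsum 0 (Complex \<sigma> t)) ^ 4"
    define Y where "Y = Q * (1 + \<bar>t\<bar>)"
    have "norm (zsum 0 (Complex \<sigma> 0)) \<le> norm (1 / (Complex \<sigma> 0 - 1)) + norm (zsum 0 (Complex \<sigma> 0) - 1 / (Complex \<sigma> 0 - 1))"
      by (metis norm_triangle_sub)
    also have "Complex \<sigma> 0 - 1 = complex_of_real (\<sigma> - 1)" by (simp add: complex_eq_iff)
    also have "norm (1 / complex_of_real (\<sigma> - 1)) = 1 / (\<sigma> - 1)"
      using \<sigma> by (simp only: norm_divide norm_of_real) simp
    also have "norm (zsum 0 (Complex \<sigma> 0) - 1 / complex_of_real (\<sigma> - 1)) \<le> D"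
      using zsum_approx'(1)[OF \<sigma> refl, of 0] \<open>Complex \<sigma> 0 - 1 = _\<close> by (simp add: D_def)
    also have "D \<le> D / (\<sigma> - 1)" using D \<sigma> by (simp add: field_simps)
    also have "1 / (\<sigma> - 1) + D / (\<sigma> - 1) \<le> 2 * D / (\<sigma> - 1)"
      using D \<sigma> by (simp add: divide_simps)
    finally have z0: "norm (zsum 0 (Complex \<sigma> 0)) \<le> 2 * D / (\<sigma> - 1)" by simp
    \<comment> \<open>Doubling the ordinate moves the point away from the pole, so the upper bound
      applies there too.\<close>
    have "norm (Complex \<sigma> t - 1) \<le> norm (Complex \<sigma> (2 * t) - 1)"
      unfolding cmod_def by (intro real_sqrt_le_mono) (simp add: power_mult_distrib)
    then have "norm (zsum 0 (Complex \<sigma> (2 * t))) \<le> E * (1 + \<bar>2 * t\<bar>)"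
      using rr \<sigma> by (intro E(2)) auto
    also have "\<dots> \<le> E * (2 * (1 + \<bar>t\<bar>))"
      using E(1) by (intro mult_left_mono) auto
    finally have z2: "norm (zsum 0 (Complex \<sigma> (2 * t))) \<le> 2 * E * (1 + \<bar>t\<bar>)" by (simp only: mult_ac)
    have "1 \<le> norm (zsum 0 (Complex \<sigma> 0)) ^ 3 * x * norm (zsum 0 (Complex \<sigma> (2 * t)))"
      unfolding x_def by (rule zsum_3_4_1[OF \<sigma>(1)])
    also have "\<dots> \<le> (2 * D / (\<sigma> - 1)) ^ 3 * x * (2 * E * (1 + \<bar>t\<bar>))"
      using \<sigma> D by (intro mult_mono power_mono z0 z2) (auto simp: x_def)
    also have "\<dots> = Q * (1 + \<bar>t\<bar>) / (\<sigma> - 1) ^ 3 * x"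
      by (simp add: Q_def power_divide)
    finally have "1 \<le> Y / (\<sigma> - 1) ^ 3 * x" by (simp only: Y_def)
    moreover have "Y > 0" using Q by (simp add: Y_def)
    moreover have "(\<sigma> - 1) ^ 3 > 0" using \<sigma> by simp
    ultimately show ?thesis unfolding x_def[symmetric] Y_def[symmetric] by (simp add: divide_simps mult.commute)
  qed
  show ?thesis
  proof
    show "1 / (16 * E ^ 3 * Q) > 0" using E Q by simp
    fix \<sigma> t :: real
    assume \<sigma>: "1 < \<sigma>" "\<sigma> \<le> 2" and rr: "norm (Complex \<sigma> t - 1) \<ge> r"
    define T where "T = 1 + \<bar>t\<bar>"
    have T: "T \<ge> 1" by (simp add: T_def)
    (* Beyond the distance \<eta> from the line Re s = 1, the 3-4-1 inequality bounds the series from below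
       by 2ET\<eta>; within it, moving by at most \<eta> loses ET\<eta>. *)
    define \<eta> where "\<eta> = 1 / (16 * E ^ 4 * Q * T ^ 5)"
    have \<eta>0: "\<eta> > 0" using E Q T by (simp add: \<eta>_def)
    have "1 \<le> E ^ 4" "1 \<le> T ^ 5" using E T by auto
    then have "1 * 1 * 1 \<le> E ^ 4 * Q * T ^ 5"
      using Q by (intro mult_mono) auto
    then have \<eta>1: "\<eta> \<le> 1" by (simp add: \<eta>_def field_simps)
    have far': "norm (zsum 0 (Complex u t)) \<ge> 2 * (E * T * \<eta>)"
      if u: "1 + \<eta> \<le> u" "u \<le> 2" "\<sigma> \<le> u" for u
    proof -
      have "norm (Complex \<sigma> t - 1) \<le> norm (Complex u t - 1)"
        unfolding cmod_def using \<sigma> u by (intro real_sqrt_le_mono) (simp add: power_mono)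
      then have "(u - 1) ^ 3 / (Q * T) \<le> norm (zsum 0 (Complex u t)) ^ 4"
        unfolding T_def using u \<eta>0 rr by (intro far) auto
      moreover have "\<eta> ^ 3 / (Q * T) \<le> (u - 1) ^ 3 / (Q * T)"
        using u \<eta>0 Q T by (intro divide_right_mono power_mono) auto
      \<comment> \<open>This equation determines \<open>\<eta>\<close>: at distance
        \<open>\<eta>\<close> from the line, the lower bound is exactly twice the loss E T
        \<eta>.\<close>
      moreover have "\<eta> ^ 3 / (Q * T) = (2 * (E * T * \<eta>)) ^ 4"
      proof -
        have "(2 * (E * T * \<eta>)) ^ 4 = \<eta> ^ 3 * (16 * E ^ 4 * T ^ 4 * \<eta>)"
          by (simp add: power_mult_distrib eval_nat_numeral)
        also have "16 * E ^ 4 * T ^ 4 * \<eta> = 1 / (Q * T)"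
          using E Q T by (simp add: \<eta>_def eval_nat_numeral)
        finally show ?thesis by simp
      qed
      ultimately have "(2 * (E * T * \<eta>)) ^ 4 \<le> norm (zsum 0 (Complex u t)) ^ 4" by linarith
      then show ?thesis by (rule power_le_imp_le_base[of _ 3, simplified]) auto
    qed
    have "norm (zsum 0 (Complex \<sigma> t)) \<ge> E * T * \<eta>"
    proof (cases "1 + \<eta> \<le> \<sigma>")
      case True
      then show ?thesis using far'[of \<sigma>] \<sigma> E T \<eta>0 by (smt (verit) mult_pos_pos)
    next
      case False
      have "norm (zsum 0 (Complex (1 + \<eta>) t) - zsum 0 (Complex \<sigma> t)) \<le> (E * T) * (1 + \<eta> - \<sigma>)"
      proof (rule zsum_0_lipschitz)
        fix u assume u: "\<sigma> \<le> u" "u \<le> 1 + \<eta>"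
        have "norm (Complex \<sigma> t - 1) \<le> norm (Complex u t - 1)"
          unfolding cmod_def using \<sigma> u by (intro real_sqrt_le_mono) (simp add: power_mono)
        then show "norm (zsum 1 (Complex u t)) \<le> E * T"
          unfolding T_def using rr u \<sigma> \<eta>1 by (intro E(2)) auto
      qed (use False \<sigma> in auto)
      also have "\<dots> \<le> (E * T) * \<eta>"
        using E T \<sigma> by (intro mult_left_mono) auto
      finally have "norm (zsum 0 (Complex (1 + \<eta>) t) - zsum 0 (Complex \<sigma> t)) \<le> E * T * \<eta>" .
      moreover have "norm (zsum 0 (Complex (1 + \<eta>) t)) \<ge> 2 * (E * T * \<eta>)"
        using False \<eta>1 by (intro far') auto
      ultimately show ?thesis
        using norm_triangle_ineq2[of "zsum 0 (Complex (1 + \<eta>) t)" "zsum 0 (Complex \<sigma> t)"] by linarith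
    qed
    also have "E * T * \<eta> = 1 / (16 * E ^ 3 * Q) / T ^ 4"
      using E T Q by (simp add: \<eta>_def eval_nat_numeral)
    finally show "norm (zsum 0 (Complex \<sigma> t)) \<ge> 1 / (16 * E ^ 3 * Q) / (1 + \<bar>t\<bar>) ^ 4"
      by (simp add: T_def)
  qed
qed

section \<open>The series with coefficients (\<Lambda>(n) - 1) ln n\<close>

definition mang_ln :: "nat \<Rightarrow> real" where
  "mang_ln n = (mangoldt n - 1) * ln (real n)"

lemma mang_ln_abs_le:
  assumes "n > 0"
  shows "\<bar>mang_ln n\<bar> \<le> ln (real n) ^ 2"
proof -
  have "\<bar>mangoldt n - 1\<bar> \<le> ln (real n)" if "n > 1"
  \<comment> \<open>For n > 2 both \<Lambda>(n) and 1 lie between 0 and ln n. As ln 2 < 1, the case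
    n = 2 rests on 1 - ln 2 \<le> ln 2 instead.\<close>
  proof (cases "n = 2")
    case True
    have "exp (1 / 2) \<le> (2 :: real)"
      using exp_bound_half[of "1 / 2 :: real"] by simp
    then have "ln (2 :: real) \<ge> 1 / 2" by (subst ln_ge_iff) auto
    then show ?thesis using True mangoldt_prime[of 2, where 'a = real] ln_2_less_1 by simp
  next
    case False
    then have "exp 1 \<le> real n" using that exp_le by linarith
    then have "1 \<le> ln (real n)" using that by (subst ln_ge_iff) auto
    then show ?thesis using mangoldt_nonneg[of n] mangoldt_le[of n] that by (simp add: abs_le_iff)
  qed
  then show ?thesis
    using assms by (cases "n = 1") (auto simp: mang_ln_def abs_mult power2_eq_square intro: mult_right_mono)
qed

text \<open>The series is (zeta'/zeta)' + zeta', written with the signs of \<open>zsum\<close> and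
  multiplied by zeta^2, so that no quotient has to be formed.\<close>

lemma dser_mang_ln:
  assumes s: "Re s > 1"
  shows "dser mang_ln s * (zsum 0 s)\<^sup>2 = zsum 2 s * zsum 0 s - (zsum 1 s)\<^sup>2 - zsum 1 s * (zsum 0 s)\<^sup>2"
proof -
  have 1: "dser (\<lambda>n. mangoldt n * ln (real n)) s - zsum 1 s = dser mang_ln s"
    unfolding zsum_def mang_ln_def using dser_diff[OF mangoldt_ln_abs_le _ s, of "\<lambda>n. ln (real n) ^ 1" 1]
    by (simp add: left_diff_distrib)
  have "dser (\<lambda>n. mangoldt n * ln (real n)) s * (zsum 0 s)\<^sup>2 = zsum 2 s * zsum 0 s - (zsum 1 s)\<^sup>2"
  proof -
    have "dser (\<lambda>n. mangoldt n * ln (real n)) s * zsum 0 s = zsum 2 s - dser mangoldt s * zsum 1 s"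
      using mangoldt_ln_zsum[OF s] by (simp add: eq_diff_eq)
    then have "dser (\<lambda>n. mangoldt n * ln (real n)) s * zsum 0 s * zsum 0 s = (zsum 2 s - dser mangoldt s * zsum 1 s) * zsum 0 s"
      by simp
    also have "\<dots> = zsum 2 s * zsum 0 s - (dser mangoldt s * zsum 0 s) * zsum 1 s" by (simp add: algebra_simps)
    also have "\<dots> = zsum 2 s * zsum 0 s - (zsum 1 s)\<^sup>2"
      by (simp only: mangoldt_zsum[OF s] power2_eq_square)
    finally show ?thesis by (simp add: power2_eq_square mult_ac)
  qed
  then show ?thesis unfolding 1[symmetric] by (simp add: algebra_simps)
qed

text \<open>Away from 1 the right-hand side of \<open>dser_mang_ln\<close> is at most 3 (E T)^3, and
  division by |zeta|^2 \<ge> c^2 / T^8 raises the exponent to 11. Near 1 both sides are multiplied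
  by w^2, which turns the double pole of zeta^2 into a factor bounded away from 0.\<close>

lemma dser_mang_ln_bound:
  obtains K where "K > 0" 
    "\<And>\<sigma> t. \<lbrakk>1 < \<sigma>; \<sigma> \<le> 2\<rbrakk> \<Longrightarrow> norm (dser mang_ln (Complex \<sigma> t)) \<le> K * (1 + \<bar>t\<bar>) ^ 11"
proof -
  define D where "D = 2 * (4 * zeta_err + 1)"
  have D: "D \<ge> 2" using zeta_err_nonneg by (simp add: D_def)
  \<comment> \<open>Chosen to give |a w| \<le> D r = 1 / 2 near the pole, which keeps w zeta(s) = 1
    + a w away from 0.\<close>
  define r where "r = 1 / (2 * D)"
  have r: "0 < r" "r \<le> 1" using D by (auto simp: r_def)
  obtain E where E: "E \<ge> 1"
    "\<And>k \<sigma> t. \<lbrakk>k \<le> 2; 1 < \<sigma>; \<sigma> \<le> 2; norm (Complex \<sigma> t - 1) \<ge> r\<rbrakk> \<Longrightarrow> norm (zsum k (Complex \<sigma> t)) \<le> E * (1 + \<bar>t\<bar>)"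
    using zsum_bound_away_from_pole[OF r] by blast
  obtain c where c: "c > 0"
    "\<And>\<sigma> t. \<lbrakk>1 < \<sigma>; \<sigma> \<le> 2; norm (Complex \<sigma> t - 1) \<ge> r\<rbrakk> \<Longrightarrow> norm (zsum 0 (Complex \<sigma> t)) \<ge> c / (1 + \<bar>t\<bar>) ^ 4"
    using zsum_0_lower_bound[OF r] by blast
  show ?thesis
  proof
    show "3 * E ^ 3 / c\<^sup>2 + 40 * D ^ 3 > 0" using c E D by (intro add_pos_pos) auto
    fix \<sigma> t :: real
    assume \<sigma>: "1 < \<sigma>" "\<sigma> \<le> 2"
    define T where "T = 1 + \<bar>t\<bar>"
    have T: "T \<ge> 1" by (simp add: T_def)
    define s where "s = Complex \<sigma> t"
    define w where "w = s - 1"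
    have s: "Re s > 1" using \<sigma> by (simp add: s_def)
    have w0: "w \<noteq> 0" using s by (auto simp: w_def)
    show "norm (dser mang_ln (Complex \<sigma> t)) \<le> (3 * E ^ 3 / c\<^sup>2 + 40 * D ^ 3) * (1 + \<bar>t\<bar>) ^ 11"
    proof (cases "norm w \<ge> r")
      case True
      have Z: "norm (zsum k s) \<le> E * T" if "k \<le> 2" for k
        using E(2)[OF that \<sigma>, of t] True by (simp add: s_def w_def T_def)
      have Z0: "norm (zsum 0 s) \<ge> c / T ^ 4"
        using c(2)[OF \<sigma>, of t] True by (simp add: s_def w_def T_def)
      have T4: "c / T ^ 4 > 0" using c T by simp
      have ET: "E * T \<ge> 1" using E(1) T mult_mono[of 1 E 1 T] by simp
      have "norm (dser mang_ln s) * (c / T ^ 4)\<^sup>2 \<le> norm (dser mang_ln s) * norm (zsum 0 s) ^ 2"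
        using Z0 T4 by (intro mult_left_mono power_mono) auto
      also have "\<dots> = norm (dser mang_ln s * (zsum 0 s)\<^sup>2)" by (simp add: norm_mult norm_power)
      also have "\<dots> \<le> norm (zsum 2 s * zsum 0 s) + norm ((zsum 1 s)\<^sup>2) + norm (zsum 1 s * (zsum 0 s)\<^sup>2)"
        unfolding dser_mang_ln[OF s] by (intro order_trans[OF norm_triangle_ineq4] add_mono order_refl)
      also have "\<dots> \<le> (E * T) * (E * T) + (E * T)\<^sup>2 + (E * T) * (E * T)\<^sup>2"
        unfolding norm_mult norm_power using ET by (intro add_mono mult_mono power_mono Z) auto
      also have "\<dots> \<le> (E * T) ^ 3 + (E * T) ^ 3 + (E * T) ^ 3"
        using ET power_increasing[of 2 3 "E * T"] by (intro add_mono) (auto simp: power2_eq_square power3_eq_cube)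
      also have "\<dots> = 3 * E ^ 3 * T ^ 3" by (simp add: power_mult_distrib)
      finally have "norm (dser mang_ln s) * (c / T ^ 4)\<^sup>2 \<le> 3 * E ^ 3 * T ^ 3" .
      then have "norm (dser mang_ln s) \<le> 3 * E ^ 3 * T ^ 3 / (c / T ^ 4)\<^sup>2"
        using T4 by (subst pos_le_divide_eq) auto
      also have "\<dots> = (3 * E ^ 3 / c\<^sup>2) * T ^ 11"
        using T by (simp add: power_divide field_simps flip: power_mult power_add)
      also have "\<dots> \<le> (3 * E ^ 3 / c\<^sup>2 + 40 * D ^ 3) * T ^ 11"
        using T D by (intro mult_right_mono) auto
      finally show ?thesis by (simp add: s_def T_def)
    next
      case False
      then have w: "norm w \<le> r" by simp
      have "\<bar>t\<bar> \<le> 1" using abs_Im_le_cmod[of w] w r by (simp add: w_def s_def)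
      then have "(4 * zeta_err + 1) * (1 + \<bar>t\<bar>) \<le> (4 * zeta_err + 1) * 2"
        using zeta_err_nonneg by (intro mult_left_mono) auto
      then have bd: "(4 * zeta_err + 1) * (1 + \<bar>t\<bar>) \<le> D" by (simp add: D_def)
      define a where "a = zsum 0 s - 1 / w"
      define b where "b = zsum 1 s - 1 / w\<^sup>2"
      define d where "d = zsum 2 s - 2 / w ^ 3"
      have A: "norm a \<le> D" "norm b \<le> D" "norm d \<le> D"
        using order_trans[OF zsum_approx'(1)[OF \<sigma> s_def] bd] order_trans[OF zsum_approx'(2)[OF \<sigma> s_def] bd]
          order_trans[OF zsum_approx'(3)[OF \<sigma> s_def] bd]
        by (auto simp: a_def b_def d_def w_def s_def)
      have Z: "zsum 0 s = 1 / w + a" "zsum 1 s = 1 / w\<^sup>2 + b" "zsum 2 s = 2 / w ^ 3 + d"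
        by (auto simp: a_def b_def d_def)
      \<comment> \<open>The terms in w^(-4) and w^(-3) cancel, with coefficients 2 - 1 - 1 and 2 a -
        2 a. What remains is of order w^(-2) at most, and the factor w^2 removes it.\<close>
      define N where "N = d * w + d * a * w\<^sup>2 - 3 * b - b\<^sup>2 * w\<^sup>2 - a\<^sup>2 - 2 * a * b * w - b * a\<^sup>2 * w\<^sup>2"
      have "(w * zsum 0 s)\<^sup>2 = (1 + a * w)\<^sup>2" using w0 by (simp add: Z distrib_left mult.commute)
      moreover have "dser mang_ln s * (w * zsum 0 s)\<^sup>2 = w\<^sup>2 * (zsum 2 s * zsum 0 s - (zsum 1 s)\<^sup>2 - zsum 1 s * (zsum 0 s)\<^sup>2)"
        unfolding dser_mang_ln[OF s, symmetric] by (simp add: power_mult_distrib)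
      moreover have "w\<^sup>2 * (zsum 2 s * zsum 0 s - (zsum 1 s)\<^sup>2 - zsum 1 s * (zsum 0 s)\<^sup>2) = N"
        unfolding Z N_def using w0 by (simp add: field_simps power2_eq_square power3_eq_cube)
      ultimately have eq: "dser mang_ln s * (1 + a * w)\<^sup>2 = N" by simp
      have w1: "norm w \<le> 1" using w r by simp
      have D0: "D \<ge> 0" "D \<ge> 1" using D by auto
      have "norm (a * w) \<le> D * r" unfolding norm_mult using A w D0 by (intro mult_mono) auto
      also have "\<dots> = 1 / 2" using D by (simp add: r_def)
      finally have "norm (1 + a * w) \<ge> 1 / 2"
        using norm_triangle_ineq4[of "1 + a * w" "a * w"] by simp
      then have "norm (dser mang_ln s) * (1 / 2)\<^sup>2 \<le> norm (dser mang_ln s) * norm (1 + a * w) ^ 2"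
        by (intro mult_left_mono power_mono) auto
      also have "\<dots> = norm N" by (simp add: norm_mult norm_power flip: eq)
      also have "norm N \<le> norm (d * w) + norm (d * a * w\<^sup>2) + norm (3 * b) + norm (b\<^sup>2 * w\<^sup>2) + norm (a\<^sup>2) + norm (2 * a * b * w) + norm (b * a\<^sup>2 * w\<^sup>2)"
        unfolding N_def by (intro order_trans[OF norm_triangle_ineq4] order_trans[OF norm_triangle_ineq] add_mono order_refl)
      also have "\<dots> \<le> D * 1 + D * D * 1\<^sup>2 + 3 * D + D\<^sup>2 * 1\<^sup>2 + D\<^sup>2 + 2 * D * D * 1 + D * D\<^sup>2 * 1\<^sup>2"
        unfolding norm_mult norm_power norm_numeral
        by (intro add_mono mult_mono power_mono A w1 order_refl mult_nonneg_nonneg D0 norm_ge_zero zero_le_power zero_le_numeral)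
      also have "\<dots> = 4 * D ^ 1 + 5 * D ^ 2 + D ^ 3" by (simp add: power2_eq_square power3_eq_cube)
      also have "\<dots> \<le> 4 * D ^ 3 + 5 * D ^ 3 + D ^ 3"
        using D0 by (intro add_mono mult_left_mono power_increasing) auto
      finally have "norm (dser mang_ln s) \<le> 40 * D ^ 3" by (simp add: power2_eq_square)
      also have "\<dots> \<le> (3 * E ^ 3 / c\<^sup>2 + 40 * D ^ 3) * 1" using E by simp
      also have "\<dots> \<le> (3 * E ^ 3 / c\<^sup>2 + 40 * D ^ 3) * T ^ 11"
        using T E D by (intro mult_left_mono add_nonneg_nonneg) auto
      finally show ?thesis by (simp add: s_def T_def)
    qed
  qed
qed

section \<open>Gaussian smoothing\<close>

abbreviation gauss :: "real \<Rightarrow> real \<Rightarrow> real" where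
  "gauss \<epsilon> y \<equiv> exp (- (y\<^sup>2 / (2 * \<epsilon>\<^sup>2)))"

lemma integrable_std_normal_1_plus_abs:
  "integrable std_normal_distribution (\<lambda>z. (1 + \<bar>z\<bar>) ^ k)"
proof (rule Bochner_Integration.integrable_bound)
  have "integrable lborel (\<lambda>x. 2 ^ k * (std_normal_density x * \<bar>x\<bar> ^ 0) + 2 ^ k * (std_normal_density x * \<bar>x\<bar> ^ k))"
    by (intro Bochner_Integration.integrable_add integrable_mult_right integrable_std_normal_moment_abs)
  then show "integrable std_normal_distribution (\<lambda>z. 2 ^ k + 2 ^ k * \<bar>z\<bar> ^ k :: real)"
    by (subst integrable_density) (auto simp: algebra_simps)
  have "(1 + \<bar>z\<bar>) ^ k \<le> 2 ^ k + 2 ^ k * \<bar>z\<bar> ^ k" for z :: real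
  proof -
    have "(1 + \<bar>z\<bar>) ^ k \<le> (2 * max 1 \<bar>z\<bar>) ^ k" by (intro power_mono) auto
    also have "\<dots> \<le> 2 ^ k + 2 ^ k * \<bar>z\<bar> ^ k" by (auto simp: power_mult_distrib max_def)
    finally show ?thesis .
  qed
  then show "AE z in std_normal_distribution. norm ((1 + \<bar>z\<bar>) ^ k) \<le> norm (2 ^ k + 2 ^ k * \<bar>z\<bar> ^ k :: real)"
    by (intro always_eventually) auto
qed simp

text \<open>The Gaussian is the characteristic function of the standard normal law:
  \<open>gauss \<epsilon> (ln n - v)\<close> is the expectation of exp (i z (ln n - v) /
  \<epsilon>). Summing over n inside the expectation gives, up to a phase, the series at \<sigma> -
  i z / \<epsilon>. Polynomial growth in the ordinate thus becomes a moment of z together with the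
  power \<epsilon>^(-m).\<close>

lemma gauss_smoothing_dser:
  fixes a :: "nat \<Rightarrow> real"
  assumes a: "\<And>n. n > 0 \<Longrightarrow> \<bar>a n\<bar> \<le> ln (real n) ^ k"
    and K: "\<And>t. norm (dser a (Complex \<sigma> t)) \<le> K * (1 + \<bar>t\<bar>) ^ m"
    and \<sigma>: "\<sigma> > 1" and \<epsilon>: "0 < \<epsilon>" "\<epsilon> \<le> 1"
  shows "\<bar>\<Sum>n. a n * real n powr (-\<sigma>) * gauss \<epsilon> (ln (real n) - v)\<bar>
    \<le> K / \<epsilon> ^ m * (\<integral>z. (1 + \<bar>z\<bar>) ^ m \<partial>std_normal_distribution)"
proof -
  let ?M = std_normal_distribution
  interpret M: prob_space ?M by (rule prob_space_normal_density) simp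
  define f where "f = (\<lambda>n z. complex_of_real (a n * real n powr (-\<sigma>)) * iexp (((ln (real n) - v) / \<epsilon>) * z))"
  have f_norm: "norm (f n z) = \<bar>a n\<bar> * real n powr (-\<sigma>)" for n z
    by (simp add: f_def norm_mult)
  have f_eq: "f n z = iexp (- (v / \<epsilon> * z)) * (complex_of_real (a n) * of_nat n powr (- Complex \<sigma> (- (z / \<epsilon>))))" for n z
  proof (cases "n = 0")
    case False
    have "complex_of_real (real n powr (-\<sigma>)) * iexp (((ln (real n) - v) / \<epsilon>) * z)
      = exp (of_real (- \<sigma> * ln (real n)) + \<i> * of_real (((ln (real n) - v) / \<epsilon>) * z))"
      using False unfolding exp_add by (simp add: powr_def flip: exp_of_real)
    also have "of_real (- \<sigma> * ln (real n)) + \<i> * of_real (((ln (real n) - v) / \<epsilon>) * z)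
      = \<i> * of_real (- (v / \<epsilon> * z)) + (- Complex \<sigma> (- (z / \<epsilon>))) * of_real (ln (real n))"
      using \<epsilon> by (simp add: complex_eq_iff field_simps)
    also have "exp \<dots> = iexp (- (v / \<epsilon> * z)) * of_nat n powr (- Complex \<sigma> (- (z / \<epsilon>)))"
      using False unfolding exp_add by (simp add: powr_def Ln_of_nat)
    finally show ?thesis by (simp add: f_def)
  qed (simp add: f_def)
  have f_meas: "f n \<in> borel_measurable ?M" for n
    unfolding f_def by (simp, measurable)
  have f_int: "integrable ?M (f n)" for n
    by (rule M.integrable_const_bound[of _ "\<bar>a n\<bar> * real n powr (-\<sigma>)"]) (use f_meas in \<open>auto simp: f_norm\<close>)
  have summ: "summable (\<lambda>n. \<bar>a n\<bar> * real n powr (-\<sigma>))"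
    by (rule summable_dser_abs[OF a \<sigma>])
  have sum1: "AE z in ?M. summable (\<lambda>n. norm (f n z))" by (simp add: f_norm summ)
  have sum2: "summable (\<lambda>n. \<integral>z. norm (f n z) \<partial>?M)"
    using summ M.prob_space by (simp add: f_norm)
  have suminf_f: "(\<Sum>n. f n z) = iexp (- (v / \<epsilon> * z)) * dser a (Complex \<sigma> (- (z / \<epsilon>)))" for z
    unfolding f_eq dser_def
    by (rule suminf_mult, rule summable_norm_cancel, rule summable_dser_norm[OF a]) (use \<sigma> in auto)
  have int_f: "(\<integral>z. f n z \<partial>?M) = complex_of_real (a n * real n powr (-\<sigma>) * gauss \<epsilon> (ln (real n) - v))" for n
  proof -
    have "(\<integral>z. f n z \<partial>?M) = complex_of_real (a n * real n powr (-\<sigma>)) * char ?M ((ln (real n) - v) / \<epsilon>)"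
      unfolding f_def char_def by simp
    also have "char ?M ((ln (real n) - v) / \<epsilon>) = complex_of_real (gauss \<epsilon> (ln (real n) - v))"
      by (simp add: char_std_normal_distribution power_divide mult.commute)
    finally show ?thesis by simp
  qed
  have "(\<Sum>n. complex_of_real (a n * real n powr (-\<sigma>) * gauss \<epsilon> (ln (real n) - v))) = (\<integral>z. (\<Sum>n. f n z) \<partial>?M)"
    unfolding int_f[symmetric] by (rule integral_suminf[OF f_int sum1 sum2, symmetric])
  moreover have "summable (\<lambda>n. a n * real n powr (-\<sigma>) * gauss \<epsilon> (ln (real n) - v))"
  proof (rule summable_comparison_test[OF _ summ], intro exI allI impI)
    fix n :: nat
    have "gauss \<epsilon> (ln (real n) - v) \<le> 1" using \<epsilon> by simp
    then show "norm (a n * real n powr (-\<sigma>) * gauss \<epsilon> (ln (real n) - v)) \<le> \<bar>a n\<bar> * real n powr (-\<sigma>)"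
      unfolding norm_mult by (simp add: mult_left_le)
  qed
  ultimately have eq: "complex_of_real (\<Sum>n. a n * real n powr (-\<sigma>) * gauss \<epsilon> (ln (real n) - v)) = (\<integral>z. (\<Sum>n. f n z) \<partial>?M)"
    by (subst suminf_of_real)
  have "\<bar>\<Sum>n. a n * real n powr (-\<sigma>) * gauss \<epsilon> (ln (real n) - v)\<bar> = norm (\<integral>z. (\<Sum>n. f n z) \<partial>?M)"
    unfolding eq[symmetric] by (simp only: norm_of_real)
  also have "\<dots> \<le> (\<integral>z. K / \<epsilon> ^ m * (1 + \<bar>z\<bar>) ^ m \<partial>?M)"
  proof (rule Bochner_Integration.integral_norm_bound_integral)
    show "integrable ?M (\<lambda>z. \<Sum>n. f n z)" by (rule integrable_suminf[OF f_int sum1 sum2])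
    show "integrable ?M (\<lambda>z. K / \<epsilon> ^ m * (1 + \<bar>z\<bar>) ^ m)"
      by (intro integrable_mult_right integrable_std_normal_1_plus_abs)
    fix z
    have "norm (\<Sum>n. f n z) = norm (dser a (Complex \<sigma> (- (z / \<epsilon>))))"
      unfolding suminf_f by (simp add: norm_mult)
    also have "\<dots> \<le> K * (1 + \<bar>- (z / \<epsilon>)\<bar>) ^ m" by (rule K)
    also have "\<dots> \<le> K * ((1 + \<bar>z\<bar>) / \<epsilon>) ^ m"
    proof (rule mult_left_mono)
      show "K \<ge> 0" using order_trans[OF norm_ge_zero K[of 0]] by simp
      show "(1 + \<bar>- (z / \<epsilon>)\<bar>) ^ m \<le> ((1 + \<bar>z\<bar>) / \<epsilon>) ^ m"
        using \<epsilon> by (intro power_mono) (auto simp: field_simps)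
    qed
    finally show "norm (\<Sum>n. f n z) \<le> K / \<epsilon> ^ m * (1 + \<bar>z\<bar>) ^ m" by (simp add: power_divide)
  qed
  also have "\<dots> = K / \<epsilon> ^ m * (\<integral>z. (1 + \<bar>z\<bar>) ^ m \<partial>?M)" by simp
  finally show ?thesis .
qed

text \<open>
  Completing the square absorbs n^(-\<sigma>) into a shift of \<^term>\<open>v\<close>. The smoothed sum itself is then free of \<sigma>,
  and \<sigma> \<rightarrow> 1 is needed only in the bound.
\<close>

lemma mang_ln_gauss_bound:
  obtains K where "K > 0"
    "\<And>v \<epsilon>. \<lbrakk>0 < \<epsilon>; \<epsilon> \<le> 1\<rbrakk> \<Longrightarrow> \<bar>\<Sum>n. mang_ln n * gauss \<epsilon> (ln (real n) - v)\<bar> \<le> K * exp v / \<epsilon> ^ 11"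
proof -
  obtain K where K: "K > 0" 
    "\<And>\<sigma> t. \<lbrakk>1 < \<sigma>; \<sigma> \<le> 2\<rbrakk> \<Longrightarrow> norm (dser mang_ln (Complex \<sigma> t)) \<le> K * (1 + \<bar>t\<bar>) ^ 11"
    using dser_mang_ln_bound by blast
  define G where "G = (\<integral>z. (1 + \<bar>z\<bar>) ^ 11 \<partial>std_normal_distribution)"
  have G: "G \<ge> 0" unfolding G_def by (rule Bochner_Integration.integral_nonneg) simp
  show ?thesis
  proof
    show "exp 2 * K * G + 1 > 0" using K(1) G by (intro add_nonneg_pos) auto
    fix v \<epsilon> :: real assume \<epsilon>: "0 < \<epsilon>" "\<epsilon> \<le> 1"
    define S where "S = (\<Sum>n. mang_ln n * gauss \<epsilon> (ln (real n) - v))"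
    have *: "\<bar>S\<bar> \<le> exp (\<sigma> * v) * (exp 2 * K * G / \<epsilon> ^ 11)" if \<sigma>: "1 < \<sigma>" "\<sigma> \<le> 2" for \<sigma>
    proof -
      define v' where "v' = v + \<sigma> * \<epsilon>\<^sup>2"
      have eq: "mang_ln n * gauss \<epsilon> (ln (real n) - v) =
        exp (\<sigma> * v + \<sigma>\<^sup>2 * \<epsilon>\<^sup>2 / 2) * (mang_ln n * real n powr (-\<sigma>) * gauss \<epsilon> (ln (real n) - v'))" for n
      proof (cases "n = 0")
        case False
        have "- ((ln (real n) - v)\<^sup>2 / (2 * \<epsilon>\<^sup>2)) = (\<sigma> * v + \<sigma>\<^sup>2 * \<epsilon>\<^sup>2 / 2) + - \<sigma> * ln (real n) + - ((ln (real n) - v')\<^sup>2 / (2 * \<epsilon>\<^sup>2))"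
          using \<epsilon> by (simp add: v'_def field_simps power2_eq_square)
        then have "gauss \<epsilon> (ln (real n) - v) = exp (\<sigma> * v + \<sigma>\<^sup>2 * \<epsilon>\<^sup>2 / 2) * exp (- \<sigma> * ln (real n)) * gauss \<epsilon> (ln (real n) - v')"
          by (simp only: exp_add)
        then show ?thesis using False by (simp add: powr_def)
      qed (simp add: mang_ln_def)
      have "summable (\<lambda>n. mang_ln n * real n powr (-\<sigma>) * gauss \<epsilon> (ln (real n) - v'))"
      proof (rule summable_comparison_test[OF _ summable_dser_abs[OF mang_ln_abs_le \<sigma>(1)]], intro exI allI impI)
        fix n :: nat
        have "gauss \<epsilon> (ln (real n) - v') \<le> 1" using \<epsilon> by simp
        then show "norm (mang_ln n * real n powr (-\<sigma>) * gauss \<epsilon> (ln (real n) - v')) \<le> \<bar>mang_ln n\<bar> * real n powr (-\<sigma>)"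
          unfolding norm_mult by (simp add: mult_left_le)
      qed
      then have "S = exp (\<sigma> * v + \<sigma>\<^sup>2 * \<epsilon>\<^sup>2 / 2) * (\<Sum>n. mang_ln n * real n powr (-\<sigma>) * gauss \<epsilon> (ln (real n) - v'))"
        unfolding S_def eq by (rule suminf_mult)
      then have "\<bar>S\<bar> \<le> exp (\<sigma> * v + \<sigma>\<^sup>2 * \<epsilon>\<^sup>2 / 2) * (K / \<epsilon> ^ 11 * G)"
        using mult_left_mono[OF gauss_smoothing_dser[OF mang_ln_abs_le K(2)[OF \<sigma>] \<sigma>(1) \<epsilon>, of v']
            exp_ge_zero, of "\<sigma> * v + \<sigma>\<^sup>2 * \<epsilon>\<^sup>2 / 2"]
        by (simp only: abs_mult abs_exp_cancel G_def)
      also have "\<dots> \<le> exp (\<sigma> * v + 2) * (K / \<epsilon> ^ 11 * G)"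
      proof -
        have "\<sigma>\<^sup>2 * \<epsilon>\<^sup>2 \<le> 2\<^sup>2 * 1\<^sup>2" using \<sigma> \<epsilon> by (intro mult_mono power_mono) auto
        then show ?thesis using K(1) G \<epsilon> by (intro mult_right_mono) auto
      qed
      finally show ?thesis by (simp add: exp_add mult_ac)
    qed
    have "\<bar>S\<bar> \<le> exp (1 * v) * (exp 2 * K * G / \<epsilon> ^ 11)"
    proof (rule tendsto_lowerbound)
      show "((\<lambda>\<sigma>. exp (\<sigma> * v) * (exp 2 * K * G / \<epsilon> ^ 11)) \<longlongrightarrow> exp (1 * v) * (exp 2 * K * G / \<epsilon> ^ 11)) (at_right 1)"
        by (intro tendsto_intros)
      show "\<forall>\<^sub>F \<sigma> in at_right 1. \<bar>S\<bar> \<le> exp (\<sigma> * v) * (exp 2 * K * G / \<epsilon> ^ 11)"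
        unfolding eventually_at_right_field by (intro exI[of _ 2] conjI allI impI *) auto
    qed auto
    also have "\<dots> \<le> (exp 2 * K * G + 1) * exp v / \<epsilon> ^ 11"
      using \<epsilon> by (simp add: field_simps)
    finally show "\<bar>\<Sum>n. mang_ln n * gauss \<epsilon> (ln (real n) - v)\<bar> \<le> (exp 2 * K * G + 1) * exp v / \<epsilon> ^ 11"
      by (simp only: S_def)
  qed
qed

section \<open>Gaussian tails as smooth cut-offs\<close>

definition gtail :: "real \<Rightarrow> real \<Rightarrow> real" where
  "gtail \<epsilon> y = (\<integral>x. indicator {y..} x * gauss \<epsilon> x \<partial>lborel)"

lemma has_bochner_integral_exp_atLeast:
  assumes "c > 0"
  shows "has_bochner_integral lborel (\<lambda>u::real. indicator {y..} u * exp (- (c * u))) (exp (- (c * y)) / c)"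
proof (rule has_bochner_integral_nn_integral)
  have "((\<lambda>u. - exp (- (c * u)) / c) \<longlongrightarrow> 0) at_top"
    using assms by real_asymp
  then have "(\<integral>\<^sup>+u. ennreal (exp (- (c * u))) * indicator {y..} u \<partial>lborel) = ennreal (0 - (- exp (- (c * y)) / c))"
    using assms by (intro nn_integral_FTC_atLeast) (auto intro!: derivative_eq_intros)
  then show "(\<integral>\<^sup>+u. ennreal (indicator {y..} u * exp (- (c * u))) \<partial>lborel) = ennreal (exp (- (c * y)) / c)"
    by (simp add: mult.commute ennreal_mult ennreal_indicator)
qed (use assms in auto)

lemma integral_exp_atMost: "(\<integral>v. indicator {..L} v * exp v \<partial>lborel) = exp (L::real)"
  and integrable_exp_atMost: "integrable lborel (\<lambda>v. indicator {..L} v * exp (v::real))"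
proof -
  have *: "indicator {..L} (L + - 1 * u) * exp (L + - 1 * u) = exp L * (indicator {0..} u * exp (- (1 * u)))" for u :: real
    by (auto simp: indicator_def exp_add exp_minus exp_diff field_simps)
  show "(\<integral>v. indicator {..L} v * exp v \<partial>lborel) = exp (L::real)"
    using has_bochner_integral_exp_atLeast[of 1 0]
    by (subst lborel_integral_real_affine[of "-1" _ L]) (simp_all only: *, auto simp: has_bochner_integral_iff)
  show "integrable lborel (\<lambda>v. indicator {..L} v * exp (v::real))"
    using has_bochner_integral_exp_atLeast[of 1 0]
    by (subst lborel_integrable_real_affine_iff[of "-1" _ L, symmetric]) (simp_all only: *, auto simp: has_bochner_integral_iff)
qed

lemma integrable_gauss: "\<epsilon> > 0 \<Longrightarrow> integrable lborel (gauss \<epsilon>)"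
  and integral_gauss: "\<epsilon> > 0 \<Longrightarrow> (\<integral>x. gauss \<epsilon> x \<partial>lborel) = \<epsilon> * sqrt (2 * pi)"
proof -
  assume \<epsilon>: "\<epsilon> > 0"
  have *: "gauss \<epsilon> = (\<lambda>x. (\<epsilon> * sqrt (2 * pi)) * normal_density 0 \<epsilon> x)"
    using \<epsilon> by (auto simp: normal_density_def real_sqrt_mult)
  show "integrable lborel (gauss \<epsilon>)"
    unfolding * by (intro integrable_mult_right integrable_normal_density \<epsilon>)
  show "(\<integral>x. gauss \<epsilon> x \<partial>lborel) = \<epsilon> * sqrt (2 * pi)"
    unfolding * using \<epsilon> by simp
qed

lemma integrable_indicator_gauss:
  assumes "\<epsilon> > 0" "A \<in> sets borel"
  shows "integrable lborel (\<lambda>x. indicator A x * gauss \<epsilon> x)"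
  using assms(2) integrable_mult_indicator[OF _ integrable_gauss[OF assms(1)], of A]
  by simp

text \<open>Half of the exponent yields exp (- \<kappa>^2 / (4 \<epsilon>^2)), which is tiny when
  \<kappa> is large against \<epsilon>. The other half is at least u^2 / 4, hence at least 5 u - 25
  because (u / 2 - 5)^2 \<ge> 0. For u = ln n - v the factor exp (- 5 u) decays like n^(-5), which
  outweighs ln^2 n in sums over n.\<close>

lemma gauss_le_exp:
  assumes "0 < \<epsilon>" "\<epsilon> \<le> 1" "\<kappa> \<le> u" "0 \<le> \<kappa>"
  shows "gauss \<epsilon> u \<le> exp (25 - \<kappa>\<^sup>2 / (4 * \<epsilon>\<^sup>2)) * exp (- (5 * u))"
proof -
  have "\<kappa>\<^sup>2 / (4 * \<epsilon>\<^sup>2) \<le> u\<^sup>2 / (4 * \<epsilon>\<^sup>2)" using assms by (intro divide_right_mono power_mono) auto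
  moreover have "u\<^sup>2 / 4 \<le> u\<^sup>2 / (4 * \<epsilon>\<^sup>2)" using assms by (intro divide_left_mono) (auto simp: power_le_one)
  moreover have "0 \<le> (u / 2 - 5)\<^sup>2" by simp
  then have "5 * u - 25 \<le> u\<^sup>2 / 4" by (simp add: power2_eq_square field_simps)
  ultimately have "- (u\<^sup>2 / (2 * \<epsilon>\<^sup>2)) \<le> (25 - \<kappa>\<^sup>2 / (4 * \<epsilon>\<^sup>2)) + - (5 * u)" by simp
  then show ?thesis unfolding exp_add[symmetric] by simp
qed

lemma gtail_nonneg: "gtail \<epsilon> y \<ge> 0"
  unfolding gtail_def by (rule Bochner_Integration.integral_nonneg) simp

lemma gtail_le_total: "\<epsilon> > 0 \<Longrightarrow> gtail \<epsilon> y \<le> \<epsilon> * sqrt (2 * pi)"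
  unfolding gtail_def integral_gauss[symmetric]
  by (intro integral_mono integrable_indicator_gauss integrable_gauss) (auto simp: indicator_def)

lemma gtail_le_exp:
  assumes "0 < \<epsilon>" "\<epsilon> \<le> 1" "\<kappa> \<le> y" "0 \<le> \<kappa>"
  shows "gtail \<epsilon> y \<le> exp (25 - \<kappa>\<^sup>2 / (4 * \<epsilon>\<^sup>2)) * exp (- (5 * y))"
proof -
  let ?\<tau> = "exp (25 - \<kappa>\<^sup>2 / (4 * \<epsilon>\<^sup>2))"
  have E: "integrable lborel (\<lambda>u::real. indicator {y..} u * exp (- (5 * u)))"
    "(\<integral>u. indicator {y..} u * exp (- (5 * u)) \<partial>lborel) = exp (- (5 * y)) / 5"
    using has_bochner_integral_exp_atLeast[of 5 y] by (auto simp: has_bochner_integral_iff)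
  have "gtail \<epsilon> y \<le> (\<integral>u. ?\<tau> * (indicator {y..} u * exp (- (5 * u))) \<partial>lborel)"
    unfolding gtail_def
  proof (intro integral_mono integrable_indicator_gauss integrable_mult_right E)
    show "indicator {y..} u * gauss \<epsilon> u \<le> ?\<tau> * (indicator {y..} u * exp (- (5 * u)))" for u
      using gauss_le_exp[OF assms(1,2) _ assms(4), of u] assms(3) by (auto simp: indicator_def)
  qed (use assms in auto)
  also have "\<dots> = ?\<tau> * (exp (- (5 * y)) / 5)" unfolding integral_mult_right_zero E ..
  also have "\<dots> \<le> ?\<tau> * exp (- (5 * y))" by (intro mult_left_mono) auto
  finally show ?thesis .
qed

text \<open>By reflection, the part missing from the total mass is an upper tail beyond
  \<kappa>.\<close>

lemma gtail_ge:
  assumes "0 < \<epsilon>" "\<epsilon> \<le> 1" "0 \<le> \<kappa>" "y \<le> - \<kappa>"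
  shows "gtail \<epsilon> y \<ge> \<epsilon> * sqrt (2 * pi) - exp (25 - \<kappa>\<^sup>2 / (4 * \<epsilon>\<^sup>2))"
proof -
  have "(\<integral>x. indicator {..<y} x * gauss \<epsilon> x \<partial>lborel) = (\<integral>x. indicator {- y<..} x * gauss \<epsilon> x \<partial>lborel)"
    by (subst lborel_integral_real_affine[of "-1" _ 0]) (auto intro!: Bochner_Integration.integral_cong simp: indicator_def)
  also have "\<dots> \<le> gtail \<epsilon> (- y)"
    unfolding gtail_def using assms
    by (intro integral_mono integrable_indicator_gauss) (auto simp: indicator_def)
  also have "\<dots> \<le> exp (25 - \<kappa>\<^sup>2 / (4 * \<epsilon>\<^sup>2)) * exp (- (5 * (- y)))"
    using assms by (intro gtail_le_exp) auto
  also have "\<dots> \<le> exp (25 - \<kappa>\<^sup>2 / (4 * \<epsilon>\<^sup>2)) * 1"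
    using assms by (intro mult_left_mono) auto
  finally have "(\<integral>x. indicator {..<y} x * gauss \<epsilon> x \<partial>lborel) \<le> exp (25 - \<kappa>\<^sup>2 / (4 * \<epsilon>\<^sup>2))" by simp
  moreover have "(\<integral>x. indicator {..<y} x * gauss \<epsilon> x \<partial>lborel) + gtail \<epsilon> y = \<epsilon> * sqrt (2 * pi)"
    unfolding gtail_def integral_gauss[OF assms(1), symmetric] using assms(1)
    by (subst Bochner_Integration.integral_add[symmetric])
       (auto intro!: integrable_indicator_gauss Bochner_Integration.integral_cong split: split_indicator)
  ultimately show ?thesis by linarith
qed

text \<open>Integration over all centres v \<le> L turns the bump into a cut-off: the weight is
  nearly the full Gaussian mass for l well below L and nearly 0 for l well above.\<close>

lemma integral_gauss_atMost:
  "(\<integral>v. indicator {..L} v * gauss \<epsilon> (l - v) \<partial>lborel) = gtail \<epsilon> (l - L)"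
  unfolding gtail_def
  by (subst lborel_integral_real_affine[of "-1" _ l]) (auto intro!: Bochner_Integration.integral_cong simp: indicator_def)

lemma integrable_gauss_atMost:
  assumes "\<epsilon> > 0"
  shows "integrable lborel (\<lambda>v. indicator {..L} v * gauss \<epsilon> (l - v))"
proof -
  have "integrable lborel (\<lambda>v. indicator {..L} (l + - 1 * v) * gauss \<epsilon> (l - (l + -1 * v)))"
    using integrable_indicator_gauss[OF assms, of "{l - L..}"]
    by (rule Bochner_Integration.integrable_cong[THEN iffD1, rotated -1]) (auto simp: indicator_def)
  then show ?thesis
    by (subst (asm) lborel_integrable_real_affine_iff[of "-1" "\<lambda>v. indicator {..L} v * gauss \<epsilon> (l - v)" l]) auto
qed

lemma exp_minus_5_diff_ln: "n > 0 \<Longrightarrow> exp (- (5 * (ln (real n) - v))) = exp (5 * v) / real n ^ 5"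
  using exp_of_nat_mult[of 5 "ln (real n)"] by (simp add: exp_diff algebra_simps)

lemma summable_weight_5:
  fixes a :: "nat \<Rightarrow> real"
  assumes "\<And>n. n > 0 \<Longrightarrow> \<bar>a n\<bar> \<le> (1 + ln (real n))\<^sup>2" "a 0 = 0"
    and "\<And>n. n > 0 \<Longrightarrow> \<bar>r n\<bar> \<le> C / real n ^ 5"
  shows "summable (\<lambda>n. \<bar>a n * r n\<bar>)"
proof (rule summable_comparison_test_bigo)
  have "summable (\<lambda>n. real n powr (-2))" by (subst summable_real_powr_iff) auto
  then show "summable (\<lambda>n. norm (real n powr (-2)))" by simp
  have "(\<lambda>n. \<bar>a n * r n\<bar>) \<in> O(\<lambda>n. (1 + ln (real n))\<^sup>2 * (C / real n ^ 5))"
  proof (rule bigoI[of _ 1], rule eventually_mono[OF eventually_gt_at_top[of 0]])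
    fix n :: nat assume n: "n > 0"
    have "\<bar>a n * r n\<bar> \<le> (1 + ln (real n))\<^sup>2 * (C / real n ^ 5)"
      unfolding abs_mult using assms(1,3)[OF n] by (intro mult_mono) auto
    then show "norm \<bar>a n * r n\<bar> \<le> 1 * norm ((1 + ln (real n))\<^sup>2 * (C / real n ^ 5))"
      by (simp only: real_norm_def abs_abs mult_1 abs_ge_self order_trans)
  qed
  also have "(\<lambda>n. (1 + ln (real n))\<^sup>2 * (C / real n ^ 5)) \<in> O(\<lambda>n. real n powr (-2))"
  proof (cases "C = 0")
    case False
    then show ?thesis by real_asymp
  qed simp
  finally show "(\<lambda>n. \<bar>a n * r n\<bar>) \<in> O(\<lambda>n. real n powr (-2))" .
qed

lemma summable_gtail:
  fixes a :: "nat \<Rightarrow> real"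
  assumes "\<And>n. n > 0 \<Longrightarrow> \<bar>a n\<bar> \<le> (1 + ln (real n))\<^sup>2" "a 0 = 0" and \<epsilon>: "0 < \<epsilon>" "\<epsilon> \<le> 1"
  shows "summable (\<lambda>n. \<bar>a n * gtail \<epsilon> (ln (real n) - L)\<bar>)"
proof (rule summable_weight_5[OF assms(1,2)])
  fix n :: nat assume n: "n > 0"
  show "\<bar>gtail \<epsilon> (ln (real n) - L)\<bar> \<le> exp 25 * exp (5 * L) / real n ^ 5"
  proof (cases "ln (real n) - L \<ge> 0")
    case True
    then have "gtail \<epsilon> (ln (real n) - L) \<le> exp (25 - 0\<^sup>2 / (4 * \<epsilon>\<^sup>2)) * exp (- (5 * (ln (real n) - L)))"
      using \<epsilon> by (intro gtail_le_exp) auto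
    then show ?thesis using n gtail_nonneg exp_minus_5_diff_ln[of n L] by simp
  next
    case False
    have "gtail \<epsilon> (ln (real n) - L) \<le> \<epsilon> * sqrt (2 * pi)" by (rule gtail_le_total[OF \<epsilon>(1)])
    also have "\<dots> \<le> 1 * exp 25"
    proof (intro mult_mono)
      have "2 * pi \<le> 8" using pi_less_4 by simp
      then have "sqrt (2 * pi) \<le> sqrt (3\<^sup>2)" by (intro real_sqrt_le_mono) simp
      also have "\<dots> \<le> 1 + 25" by simp
      also have "\<dots> \<le> exp 25" by (rule exp_ge_add_one_self)
      finally show "sqrt (2 * pi) \<le> exp 25" .
    qed (use \<epsilon> in auto)
    also have "\<dots> \<le> exp 25 * exp (- (5 * (ln (real n) - L)))"
      using False by simp
    finally show ?thesis using n gtail_nonneg exp_minus_5_diff_ln[of n L] by simp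
  qed
qed

lemma ln_power2_le: "n > 0 \<Longrightarrow> ln (real n) ^ 2 \<le> (1 + ln (real n))\<^sup>2"
  by (rule power_mono) auto

lemma mang_ln_abs_le': "n > 0 \<Longrightarrow> \<bar>mang_ln n\<bar> \<le> (1 + ln (real n))\<^sup>2"
  using mang_ln_abs_le[of n] ln_power2_le[of n] by linarith

text \<open>The bound for the smoothed sum grows like exp v, so its integral over v \<le> L is again
  of order exp L: passing from a bump to a cut-off costs nothing. The decay n^(-5) of the weights
  justifies the exchange of sum and integral.\<close>

lemma mang_ln_gtail_bound:
  obtains K where "K > 0"
    "\<And>L \<epsilon>. \<lbrakk>0 < \<epsilon>; \<epsilon> \<le> 1\<rbrakk> \<Longrightarrow> \<bar>\<Sum>n. mang_ln n * gtail \<epsilon> (ln (real n) - L)\<bar> \<le> K * exp L / \<epsilon> ^ 11"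
proof -
  obtain K where K: "K > 0"
    "\<And>v \<epsilon>. \<lbrakk>0 < \<epsilon>; \<epsilon> \<le> 1\<rbrakk> \<Longrightarrow> \<bar>\<Sum>n. mang_ln n * gauss \<epsilon> (ln (real n) - v)\<bar> \<le> K * exp v / \<epsilon> ^ 11"
    using mang_ln_gauss_bound by blast
  have "\<bar>\<Sum>n. mang_ln n * gtail \<epsilon> (ln (real n) - L)\<bar> \<le> K * exp L / \<epsilon> ^ 11"
    if \<epsilon>: "0 < \<epsilon>" "\<epsilon> \<le> 1" for L \<epsilon>
  proof -
    define f where "f = (\<lambda>n v. mang_ln n * (indicator {..L} v * gauss \<epsilon> (ln (real n) - v)))"
    have f_int: "integrable lborel (f n)" for n
      unfolding f_def by (intro integrable_mult_right integrable_gauss_atMost \<epsilon>)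
    have sg: "summable (\<lambda>n. \<bar>mang_ln n * gauss \<epsilon> (ln (real n) - v)\<bar>)" for v
    proof (rule summable_weight_5[OF mang_ln_abs_le'])
      fix n :: nat assume n: "n > 0"
      show "\<bar>gauss \<epsilon> (ln (real n) - v)\<bar> \<le> exp 25 * exp (5 * v) / real n ^ 5"
      proof (cases "ln (real n) - v \<ge> 0")
        case True
        then show ?thesis
          using gauss_le_exp[OF \<epsilon>, of 0 "ln (real n) - v"] n exp_minus_5_diff_ln[of n v] by simp
      next
        case False
        have "gauss \<epsilon> (ln (real n) - v) \<le> 1 * 1" using \<epsilon> by simp
        also have "\<dots> \<le> exp 25 * exp (- (5 * (ln (real n) - v)))"
          using False by (intro mult_mono) auto
        finally show ?thesis using n exp_minus_5_diff_ln[of n v] by simp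
      qed
    qed (auto simp: mang_ln_def)
    have sf: "summable (\<lambda>n. norm (f n v))" for v
      by (rule summable_comparison_test[OF _ sg[of v]]) (auto simp: f_def indicator_def)
    have int_norm: "(\<integral>v. norm (f n v) \<partial>lborel) = \<bar>mang_ln n * gtail \<epsilon> (ln (real n) - L)\<bar>" for n
      using gtail_nonneg by (simp add: f_def abs_mult integral_gauss_atMost)
    have s2: "summable (\<lambda>n. \<integral>v. norm (f n v) \<partial>lborel)"
      unfolding int_norm by (rule summable_gtail[OF mang_ln_abs_le' _ \<epsilon>]) (auto simp: mang_ln_def)
    have ae: "AE v in lborel. summable (\<lambda>n. norm (f n v))" using sf by simp
    have "(\<Sum>n. mang_ln n * gtail \<epsilon> (ln (real n) - L)) = (\<Sum>n. \<integral>v. f n v \<partial>lborel)"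
      by (simp add: f_def integral_gauss_atMost)
    also have "\<dots> = (\<integral>v. (\<Sum>n. f n v) \<partial>lborel)"
      by (rule integral_suminf[OF f_int ae s2, symmetric])
    finally have "\<bar>\<Sum>n. mang_ln n * gtail \<epsilon> (ln (real n) - L)\<bar> = norm (\<integral>v. (\<Sum>n. f n v) \<partial>lborel)" by simp
    also have "\<dots> \<le> (\<integral>v. K / \<epsilon> ^ 11 * (indicator {..L} v * exp v) \<partial>lborel)"
    proof (rule Bochner_Integration.integral_norm_bound_integral)
      show "integrable lborel (\<lambda>v. \<Sum>n. f n v)" by (rule integrable_suminf[OF f_int ae s2])
      show "integrable lborel (\<lambda>v. K / \<epsilon> ^ 11 * (indicator {..L} v * exp v))"
        by (intro integrable_mult_right integrable_exp_atMost)
      show "norm (\<Sum>n. f n v) \<le> K / \<epsilon> ^ 11 * (indicator {..L} v * exp v)" for v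
        using K(2)[OF \<epsilon>, of v] by (auto simp: f_def indicator_def)
    qed
    also have "\<dots> = K * exp L / \<epsilon> ^ 11"
      unfolding integral_mult_right_zero integral_exp_atMost by simp
    finally show ?thesis .
  qed
  then show ?thesis using that K(1) by blast
qed

section \<open>From smoothed sums to summatory functions\<close>

definition csum :: "(nat \<Rightarrow> real) \<Rightarrow> real \<Rightarrow> real" where
  "csum a x = (\<Sum>n | real n \<le> x. a n)"

lemma finite_nat_le_real [simp, intro]: "finite {n. real n \<le> x}"
proof (rule finite_subset)
  show "{n. real n \<le> x} \<subseteq> {..nat \<lfloor>x\<rfloor>}" by (auto simp: le_nat_floor)
qed auto

lemma csum_altdef:
  assumes "x \<ge> 0" "a 0 = 0"
  shows "csum a x = (\<Sum>n=1..nat \<lfloor>x\<rfloor>. a n)"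
proof -
  have "real n \<le> x \<longleftrightarrow> n \<le> nat \<lfloor>x\<rfloor>" for n
    using assms by (simp add: le_nat_iff le_floor_iff)
  then have "csum a x = (\<Sum>n\<le>nat \<lfloor>x\<rfloor>. a n)" by (simp add: csum_def atMost_def)
  also have "\<dots> = (\<Sum>n=1..nat \<lfloor>x\<rfloor>. a n)"
    by (rule sum.mono_neutral_right) (use assms in \<open>auto simp: Suc_le_eq intro: Nat.gr0I\<close>)
  finally show ?thesis .
qed

text \<open>The bound 1 / (M + 1)^2 \<le> 1 / M - 1 / (M + 1) telescopes to the reciprocal of the
  integer part of x, which is at most 2 / x; the normalisation by x^2 gives a tail of order
  x.\<close>

lemma inverse_square_tail:
  fixes x :: real
  assumes x: "x \<ge> 1"
  shows "summable (\<lambda>n. if real n > x then x\<^sup>2 / (real n)\<^sup>2 else 0)"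
    and "(\<Sum>n. if real n > x then x\<^sup>2 / (real n)\<^sup>2 else 0) \<le> 2 * x"
proof -
  define g where "g = (\<lambda>n. if real n > x then x\<^sup>2 / (real n)\<^sup>2 else 0)"
  define m where "m = nat \<lfloor>x\<rfloor>"
  have m1: "m \<ge> 1" using x by (simp add: m_def le_nat_floor)
  have m2: "x < real m + 1" "real m \<le> x" using x by (simp_all add: m_def)
  have mx: "x / 2 \<le> real m" using m1 m2 by simp
  have iff: "real n > x \<longleftrightarrow> n \<ge> m + 1" for n
    using m2 by (metis Suc_eq_plus1 less_Suc_eq_le linorder_not_less nat_less_real_le not_less_eq_eq of_nat_le_iff order_le_less_trans order_less_le_trans)
  have tel: "(\<lambda>i. 1 / real (m + i) - 1 / real (m + Suc i)) sums (1 / real (m + 0) - 0)"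
    by (rule telescope_sums') real_asymp
  have term_le: "g (i + (m + 1)) \<le> x\<^sup>2 * (1 / real (m + i) - 1 / real (m + Suc i))" for i
  proof -
    define M where "M = real (m + i)"
    have M: "M > 0" using m1 by (simp add: M_def)
    then have "1 / (M + 1)\<^sup>2 \<le> 1 / (M * (M + 1))"
      unfolding power2_eq_square by (intro divide_left_mono mult_right_mono) auto
    also have "\<dots> = 1 / M - 1 / (M + 1)" using M by (simp add: field_simps)
    finally have "x\<^sup>2 * (1 / (M + 1)\<^sup>2) \<le> x\<^sup>2 * (1 / M - 1 / (M + 1))"
      by (rule mult_left_mono) simp
    moreover have "g (i + (m + 1)) = x\<^sup>2 * (1 / (M + 1)\<^sup>2)"
      unfolding g_def iff by (simp add: M_def add_ac)
    ultimately show ?thesis by (simp add: M_def add_ac)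
  qed
  have nonneg: "g n \<ge> 0" for n by (simp add: g_def)
  have summ: "summable (\<lambda>i. g (i + (m + 1)))"
    by (rule summable_comparison_test[OF _ summable_mult[OF sums_summable[OF tel], of "x\<^sup>2"]])
       (use term_le nonneg in auto)
  then have sg: "summable g" by (subst (asm) summable_iff_shift)
  then show "summable (\<lambda>n. if real n > x then x\<^sup>2 / (real n)\<^sup>2 else 0)" by (simp add: g_def)
  have "(\<Sum>n<m + 1. g n) = 0" unfolding g_def iff by (rule sum.neutral) auto
  then have "suminf g = (\<Sum>i. g (i + (m + 1)))"
    using suminf_split_initial_segment[OF sg, of "m + 1"] by linarith
  also have "\<dots> \<le> (\<Sum>i. x\<^sup>2 * (1 / real (m + i) - 1 / real (m + Suc i)))"
    by (intro suminf_le term_le summ summable_mult sums_summable[OF tel])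
  also have "\<dots> = x\<^sup>2 * (1 / real m)"
    using sums_unique[OF tel] suminf_mult[OF sums_summable[OF tel], of "x\<^sup>2"] by simp
  also have "\<dots> \<le> x\<^sup>2 * (2 / x)"
    using mx x m1 by (intro mult_left_mono) (auto simp: field_simps)
  also have "\<dots> = 2 * x" using x by (simp add: power2_eq_square)
  finally show "(\<Sum>n. if real n > x then x\<^sup>2 / (real n)\<^sup>2 else 0) \<le> 2 * x" by (simp add: g_def)
qed

text \<open>The weight is at least the full mass less \<open>\<tau>\<close> below exp (L -
  \<kappa>), at most the full mass everywhere, and at most \<tau> (exp L / n)^5 beyond exp (L +
  \<kappa>). As the coefficients are non-negative, the smoothed sum is caught between sharp sums at
  the two displaced limits.\<close>

lemma smoothed_csum:
  fixes a :: "nat \<Rightarrow> real"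
  assumes a: "\<And>n. 0 \<le> a n" "\<And>n. n > 0 \<Longrightarrow> a n \<le> (1 + ln (real n))\<^sup>2" "a 0 = 0"
    and \<epsilon>: "0 < \<epsilon>" "\<epsilon> \<le> 1" and \<kappa>: "0 \<le> \<kappa>" and L: "L \<ge> 1"
  defines "\<tau> \<equiv> exp (25 - \<kappa>\<^sup>2 / (4 * \<epsilon>\<^sup>2))" and "J \<equiv> (\<Sum>n. a n * gtail \<epsilon> (ln (real n) - L))"
  shows "(\<epsilon> * sqrt (2 * pi) - \<tau>) * csum a (exp (L - \<kappa>)) \<le> J"
    and "J \<le> \<epsilon> * sqrt (2 * pi) * csum a (exp (L + \<kappa>)) + 8 * \<tau> * L\<^sup>2 * exp L"
proof -
  let ?G = "\<epsilon> * sqrt (2 * pi)"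
  have summ: "summable (\<lambda>n. a n * gtail \<epsilon> (ln (real n) - L))"
    by (rule summable_rabs_cancel, rule summable_gtail[where a = a, OF _ a(3) \<epsilon>]) (use a in auto)
  have "(?G - \<tau>) * csum a (exp (L - \<kappa>)) = (\<Sum>n | real n \<le> exp (L - \<kappa>). (?G - \<tau>) * a n)"
    unfolding csum_def by (rule sum_distrib_left)
  also have "\<dots> \<le> (\<Sum>n | real n \<le> exp (L - \<kappa>). a n * gtail \<epsilon> (ln (real n) - L))"
  proof (rule sum_mono)
    fix n assume n: "n \<in> {n. real n \<le> exp (L - \<kappa>)}"
    show "(?G - \<tau>) * a n \<le> a n * gtail \<epsilon> (ln (real n) - L)"
    proof (cases "n = 0")
      case False
      then have "ln (real n) \<le> ln (exp (L - \<kappa>))" using n by (subst ln_le_cancel_iff) auto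
      then have "?G - \<tau> \<le> gtail \<epsilon> (ln (real n) - L)"
        unfolding \<tau>_def using \<epsilon> \<kappa> by (intro gtail_ge) auto
      from mult_left_mono[OF this a(1)[of n]] show ?thesis by (simp add: mult.commute)
    qed (simp add: a)
  qed
  also have "\<dots> \<le> J"
    unfolding J_def by (rule sum_le_suminf[OF summ]) (auto intro!: mult_nonneg_nonneg a gtail_nonneg)
  finally show "(?G - \<tau>) * csum a (exp (L - \<kappa>)) \<le> J" .
  define x where "x = exp L"
  have x1: "x \<ge> 1" using L by (simp add: x_def)
  define g where "g = (\<lambda>n::nat. if real n > x then x\<^sup>2 / (real n)\<^sup>2 else 0)"
  define h where "h = (\<lambda>n. if n \<in> {n. real n \<le> exp (L + \<kappa>)} then ?G * a n else 0)"
  have h: "h sums (\<Sum>n | real n \<le> exp (L + \<kappa>). ?G * a n)"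
    unfolding h_def by (rule sums_If_finite_set) auto
  have "a n * gtail \<epsilon> (ln (real n) - L) \<le> h n + 4 * \<tau> * L\<^sup>2 * g n" for n
  proof (cases "real n \<le> exp (L + \<kappa>)")
    case True
    have "a n * gtail \<epsilon> (ln (real n) - L) \<le> a n * ?G"
      by (intro mult_left_mono gtail_le_total \<epsilon> a)
    moreover have "0 \<le> 4 * \<tau> * L\<^sup>2 * g n" by (simp add: \<tau>_def g_def)
    ultimately show ?thesis using True unfolding h_def by (simp only: mem_Collect_eq if_True mult.commute[of ?G])
  next
    case False
    then have n: "real n > exp (L + \<kappa>)" by simp
    have "exp (L + \<kappa>) \<ge> x" using \<kappa> by (simp add: x_def)
    then have nx: "real n > x" using n by simp
    have n0: "n > 0" using nx x1 by (auto intro: Nat.gr0I)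
    have lnn: "ln (real n) > L + \<kappa>" using n n0 by (metis exp_less_cancel_iff exp_ln of_nat_0_less_iff)
    \<comment> \<open>This makes the coefficient at most (2 L n / x)^2. Against the decay (x / n)^5
      that leaves (x / n)^3, and already (x / n)^2 has a tail sum of order x.\<close>
    have "ln (real n / x) \<le> real n / x - 1" using nx x1 by (intro ln_le_minus_one) auto
    moreover have "ln (real n / x) = ln (real n) - L" using n0 x1 by (simp add: ln_div x_def)
    ultimately have "1 + ln (real n) \<le> L + real n / x" by simp
    also have "\<dots> \<le> L * (real n / x) + L * (real n / x)"
      using L nx x1 mult_mono[of 1 L "real n / x" "real n / x"] mult_left_mono[of 1 "real n / x" L]
      by (intro add_mono) auto
    finally have "(1 + ln (real n))\<^sup>2 \<le> (2 * L * (real n / x))\<^sup>2"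
      using n0 by (intro power_mono) auto
    then have an: "a n \<le> 4 * L\<^sup>2 * (real n / x)\<^sup>2"
      using a(2)[OF n0] unfolding power_mult_distrib by simp
    have "gtail \<epsilon> (ln (real n) - L) \<le> \<tau> * exp (- (5 * (ln (real n) - L)))"
      unfolding \<tau>_def using \<epsilon> \<kappa> lnn by (intro gtail_le_exp) auto
    also have "\<dots> = \<tau> * (x / real n) ^ 5"
      using exp_minus_5_diff_ln[OF n0, of L] exp_of_nat_mult[of 5 L] by (simp add: x_def power_divide)
    finally have "a n * gtail \<epsilon> (ln (real n) - L) \<le> (4 * L\<^sup>2 * (real n / x)\<^sup>2) * (\<tau> * (x / real n) ^ 5)"
      using an by (intro mult_mono gtail_nonneg) auto
    also have "\<dots> = 4 * \<tau> * L\<^sup>2 * (x / real n) ^ 3"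
      using n0 x1 by (simp add: field_simps eval_nat_numeral)
    also have "\<dots> \<le> 4 * \<tau> * L\<^sup>2 * (x / real n) ^ 2"
      using nx x1 by (intro mult_left_mono power_decreasing) (auto simp: \<tau>_def)
    also have "\<dots> = 4 * \<tau> * L\<^sup>2 * g n" using nx by (simp add: g_def power_divide)
    finally show ?thesis using False by (simp add: h_def)
  qed
  then have "J \<le> (\<Sum>n. h n + 4 * \<tau> * L\<^sup>2 * g n)"
    unfolding J_def g_def
    by (intro suminf_le summ summable_add sums_summable[OF h] summable_mult inverse_square_tail(1)[OF x1])
  also have "\<dots> = (\<Sum>n. h n) + (\<Sum>n. 4 * \<tau> * L\<^sup>2 * g n)"
    unfolding g_def
    by (intro suminf_add[symmetric] sums_summable[OF h] summable_mult inverse_square_tail(1)[OF x1])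
  also have "(\<Sum>n. 4 * \<tau> * L\<^sup>2 * g n) = 4 * \<tau> * L\<^sup>2 * (\<Sum>n. g n)"
    unfolding g_def by (intro suminf_mult inverse_square_tail(1)[OF x1])
  also have "\<dots> \<le> 4 * \<tau> * L\<^sup>2 * (2 * x)"
    unfolding g_def by (intro mult_left_mono inverse_square_tail(2)[OF x1]) (simp add: \<tau>_def)
  also have "(\<Sum>n. h n) = ?G * csum a (exp (L + \<kappa>))"
    using sums_unique[OF h] by (simp add: csum_def sum_distrib_left)
  finally show "J \<le> ?G * csum a (exp (L + \<kappa>)) + 8 * \<tau> * L\<^sup>2 * exp L"
    by (simp add: x_def)
qed

lemma csum_ln_le:
  assumes "x \<ge> 1"
  shows "csum (\<lambda>n. ln (real n)) x \<le> x * ln x"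
proof -
  have "csum (\<lambda>n. ln (real n)) x = (\<Sum>n\<in>{1..nat \<lfloor>x\<rfloor>}. ln (real n))"
    using assms by (intro csum_altdef) auto
  also have "\<dots> \<le> (\<Sum>n\<in>{1..nat \<lfloor>x\<rfloor>}. ln x)"
    using assms by (intro sum_mono) (auto simp: le_nat_iff le_floor_iff)
  also have "\<dots> = real (nat \<lfloor>x\<rfloor>) * ln x" by simp
  also have "\<dots> \<le> x * ln x" using assms by (intro mult_right_mono) auto
  finally show ?thesis .
qed

lemma sum_ln_ge: "(\<Sum>n=1..N. ln (real n)) \<ge> real N * ln (real N) - real N"
proof (induction N)
  case (Suc N)
  show ?case
  proof (cases "N = 0")
    case False
    have "ln (1 + 1 / real N) \<le> 1 / real N" by (rule ln_add_one_self_le_self) simp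
    also have "1 + 1 / real N = real (Suc N) / real N" using False by (simp add: field_simps)
    finally have "ln (real (Suc N)) - ln (real N) \<le> 1 / real N" using False by (simp add: ln_div)
    then have "real N * (ln (real (Suc N)) - ln (real N)) \<le> real N * (1 / real N)"
      by (intro mult_left_mono) auto
    then have "real N * (ln (real (Suc N)) - ln (real N)) \<le> 1" using False by simp
    then show ?thesis using Suc by (simp add: algebra_simps)
  qed simp
qed simp

lemma csum_ln_ge:
  assumes "x \<ge> 1"
  shows "csum (\<lambda>n. ln (real n)) x \<ge> x * ln x - 3 * x"
proof -
  define N where "N = nat \<lfloor>x\<rfloor>"
  have N: "real N \<le> x" "x < real N + 1" "N \<ge> 1" using assms by (simp_all add: N_def le_nat_floor)
  have "csum (\<lambda>n. ln (real n)) x = (\<Sum>n=1..N. ln (real n))"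
    unfolding N_def using assms by (intro csum_altdef) auto
  \<comment> \<open>The term for N + 1 is added and taken off again because N + 1 > x, which lets
    monotonicity bring in x ln x; the loss is at most (N + 1) + N \<le> 3 x.\<close>
  moreover have "(\<Sum>n=1..N. ln (real n)) = (\<Sum>n=1..Suc N. ln (real n)) - ln (real N + 1)" by simp
  moreover have "(\<Sum>n=1..Suc N. ln (real n)) \<ge> (real N + 1) * ln (real N + 1) - (real N + 1)"
    using sum_ln_ge[of "Suc N"] by (simp add: add.commute)
  moreover have "ln (real N + 1) \<le> real N" using ln_add_one_self_le_self[of "real N"] by (simp add: add.commute)
  moreover have "x * ln x \<le> (real N + 1) * ln (real N + 1)"
    using N assms by (intro mult_mono) auto
  ultimately show ?thesis using N by linarith
qed

abbreviation mang_sum :: "real \<Rightarrow> real" where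
  "mang_sum \<equiv> csum (\<lambda>n. mangoldt n * ln (real n))"

lemma mangoldt_ln_weight:
  fixes n :: nat
  shows "(0::real) \<le> mangoldt n * ln (real n)"
    and "n > 0 \<Longrightarrow> mangoldt n * ln (real n) \<le> (1 + ln (real n))\<^sup>2"
proof -
  show "(0::real) \<le> mangoldt n * ln (real n)" by (cases "n = 0") (simp_all add: mangoldt_nonneg)
  assume "n > 0"
  then show "mangoldt n * ln (real n) \<le> (1 + ln (real n))\<^sup>2"
    using mangoldt_ln_abs_le[of n] ln_power2_le[of n] by linarith
qed

lemma ln_weight:
  fixes n :: nat
  shows "0 \<le> ln (real n)" and "n > 0 \<Longrightarrow> ln (real n) \<le> (1 + ln (real n))\<^sup>2"
proof -
  show *: "0 \<le> ln (real n)" by (cases "n = 0") simp_all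
  have "0 \<le> (ln (real n))\<^sup>2" by simp
  with * show "ln (real n) \<le> (1 + ln (real n))\<^sup>2" by (simp add: power2_sum)
qed

lemma gtail_sum_compare:
  obtains K where "K > 0"
    "\<And>L \<epsilon>. \<lbrakk>0 < \<epsilon>; \<epsilon> \<le> 1\<rbrakk> \<Longrightarrow> 
      \<bar>(\<Sum>n. mangoldt n * ln (real n) * gtail \<epsilon> (ln (real n) - L)) - (\<Sum>n. ln (real n) * gtail \<epsilon> (ln (real n) - L))\<bar>
      \<le> K * exp L / \<epsilon> ^ 11"
proof -
  obtain K where K: "K > 0"
    "\<And>L \<epsilon>. \<lbrakk>0 < \<epsilon>; \<epsilon> \<le> 1\<rbrakk> \<Longrightarrow> \<bar>\<Sum>n. mang_ln n * gtail \<epsilon> (ln (real n) - L)\<bar> \<le> K * exp L / \<epsilon> ^ 11"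
    using mang_ln_gtail_bound by blast
  have "\<bar>(\<Sum>n. mangoldt n * ln (real n) * gtail \<epsilon> (ln (real n) - L)) - (\<Sum>n. ln (real n) * gtail \<epsilon> (ln (real n) - L))\<bar>
      \<le> K * exp L / \<epsilon> ^ 11" if \<epsilon>: "0 < \<epsilon>" "\<epsilon> \<le> 1" for L \<epsilon>
  proof -
    have 1: "summable (\<lambda>n. mangoldt n * ln (real n) * gtail \<epsilon> (ln (real n) - L))"
    proof (rule summable_rabs_cancel, rule summable_gtail[OF _ _ \<epsilon>])
      show "n > 0 \<Longrightarrow> \<bar>mangoldt n * ln (real n)\<bar> \<le> (1 + ln (real n))\<^sup>2" for n
        using mangoldt_ln_weight[of n] by linarith
    qed simp
    have 2: "summable (\<lambda>n. ln (real n) * gtail \<epsilon> (ln (real n) - L))"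
    proof (rule summable_rabs_cancel, rule summable_gtail[OF _ _ \<epsilon>])
      show "n > 0 \<Longrightarrow> \<bar>ln (real n)\<bar> \<le> (1 + ln (real n))\<^sup>2" for n
        using ln_weight[of n] by linarith
    qed simp
    have "(\<Sum>n. mangoldt n * ln (real n) * gtail \<epsilon> (ln (real n) - L)) - (\<Sum>n. ln (real n) * gtail \<epsilon> (ln (real n) - L))
       = (\<Sum>n. mang_ln n * gtail \<epsilon> (ln (real n) - L))"
      unfolding suminf_diff[OF 1 2] by (intro suminf_cong) (simp add: mang_ln_def left_diff_distrib)
    then show ?thesis using K(2)[OF \<epsilon>] by simp
  qed
  then show ?thesis using that K(1) by blast
qed

text \<open>The cut-off is placed at L = ln x + \<kappa> for the upper bound and at L = ln x -
  \<kappa> for the lower one, so that one of the displaced limits in \<open>smoothed_csum\<close> is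
  \<open>x\<close> itself. The weights \<Lambda>(n) ln n are exchanged for ln n while both sums are
  smoothed, and the latter sum is evaluated at the other limit, x exp (\<plusminus> 2
  \<kappa>).\<close>

lemma mang_sum_bounds:
  obtains K where "K > 0"
    "\<And>x \<epsilon> \<kappa> G \<tau>. \<lbrakk>0 < \<epsilon>; \<epsilon> \<le> 1; 0 \<le> \<kappa>; \<kappa> \<le> 1; x > 0; ln x \<ge> 3; G = \<epsilon> * sqrt (2 * pi);
        \<tau> = exp (25 - \<kappa>\<^sup>2 / (4 * \<epsilon>\<^sup>2))\<rbrakk> \<Longrightarrow>
      (G - \<tau>) * mang_sum x \<le> x * (G * (exp (2 * \<kappa>) * (ln x + 2 * \<kappa>)) + 8 * \<tau> * (ln x + \<kappa>)\<^sup>2 * exp \<kappa>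
        + K * exp \<kappa> / \<epsilon> ^ 11)"
    "\<And>x \<epsilon> \<kappa> G \<tau>. \<lbrakk>0 < \<epsilon>; \<epsilon> \<le> 1; 0 \<le> \<kappa>; \<kappa> \<le> 1; x > 0; ln x \<ge> 3; G = \<epsilon> * sqrt (2 * pi);
        \<tau> = exp (25 - \<kappa>\<^sup>2 / (4 * \<epsilon>\<^sup>2)); \<tau> \<le> G\<rbrakk> \<Longrightarrow>
      x * ((G - \<tau>) * (exp (- (2 * \<kappa>)) * (ln x - 2 * \<kappa>) - 3 * exp (- (2 * \<kappa>))) - 8 * \<tau> * (ln x - \<kappa>)\<^sup>2 * exp (- \<kappa>)
        - K * exp (- \<kappa>) / \<epsilon> ^ 11) \<le> G * mang_sum x"
proof -
  define J where "J = (\<lambda>a \<epsilon> L. \<Sum>n. a n * gtail \<epsilon> (ln (real n) - L))"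
  define b :: "nat \<Rightarrow> real" where "b = (\<lambda>n. mangoldt n * ln (real n))"
  define c where "c = (\<lambda>n. ln (real n))"
  have b: "0 \<le> b n" "n > 0 \<Longrightarrow> b n \<le> (1 + ln (real n))\<^sup>2" "b 0 = 0" for n
    using mangoldt_ln_weight[of n] by (simp_all add: b_def)
  have c: "0 \<le> c n" "n > 0 \<Longrightarrow> c n \<le> (1 + ln (real n))\<^sup>2" "c 0 = 0" for n
    using ln_weight[of n] by (simp_all add: c_def)
  obtain K where K: "K > 0" and J: "\<And>L \<epsilon>. \<lbrakk>0 < \<epsilon>; \<epsilon> \<le> 1\<rbrakk> \<Longrightarrow> \<bar>J b \<epsilon> L - J c \<epsilon> L\<bar> \<le> K * exp L / \<epsilon> ^ 11"
    using gtail_sum_compare unfolding J_def b_def c_def by blast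
  show ?thesis
  proof
    show "K > 0" by fact
    fix x \<epsilon> \<kappa> G \<tau> :: real
    assume e: "0 < \<epsilon>" "\<epsilon> \<le> 1" "0 \<le> \<kappa>" "\<kappa> \<le> 1" and x: "x > 0" "ln x \<ge> 3" and G: "G = \<epsilon> * sqrt (2 * pi)"
      and \<tau>: "\<tau> = exp (25 - \<kappa>\<^sup>2 / (4 * \<epsilon>\<^sup>2))"
    define l where "l = ln x"
    have l: "l \<ge> 3" "exp l = x" using x by (auto simp: l_def)
    have G0: "G > 0" using e by (simp add: G)
    have "(G - \<tau>) * csum b x \<le> x * (G * (exp (2 * \<kappa>) * (l + 2 * \<kappa>)) + 8 * \<tau> * (l + \<kappa>)\<^sup>2 * exp \<kappa>
        + K * exp \<kappa> / \<epsilon> ^ 11)"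
    proof -
      have L: "l + \<kappa> \<ge> 1" using l e by linarith
      have ex: "exp (l + \<kappa>) = x * exp \<kappa>" "exp (l + \<kappa> + \<kappa>) = x * exp (2 * \<kappa>)"
        using l(2) exp_add[of l \<kappa>] exp_add[of l "2 * \<kappa>"] by (simp_all add: add_ac)
      have "exp (l + \<kappa> + \<kappa>) \<ge> 1" using l e by simp
      from csum_ln_le[OF this] have "csum c (exp (l + \<kappa> + \<kappa>)) \<le> exp (l + \<kappa> + \<kappa>) * (l + 2 * \<kappa>)"
        by (simp add: c_def add_ac)
      then have "G * csum c (exp (l + \<kappa> + \<kappa>)) \<le> G * (exp (l + \<kappa> + \<kappa>) * (l + 2 * \<kappa>))"
        using G0 by (intro mult_left_mono) auto
      moreover have "(G - \<tau>) * csum b x \<le> J b \<epsilon> (l + \<kappa>)"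
        using smoothed_csum(1)[OF b e(1,2,3) L] l(2) by (simp add: G \<tau> J_def)
      moreover have "J b \<epsilon> (l + \<kappa>) \<le> J c \<epsilon> (l + \<kappa>) + K * exp (l + \<kappa>) / \<epsilon> ^ 11"
        using J[OF e(1,2), of "l + \<kappa>"] by linarith
      moreover have "J c \<epsilon> (l + \<kappa>) \<le> G * csum c (exp (l + \<kappa> + \<kappa>)) + 8 * \<tau> * (l + \<kappa>)\<^sup>2 * exp (l + \<kappa>)"
        using smoothed_csum(2)[OF c e(1,2,3) L] by (simp add: G \<tau> J_def)
      ultimately have "(G - \<tau>) * csum b x \<le> G * (x * exp (2 * \<kappa>) * (l + 2 * \<kappa>))
          + 8 * \<tau> * (l + \<kappa>)\<^sup>2 * (x * exp \<kappa>) + K * (x * exp \<kappa>) / \<epsilon> ^ 11"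
        unfolding ex by linarith
      also have "\<dots> = x * (G * (exp (2 * \<kappa>) * (l + 2 * \<kappa>)) + 8 * \<tau> * (l + \<kappa>)\<^sup>2 * exp \<kappa>
        + K * exp \<kappa> / \<epsilon> ^ 11)" by (simp add: ring_distribs mult_ac)
      finally show ?thesis .
    qed
    then show "(G - \<tau>) * mang_sum x \<le> x * (G * (exp (2 * \<kappa>) * (ln x + 2 * \<kappa>)) + 8 * \<tau> * (ln x + \<kappa>)\<^sup>2 * exp \<kappa>
        + K * exp \<kappa> / \<epsilon> ^ 11)" by (simp only: l_def b_def)
    assume \<tau>G: "\<tau> \<le> G"
    have "x * ((G - \<tau>) * (exp (- (2 * \<kappa>)) * (l - 2 * \<kappa>) - 3 * exp (- (2 * \<kappa>))) - 8 * \<tau> * (l - \<kappa>)\<^sup>2 * exp (- \<kappa>)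
        - K * exp (- \<kappa>) / \<epsilon> ^ 11) \<le> G * csum b x"
    proof -
      have L: "l - \<kappa> \<ge> 1" using l e by linarith
      have ex: "exp (l - \<kappa> - \<kappa>) = x * exp (- (2 * \<kappa>))" "exp (l - \<kappa>) = x * exp (- \<kappa>)"
        using l(2) exp_add[of l "- \<kappa>"] exp_add[of l "- (2 * \<kappa>)"] by simp_all
      have "exp (l - \<kappa> - \<kappa>) \<ge> 1" using l e by simp
      from csum_ln_ge[OF this] 
      have "exp (l - \<kappa> - \<kappa>) * (l - 2 * \<kappa>) - 3 * exp (l - \<kappa> - \<kappa>) \<le> csum c (exp (l - \<kappa> - \<kappa>))"
        by (simp add: c_def diff_diff_eq)
      then have "(G - \<tau>) * (x * exp (- (2 * \<kappa>)) * (l - 2 * \<kappa>) - 3 * (x * exp (- (2 * \<kappa>)))) \<le> (G - \<tau>) * csum c (exp (l - \<kappa> - \<kappa>))"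
        using \<tau>G unfolding ex by (intro mult_left_mono) auto
      moreover have "(G - \<tau>) * csum c (exp (l - \<kappa> - \<kappa>)) \<le> J c \<epsilon> (l - \<kappa>)"
        using smoothed_csum(1)[OF c e(1,2,3) L] by (simp add: G \<tau> J_def)
      moreover have "J c \<epsilon> (l - \<kappa>) \<le> J b \<epsilon> (l - \<kappa>) + K * (x * exp (- \<kappa>)) / \<epsilon> ^ 11"
        using J[OF e(1,2), of "l - \<kappa>"] unfolding ex by linarith
      moreover have "J b \<epsilon> (l - \<kappa>) \<le> G * csum b x + 8 * \<tau> * (l - \<kappa>)\<^sup>2 * (x * exp (- \<kappa>))"
        using smoothed_csum(2)[OF b e(1,2,3) L] l(2) unfolding ex by (simp add: G \<tau> J_def)
      ultimately have "G * csum b x \<ge> (G - \<tau>) * (x * exp (- (2 * \<kappa>)) * (l - 2 * \<kappa>) - 3 * (x * exp (- (2 * \<kappa>))))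
         - 8 * \<tau> * (l - \<kappa>)\<^sup>2 * (x * exp (- \<kappa>)) - K * (x * exp (- \<kappa>)) / \<epsilon> ^ 11" (is "?lhs \<ge> ?rhs")
        by linarith
      also have "?rhs = x * ((G - \<tau>) * (exp (- (2 * \<kappa>)) * (l - 2 * \<kappa>) - 3 * exp (- (2 * \<kappa>))) - 8 * \<tau> * (l - \<kappa>)\<^sup>2 * exp (- \<kappa>)
        - K * exp (- \<kappa>) / \<epsilon> ^ 11)"
        by (simp add: ring_distribs mult_ac)
      finally show ?thesis .
    qed
    then show "x * ((G - \<tau>) * (exp (- (2 * \<kappa>)) * (ln x - 2 * \<kappa>) - 3 * exp (- (2 * \<kappa>))) - 8 * \<tau> * (ln x - \<kappa>)\<^sup>2 * exp (- \<kappa>)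
        - K * exp (- \<kappa>) / \<epsilon> ^ 11) \<le> G * mang_sum x" by (simp only: l_def b_def)
  qed
qed

text \<open>
  Here l = ln x, the Gaussian has width \<epsilon> = l^(-1/24), for which the loss \<epsilon>^(-12) is l^(1/2), and the
  summation limit is moved by a factor exp (\<plusminus> sqrt \<epsilon>).
\<close>

lemma smoothing_upper:
  fixes K :: real
  shows "(\<lambda>l. (l powr (-1/24) * sqrt (2 * pi) * (exp (2 * l powr (-1/48)) * (l + 2 * l powr (-1/48)))
      + 8 * exp (25 - (l powr (-1/48))\<^sup>2 / (4 * (l powr (-1/24))\<^sup>2)) * (l + l powr (-1/48))\<^sup>2 * exp (l powr (-1/48))
      + K * exp (l powr (-1/48)) / (l powr (-1/24)) ^ 11)
      / (l powr (-1/24) * sqrt (2 * pi) - exp (25 - (l powr (-1/48))\<^sup>2 / (4 * (l powr (-1/24))\<^sup>2))) - l)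
    \<in> O(\<lambda>l. l powr (47/48))"
  by real_asymp

lemma smoothing_lower:
  fixes K :: real
  shows "(\<lambda>l. ((l powr (-1/24) * sqrt (2 * pi) - exp (25 - (l powr (-1/48))\<^sup>2 / (4 * (l powr (-1/24))\<^sup>2)))
        * (exp (- (2 * l powr (-1/48))) * (l - 2 * l powr (-1/48)) - 3 * exp (- (2 * l powr (-1/48))))
      - 8 * exp (25 - (l powr (-1/48))\<^sup>2 / (4 * (l powr (-1/24))\<^sup>2)) * (l - l powr (-1/48))\<^sup>2 * exp (- (l powr (-1/48)))
      - K * exp (- (l powr (-1/48))) / (l powr (-1/24)) ^ 11)
      / (l powr (-1/24) * sqrt (2 * pi)) - l)
    \<in> O(\<lambda>l. l powr (47/48))"
  by real_asymp

lemma mang_sum_asymp: "(\<lambda>x. mang_sum x - x * ln x) \<in> O(\<lambda>x. x * ln x powr (47/48))"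
proof -
  obtain K where K: "K > 0"
    and ub: "\<And>x \<epsilon> \<kappa> G \<tau>. \<lbrakk>0 < \<epsilon>; \<epsilon> \<le> 1; 0 \<le> \<kappa>; \<kappa> \<le> 1; x > 0; ln x \<ge> 3; G = \<epsilon> * sqrt (2 * pi);
        \<tau> = exp (25 - \<kappa>\<^sup>2 / (4 * \<epsilon>\<^sup>2))\<rbrakk> \<Longrightarrow>
      (G - \<tau>) * mang_sum x \<le> x * (G * (exp (2 * \<kappa>) * (ln x + 2 * \<kappa>)) + 8 * \<tau> * (ln x + \<kappa>)\<^sup>2 * exp \<kappa>
        + K * exp \<kappa> / \<epsilon> ^ 11)"
    and lb: "\<And>x \<epsilon> \<kappa> G \<tau>. \<lbrakk>0 < \<epsilon>; \<epsilon> \<le> 1; 0 \<le> \<kappa>; \<kappa> \<le> 1; x > 0; ln x \<ge> 3; G = \<epsilon> * sqrt (2 * pi);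
        \<tau> = exp (25 - \<kappa>\<^sup>2 / (4 * \<epsilon>\<^sup>2)); \<tau> \<le> G\<rbrakk> \<Longrightarrow>
      x * ((G - \<tau>) * (exp (- (2 * \<kappa>)) * (ln x - 2 * \<kappa>) - 3 * exp (- (2 * \<kappa>))) - 8 * \<tau> * (ln x - \<kappa>)\<^sup>2 * exp (- \<kappa>)
        - K * exp (- \<kappa>) / \<epsilon> ^ 11) \<le> G * mang_sum x"
    using mang_sum_bounds by blast
  define \<epsilon> where "\<epsilon> = (\<lambda>l::real. l powr (-1/24))"
  \<comment> \<open>As \<kappa> / \<epsilon> = l^(1/48), the tail \<open>\<tau>\<close> is smaller
    than every negative power of l, while the displacement costs about 2 \<kappa> l, which is of
    order l^(47/48) and dominates all other losses.\<close>
  define \<kappa> where "\<kappa> = (\<lambda>l::real. l powr (-1/48))"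
  define \<tau> where "\<tau> = (\<lambda>l. exp (25 - (\<kappa> l)\<^sup>2 / (4 * (\<epsilon> l)\<^sup>2)))"
  define G where "G = (\<lambda>l. \<epsilon> l * sqrt (2 * pi))"
  define U where "U = (\<lambda>l. (G l * (exp (2 * \<kappa> l) * (l + 2 * \<kappa> l)) + 8 * \<tau> l * (l + \<kappa> l)\<^sup>2 * exp (\<kappa> l)
      + K * exp (\<kappa> l) / \<epsilon> l ^ 11) / (G l - \<tau> l))"
  define V where "V = (\<lambda>l. ((G l - \<tau> l) * (exp (- (2 * \<kappa> l)) * (l - 2 * \<kappa> l) - 3 * exp (- (2 * \<kappa> l))) - 8 * \<tau> l * (l - \<kappa> l)\<^sup>2 * exp (- \<kappa> l)
      - K * exp (- \<kappa> l) / \<epsilon> l ^ 11) / G l)"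
  have U_asymp: "(\<lambda>l. U l - l) \<in> O(\<lambda>l. l powr (47/48))"
    unfolding U_def G_def \<tau>_def \<kappa>_def \<epsilon>_def by (rule smoothing_upper)
  have V_asymp: "(\<lambda>l. V l - l) \<in> O(\<lambda>l. l powr (47/48))"
    unfolding V_def G_def \<tau>_def \<kappa>_def \<epsilon>_def by (rule smoothing_lower)
  have pos: "\<forall>\<^sub>F l in at_top. G l - \<tau> l > 0"
    unfolding G_def \<tau>_def \<kappa>_def \<epsilon>_def by real_asymp
  have e: "0 < \<epsilon> l" "\<epsilon> l \<le> 1" "0 \<le> \<kappa> l" "\<kappa> l \<le> 1" if "l \<ge> 3" for l
    using that powr_mono[of "-1/24" 0 l] powr_mono[of "-1/48" 0 l] by (auto simp: \<epsilon>_def \<kappa>_def)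
  have ub': "mang_sum x \<le> x * U (ln x)" if x: "ln x \<ge> 3" "G (ln x) - \<tau> (ln x) > 0" "x > 0" for x
  proof -
    have "(G (ln x) - \<tau> (ln x)) * mang_sum x \<le> (G (ln x) - \<tau> (ln x)) * (x * U (ln x))"
      using ub[OF e[OF x(1)] x(3,1) G_def[THEN fun_cong] \<tau>_def[THEN fun_cong]] x(2)
      by (simp add: U_def mult_ac)
    then show ?thesis using x(2) by simp
  qed
  have lb': "mang_sum x \<ge> x * V (ln x)" if x: "ln x \<ge> 3" "G (ln x) - \<tau> (ln x) > 0" "x > 0" for x
  proof -
    have G0: "G (ln x) > 0" using e[OF x(1)] by (simp add: G_def)
    have "\<tau> (ln x) \<le> G (ln x)" using x(2) by simp
    from lb[OF e[OF x(1)] x(3,1) G_def[THEN fun_cong] \<tau>_def[THEN fun_cong] this]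
    have "G (ln x) * (x * V (ln x)) \<le> G (ln x) * mang_sum x"
      using G0 by (simp add: V_def)
    then show ?thesis using G0 by simp
  qed
  obtain C1 where C1: "C1 > 0" "\<forall>\<^sub>F l in at_top. norm (U l - l) \<le> C1 * norm (l powr (47/48))"
    using U_asymp by (auto elim!: landau_o.bigE)
  obtain C2 where C2: "C2 > 0" "\<forall>\<^sub>F l in at_top. norm (V l - l) \<le> C2 * norm (l powr (47/48))"
    using V_asymp by (auto elim!: landau_o.bigE)
  have "\<forall>\<^sub>F l in at_top. l \<ge> 3 \<and> G l - \<tau> l > 0 \<and> norm (U l - l) \<le> C1 * norm (l powr (47/48)) \<and> norm (V l - l) \<le> C2 * norm (l powr (47/48))"
    by (intro eventually_conj eventually_ge_at_top pos C1 C2)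
  then have "\<forall>\<^sub>F x in at_top. ln x \<ge> 3 \<and> G (ln x) - \<tau> (ln x) > 0 \<and> norm (U (ln x) - ln x) \<le> C1 * norm (ln x powr (47/48))
     \<and> norm (V (ln x) - ln x) \<le> C2 * norm (ln x powr (47/48))"
    by (rule eventually_compose_filterlim) (rule ln_at_top)
  then have "\<forall>\<^sub>F x in at_top. norm (mang_sum x - x * ln x) \<le> (C1 + C2) * norm (x * ln x powr (47/48))"
    using eventually_gt_at_top[of 0]
  proof eventually_elim
    case (elim x)
    have "mang_sum x - x * ln x \<le> x * (U (ln x) - ln x)" using ub'[of x] elim by (simp add: right_diff_distrib)
    also have "\<dots> \<le> x * (C1 * (ln x powr (47/48)))" using elim by (intro mult_left_mono) auto
    finally have 1: "mang_sum x - x * ln x \<le> C1 * (x * ln x powr (47/48))" by (simp add: mult_ac)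
    have "x * ln x - mang_sum x \<le> x * (ln x - V (ln x))" using lb'[of x] elim by (simp add: right_diff_distrib)
    also have "\<dots> \<le> x * (C2 * (ln x powr (47/48)))" using elim by (intro mult_left_mono) auto
    finally have 2: "x * ln x - mang_sum x \<le> C2 * (x * ln x powr (47/48))" by (simp add: mult_ac)
    have "0 \<le> C1 * (x * ln x powr (47/48))" "0 \<le> C2 * (x * ln x powr (47/48))" using elim C1 C2 by auto
    then show ?case using 1 2 elim by (simp add: abs_le_iff distrib_right)
  qed
  then show ?thesis by (rule bigoI)
qed

section \<open>Counting odd primes\<close>

text \<open>An odd semiprime and an even total force the prime summand to be odd, so only odd primes
  occur in the triples. The limit is real because it will be sqrt x, x / q or x - q r.\<close>

definition odd_primes_upto :: "real \<Rightarrow> nat set" where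
  "odd_primes_upto x = {p. prime p \<and> odd p \<and> real p \<le> x}"

definition opi :: "real \<Rightarrow> real" where
  "opi x = real (card (odd_primes_upto x))"

lemma finite_odd_primes_upto [simp, intro]: "finite (odd_primes_upto x)"
  by (rule finite_subset[OF _ finite_nat_le_real[of x]]) (auto simp: odd_primes_upto_def)

lemma opi_nonneg: "opi x \<ge> 0" by (simp add: opi_def)

lemma opi_mono: "x \<le> y \<Longrightarrow> opi x \<le> opi y"
  unfolding opi_def by (intro of_nat_mono card_mono) (auto simp: odd_primes_upto_def)

lemma opi_le: "x \<ge> 0 \<Longrightarrow> opi x \<le> x"
proof -
  assume x: "x \<ge> 0"
  have "odd_primes_upto x \<subseteq> {1..nat \<lfloor>x\<rfloor>}"
    by (auto simp: odd_primes_upto_def le_nat_floor Suc_le_eq prime_gt_0_nat)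
  from card_mono[OF _ this] have "card (odd_primes_upto x) \<le> nat \<lfloor>x\<rfloor>" by simp
  then have "opi x \<le> real (nat \<lfloor>x\<rfloor>)" unfolding opi_def by (rule of_nat_mono)
  also have "\<dots> \<le> x" using x by simp
  finally show ?thesis .
qed

text \<open>A Chebyshev theta function with a second logarithm: the weight is the value of
  \<Lambda>(n) ln n at a prime.\<close>

definition otheta2 :: "real \<Rightarrow> real" where
  "otheta2 x = (\<Sum>p\<in>odd_primes_upto x. ln (real p) ^ 2)"

text \<open>Apart from 2 these are powers p^k with k \<ge> 2, for which p \<le> sqrt x and k is at
  most the binary logarithm of x.\<close>

lemma proper_prime_powers_card:
  assumes x: "x \<ge> 1"
  shows "real (card {n. real n \<le> x \<and> primepow n \<and> \<not> (prime n \<and> odd n)}) \<le> 1 + (sqrt x + 1) * (log 2 x + 1)"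
proof -
  define A where "A = {..nat \<lfloor>sqrt x\<rfloor>} \<times> {..nat \<lfloor>log 2 x\<rfloor>}"
  have "{n. real n \<le> x \<and> primepow n \<and> \<not> (prime n \<and> odd n)} \<subseteq> insert 2 ((\<lambda>(p, k). p ^ k) ` A)"
  proof
    fix n assume "n \<in> {n. real n \<le> x \<and> primepow n \<and> \<not> (prime n \<and> odd n)}"
    then have n: "real n \<le> x" "primepow n" "\<not> (prime n \<and> odd n)" by auto
    then obtain p k where pk: "prime p" "k > 0" "n = p ^ k" by (auto simp: primepow_def)
    show "n \<in> insert 2 ((\<lambda>(p, k). p ^ k) ` A)"
    proof (cases "k = 1")
      case True
      then have "prime n" using pk by simp
      then show ?thesis using n(3) primes_dvd_imp_eq[of 2 n] by auto
    next
      case False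
      then have k: "k \<ge> 2" using pk by simp
      have p: "p \<ge> 2" using pk prime_ge_2_nat by auto
      have "real p ^ 2 \<le> real p ^ k" using k p by (intro power_increasing) auto
      also have "\<dots> \<le> x" using n pk by simp
      finally have "real p \<le> sqrt x" by (rule real_le_rsqrt)
      then have 1: "p \<le> nat \<lfloor>sqrt x\<rfloor>" by (simp add: le_nat_floor)
      have "2 powr real k \<le> real p ^ k" using p by (simp add: powr_realpow power_mono)
      also have "\<dots> \<le> x" using n pk by simp
      finally have "real k \<le> log 2 x" using x by (subst le_log_iff) auto
      then have 2: "k \<le> nat \<lfloor>log 2 x\<rfloor>" by (simp add: le_nat_floor)
      show ?thesis using 1 2 pk(3) by (auto simp: A_def)
    qed
  qed
  then have "card {n. real n \<le> x \<and> primepow n \<and> \<not> (prime n \<and> odd n)} \<le> card (insert 2 ((\<lambda>(p, k). p ^ k) ` A))"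
    by (intro card_mono) (auto simp: A_def)
  also have "\<dots> \<le> Suc (card ((\<lambda>(p, k). p ^ k) ` A))" by (rule card_insert_le_m1[THEN order_trans]) (auto simp: A_def)
  also have "\<dots> \<le> Suc (card A)" using card_image_le[of A] by (simp add: A_def)
  also have "card A = (nat \<lfloor>sqrt x\<rfloor> + 1) * (nat \<lfloor>log 2 x\<rfloor> + 1)" by (simp add: A_def)
  finally have "real (card {n. real n \<le> x \<and> primepow n \<and> \<not> (prime n \<and> odd n)}) \<le> 1 + (real (nat \<lfloor>sqrt x\<rfloor>) + 1) * (real (nat \<lfloor>log 2 x\<rfloor>) + 1)"
    by (simp flip: of_nat_le_iff[where 'a = real] add: algebra_simps)
  also have "\<dots> \<le> 1 + (sqrt x + 1) * (log 2 x + 1)"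
    using x by (intro add_mono mult_mono) auto
  finally show ?thesis .
qed

lemma mang_sum_minus_otheta2:
  assumes x: "x \<ge> 1"
  shows "\<bar>mang_sum x - otheta2 x\<bar> \<le> (ln x)\<^sup>2 * (1 + (sqrt x + 1) * (log 2 x + 1))"
proof -
  define A where "A = {n. real n \<le> x \<and> primepow n \<and> \<not> (prime n \<and> odd n)}"
  have fA: "finite A" by (rule finite_subset[OF _ finite_nat_le_real[of x]]) (auto simp: A_def)
  have disj: "A \<inter> odd_primes_upto x = {}" by (auto simp: A_def odd_primes_upto_def)
  have "mang_sum x = (\<Sum>n\<in>A \<union> odd_primes_upto x. mangoldt n * ln (real n))"
    unfolding csum_def
    by (rule sum.mono_neutral_right) (auto simp: A_def odd_primes_upto_def mangoldt_def)
  also have "\<dots> = (\<Sum>n\<in>A. mangoldt n * ln (real n)) + (\<Sum>n\<in>odd_primes_upto x. mangoldt n * ln (real n))"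
    by (rule sum.union_disjoint[OF fA _ disj]) simp
  also have "(\<Sum>n\<in>odd_primes_upto x. mangoldt n * ln (real n)) = otheta2 x"
    unfolding otheta2_def by (intro sum.cong) (auto simp: odd_primes_upto_def power2_eq_square)
  finally have eq: "mang_sum x - otheta2 x = (\<Sum>n\<in>A. mangoldt n * ln (real n))" by simp
  have "\<bar>mang_sum x - otheta2 x\<bar> = (\<Sum>n\<in>A. mangoldt n * ln (real n))"
    unfolding eq by (intro abs_of_nonneg sum_nonneg mangoldt_ln_weight(1))
  also have "\<dots> \<le> (\<Sum>n\<in>A. (ln x)\<^sup>2)"
  proof (rule sum_mono)
    fix n assume "n \<in> A"
    then have n: "real n \<le> x" "n > 0" by (auto simp: A_def primepow_gt_0_nat)
    have "mangoldt n * ln (real n) \<le> ln (real n) * ln (real n)"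
      using mangoldt_le[OF n(2)] n by (intro mult_right_mono) auto
    also have "\<dots> \<le> ln x * ln x" using n x by (intro mult_mono) auto
    finally show "mangoldt n * ln (real n) \<le> (ln x)\<^sup>2" by (simp add: power2_eq_square)
  qed
  also have "\<dots> = (ln x)\<^sup>2 * real (card A)" by simp
  also have "\<dots> \<le> (ln x)\<^sup>2 * (1 + (sqrt x + 1) * (log 2 x + 1))"
    unfolding A_def by (intro mult_left_mono proper_prime_powers_card x) simp
  finally show ?thesis .
qed

lemma otheta2_asymp: "(\<lambda>x. otheta2 x - x * ln x) \<in> O(\<lambda>x. x * ln x powr (47/48))"
proof -
  have "(\<lambda>x. mang_sum x - otheta2 x) \<in> O(\<lambda>x. (ln x)\<^sup>2 * (1 + (sqrt x + 1) * (log 2 x + 1)))"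
  proof (rule bigoI[of _ 1], rule eventually_mono[OF eventually_ge_at_top[of 1]])
    fix x :: real assume "x \<ge> 1"
    from mang_sum_minus_otheta2[OF this]
    show "norm (mang_sum x - otheta2 x) \<le> 1 * norm ((ln x)\<^sup>2 * (1 + (sqrt x + 1) * (log 2 x + 1)))"
      by simp
  qed
  also have "(\<lambda>x. (ln x)\<^sup>2 * (1 + (sqrt x + 1) * (log 2 x + 1))) \<in> O(\<lambda>x. x * ln x powr (47/48))"
    by real_asymp
  finally have "(\<lambda>x. (mang_sum x - x * ln x) - (mang_sum x - otheta2 x)) \<in> O(\<lambda>x. x * ln x powr (47/48))"
    by (rule sum_in_bigo[OF mang_sum_asymp])
  then show ?thesis by simp
qed

lemma otheta2_le: "x \<ge> 1 \<Longrightarrow> otheta2 x \<le> (ln x)\<^sup>2 * opi x"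
proof -
  assume x: "x \<ge> 1"
  have "otheta2 x \<le> (\<Sum>p\<in>odd_primes_upto x. (ln x)\<^sup>2)"
    unfolding otheta2_def
  proof (rule sum_mono)
    fix p assume "p \<in> odd_primes_upto x"
    then have p: "p > 0" "real p \<le> x" by (auto simp: odd_primes_upto_def prime_gt_0_nat)
    then have "ln (real p) \<le> ln x" by (subst ln_le_cancel_iff) auto
    then show "ln (real p) ^ 2 \<le> (ln x)\<^sup>2" using p by (intro power_mono) auto
  qed
  then show ?thesis by (simp add: opi_def mult.commute)
qed

text \<open>A cut at z replaces partial summation: primes up to z are counted trivially, and each
  one beyond z has weight at least (ln z)^2.\<close>

lemma opi_le_otheta2:
  assumes "1 < z" "z \<le> x"
  shows "opi x \<le> z + otheta2 x / (ln z)\<^sup>2"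
proof -
  define A where "A = odd_primes_upto x - odd_primes_upto z"
  have "(ln z)\<^sup>2 * real (card A) = (\<Sum>p\<in>A. (ln z)\<^sup>2)" by simp
  also have "\<dots> \<le> (\<Sum>p\<in>A. ln (real p) ^ 2)"
    using assms by (intro sum_mono power_mono) (auto simp: A_def odd_primes_upto_def)
  also have "\<dots> \<le> otheta2 x"
    unfolding otheta2_def by (intro sum_mono2) (auto simp: A_def)
  finally have "real (card A) \<le> otheta2 x / (ln z)\<^sup>2"
    using assms by (simp add: pos_le_divide_eq mult.commute)
  moreover have "card (odd_primes_upto x) = card (odd_primes_upto z) + card A"
  proof -
    have "odd_primes_upto z \<subseteq> odd_primes_upto x" using assms by (auto simp: odd_primes_upto_def)
    then show ?thesis unfolding A_def using card_mono[of "odd_primes_upto x" "odd_primes_upto z"]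
      by (subst card_Diff_subset) auto
  qed
  moreover have "opi z \<le> z" using assms by (intro opi_le) auto
  ultimately show ?thesis by (simp add: opi_def)
qed

text \<open>The lower bound gives every prime the weight (ln x)^2. The upper bound takes z = x / (ln
  x)^2, for which the trivial part is small; since ln z = l - 2 ln l, the shift costs a relative
  error of order ln l / l, well within l^(-1/48).\<close>

lemma opi_asymp: "(\<lambda>x. opi x - x / ln x) \<in> O(\<lambda>x. x * ln x powr (-49/48))"
proof -
  obtain C where C: "C > 0" "\<forall>\<^sub>F x in at_top. norm (otheta2 x - x * ln x) \<le> C * norm (x * ln x powr (47/48))"
    using otheta2_asymp by (auto elim!: landau_o.bigE)
  \<comment> \<open>The upper bound for opi x - x / l, divided by x and expressed in l = ln
    x.\<close>
  define W where "W = (\<lambda>l::real. 1 / l\<^sup>2 + (l + C * l powr (47/48)) / (l - 2 * ln l)\<^sup>2 - 1 / l)"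
  have "W \<in> O(\<lambda>l. l powr (-49/48))" unfolding W_def by real_asymp
  then obtain D where D: "D > 0" "\<forall>\<^sub>F l in at_top. norm (W l) \<le> D * norm (l powr (-49/48))"
    by (auto elim!: landau_o.bigE)
  have D': "\<forall>\<^sub>F x in at_top. norm (W (ln x)) \<le> D * norm (ln x powr (-49/48))"
    by (rule eventually_compose_filterlim[OF D(2) ln_at_top])
  have z1: "\<forall>\<^sub>F x::real in at_top. 1 < x / (ln x)\<^sup>2" by real_asymp
  have z2: "\<forall>\<^sub>F x::real in at_top. x / (ln x)\<^sup>2 \<le> x" by real_asymp
  have "\<forall>\<^sub>F x in at_top. norm (opi x - x / ln x) \<le> (C + D) * norm (x * ln x powr (-49/48))"
    using C(2) D' z1 z2 eventually_gt_at_top[of "exp 1"]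
  proof eventually_elim
    case (elim x)
    have x: "x > 1" using elim(5) one_less_exp_iff[of "1::real"] by linarith
    have "ln (exp 1) < ln x" using elim(5) x by (subst ln_less_cancel_iff) auto
    define l where "l = ln x"
    have l: "l > 1" using \<open>ln (exp 1) < ln x\<close> by (simp add: l_def)
    have th: "\<bar>otheta2 x - x * l\<bar> \<le> C * (x * l powr (47/48))" using elim(1) x by (simp add: l_def abs_mult)
    have p: "l powr (47/48) / l\<^sup>2 = l powr (-49/48)"
      using l by (simp flip: powr_numeral powr_diff)
    have "x * l - C * (x * l powr (47/48)) \<le> l\<^sup>2 * opi x"
      using otheta2_le[of x] th x by (simp add: l_def)
    then have "(x * l - C * (x * l powr (47/48))) / l\<^sup>2 \<le> opi x"
      using l by (simp add: pos_divide_le_eq mult.commute)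
    also have "(x * l - C * (x * l powr (47/48))) / l\<^sup>2 = x / l - C * (x * (l powr (47/48) / l\<^sup>2))"
      using l by (simp add: field_simps power2_eq_square)
    finally have lower: "opi x - x / l \<ge> - (C * (x * l powr (-49/48)))" unfolding p by simp
    define z where "z = x / l\<^sup>2"
    have z: "1 < z" "z \<le> x" using elim by (simp_all add: z_def l_def)
    have lnz: "ln z = l - 2 * ln l" using x l by (simp add: z_def ln_div ln_realpow l_def)
    have "opi x \<le> z + otheta2 x / (ln z)\<^sup>2" by (rule opi_le_otheta2[OF z])
    also have "otheta2 x / (ln z)\<^sup>2 \<le> (x * l + C * (x * l powr (47/48))) / (ln z)\<^sup>2"
      using th by (intro divide_right_mono) auto
    also have "z + (x * l + C * (x * l powr (47/48))) / (ln z)\<^sup>2 = x / l + x * W l"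
      unfolding lnz unfolding W_def z_def by (simp add: field_simps add_divide_distrib)
    finally have "opi x - x / l \<le> x * W l" by simp
    also have "\<dots> \<le> x * (D * l powr (-49/48))"
      using elim(2) x by (intro mult_left_mono) (auto simp: l_def)
    finally have upper: "opi x - x / l \<le> D * (x * l powr (-49/48))" by (simp add: mult_ac)
    have "0 \<le> C * (x * l powr (-49/48))" "0 \<le> D * (x * l powr (-49/48))" using C D x by auto
    then have "\<bar>opi x - x / l\<bar> \<le> (C + D) * (x * l powr (-49/48))"
      using lower upper by (simp add: abs_le_iff distrib_right)
    then show ?case using x by (simp add: l_def abs_mult)
  qed
  then show ?thesis by (rule bigoI)
qed

text \<open>The logarithm is taken at \<open>x\<close> and not at \<open>y\<close>: the
  approximation is then linear in \<open>y\<close>, fit for summation over y = x - q r, and the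
  error depends on \<open>x\<close> alone. For y < sqrt x both terms are negligible. For y \<ge>
  sqrt x the change of logarithm costs y (ln x - ln y) / (ln x ln y), and y ln (x / y) \<le> x makes
  this at most 2 x / (ln x)^2.\<close>

lemma opi_uniform:
  obtains C x0 where "C > 0" "x0 \<ge> 3"
    "\<And>x y. \<lbrakk>x \<ge> x0; 0 \<le> y; y \<le> x\<rbrakk> \<Longrightarrow> \<bar>opi y - y / ln x\<bar> \<le> C * x * ln x powr (-49/48)"
proof -
  obtain C where C: "C > 0" "\<forall>\<^sub>F x in at_top. norm (opi x - x / ln x) \<le> C * norm (x * ln x powr (-49/48))"
    using opi_asymp by (auto elim!: landau_o.bigE)
  then obtain x1 where x1: "\<And>x. x \<ge> x1 \<Longrightarrow> \<bar>opi x - x / ln x\<bar> \<le> C * \<bar>x * ln x powr (-49/48)\<bar>"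
    unfolding eventually_at_top_linorder real_norm_def by blast
  have "\<forall>\<^sub>F x::real in at_top. sqrt x + sqrt x / ln x \<le> x * ln x powr (-49/48)" by real_asymp
  moreover have "\<forall>\<^sub>F x::real in at_top. 2 * x / (ln x)\<^sup>2 \<le> x * ln x powr (-49/48)" by real_asymp
  ultimately have "\<forall>\<^sub>F x::real in at_top. sqrt x + sqrt x / ln x \<le> x * ln x powr (-49/48) \<and> 2 * x / (ln x)\<^sup>2 \<le> x * ln x powr (-49/48)"
    by (rule eventually_conj)
  then obtain x2 where x2: "\<And>x::real. x \<ge> x2 \<Longrightarrow> sqrt x + sqrt x / ln x \<le> x * ln x powr (-49/48)"
     "\<And>x::real. x \<ge> x2 \<Longrightarrow> 2 * x / (ln x)\<^sup>2 \<le> x * ln x powr (-49/48)"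
    unfolding eventually_at_top_linorder by blast
  define x0 where "x0 = max (max 3 x2) (max 1 x1 ^ 2)"
  define P where "P = 1 / 2 powr (-49/48 :: real)"
  show ?thesis
  proof
    show "C * P + 1 > 0" using C by (simp add: P_def add_pos_pos)
    show "x0 \<ge> 3" by (simp add: x0_def)
    fix x y :: real assume xy: "x \<ge> x0" "0 \<le> y" "y \<le> x"
    have x: "x \<ge> 3" "x \<ge> x2" "x \<ge> max 1 x1 ^ 2" using xy by (auto simp: x0_def)
    have "sqrt x \<ge> sqrt (max 1 x1 ^ 2)" using x by (intro real_sqrt_le_mono) auto
    then have sx: "sqrt x \<ge> x1" "sqrt x \<ge> 1" by auto
    have lnx: "ln x > 0" using x by simp
    define E where "E = x * ln x powr (-49/48)"
    have E0: "E \<ge> 0" using x by (simp add: E_def)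
    have "\<bar>opi y - y / ln x\<bar> \<le> (C * P + 1) * E"
    proof (cases "y \<ge> sqrt x")
      case False
      have "opi y \<le> sqrt x" using opi_le[OF xy(2)] False by simp
      moreover have "0 \<le> y / ln x" "y / ln x \<le> sqrt x / ln x"
        using xy lnx False by (auto intro!: divide_right_mono)
      moreover have "0 \<le> sqrt x" "0 \<le> sqrt x / ln x" using lnx x by auto
      ultimately have "\<bar>opi y - y / ln x\<bar> \<le> sqrt x + sqrt x / ln x"
        using opi_nonneg[of y] by linarith
      also have "\<dots> \<le> E" unfolding E_def by (rule x2(1)[OF x(2)])
      also have "\<dots> \<le> (C * P + 1) * E" using E0 C mult_right_mono[of 1 "C * P + 1" E] by (simp add: P_def)
      finally show ?thesis .
    next
      case True
      have y: "y \<ge> x1" "y \<ge> 1" "y > 0" using True sx by linarith+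
      have "0 < sqrt x" using sx(2) by linarith
      then have "ln (sqrt x) \<le> ln y" using True y by (subst ln_le_cancel_iff)
      then have lny: "ln x / 2 \<le> ln y" using x by (simp add: ln_sqrt)
      have "\<bar>opi y - y / ln y\<bar> \<le> C * (y * ln y powr (-49/48))"
        using x1[OF y(1)] y by (simp add: abs_mult)
      also have "\<dots> \<le> C * (x * (ln x / 2) powr (-49/48))"
        using C xy y lny lnx by (intro mult_left_mono mult_mono powr_mono2') auto
      also have "(ln x / 2) powr (-49/48) = P * ln x powr (-49/48)"
        using lnx by (simp add: powr_divide P_def)
      finally have 1: "\<bar>opi y - y / ln y\<bar> \<le> C * P * E" by (simp add: E_def mult_ac)
      have "ln (x / y) \<le> x / y" using ln_le_minus_one[of "x / y"] y x by simp
      then have d: "ln x - ln y \<le> x / y" using x y by (simp add: ln_div)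
      have "ln y > 0" using lny lnx by simp
      then have "y / ln y - y / ln x = y * (ln x - ln y) / (ln y * ln x)"
        using lnx by (simp add: divide_simps algebra_simps)
      also have "\<dots> \<le> x / (ln x / 2 * ln x)"
      proof (rule frac_le)
        show "y * (ln x - ln y) \<le> x" using mult_left_mono[OF d, of y] y by simp
        show "ln x / 2 * ln x \<le> ln y * ln x" using lny lnx by (intro mult_right_mono) auto
      qed (use lnx x in auto)
      also have "\<dots> = 2 * x / (ln x)\<^sup>2" by (simp add: power2_eq_square)
      also have "\<dots> \<le> E" unfolding E_def by (rule x2(2)[OF x(2)])
      finally have 2: "y / ln y - y / ln x \<le> E" .
      have "ln y \<le> ln x" using xy y by simp
      then have 3: "y / ln y - y / ln x \<ge> 0" using \<open>ln y > 0\<close> lnx y frac_le[of y y "ln y" "ln x"] by simp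
      have "\<bar>opi y - y / ln x\<bar> \<le> C * P * E + E" using 1 2 3 by linarith
      then show ?thesis by (simp only: distrib_right mult_1)
    qed
    then show "\<bar>opi y - y / ln x\<bar> \<le> (C * P + 1) * x * ln x powr (-49/48)"
      by (simp add: E_def mult_ac)
  qed
qed

section \<open>Mertens' second theorem and related sums\<close>

lemma odd_primes_upto_Suc:
  "odd_primes_upto (real (Suc n)) = (if prime (Suc n) \<and> odd (Suc n) then insert (Suc n) (odd_primes_upto (real n)) else odd_primes_upto (real n))"
  by (auto simp: odd_primes_upto_def le_Suc_eq simp del: of_nat_Suc)

lemma odd_primes_upto_floor: "x \<ge> 0 \<Longrightarrow> odd_primes_upto x = odd_primes_upto (real (nat \<lfloor>x\<rfloor>))"
proof -
  assume "x \<ge> 0"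
  then have "real p \<le> x \<longleftrightarrow> p \<le> nat \<lfloor>x\<rfloor>" for p by (simp add: le_nat_iff le_floor_iff)
  then show ?thesis unfolding odd_primes_upto_def by (simp only: of_nat_le_iff)
qed

definition recip_sum :: "real \<Rightarrow> real" where
  "recip_sum x = (\<Sum>q\<in>odd_primes_upto x. 1 / real q)"

lemma recip_sum_abel:
  "recip_sum (real n) = (\<Sum>j=1..n. opi (real j) / (real j * (real j + 1))) + opi (real n) / (real n + 1)"
proof (induction n)
  case 0
  have "odd_primes_upto 0 = {}" by (auto simp: odd_primes_upto_def dest: prime_gt_0_nat)
  then show ?case by (simp add: recip_sum_def opi_def)
next
  case (Suc n)
  define d :: real where "d = (if prime (Suc n) \<and> odd (Suc n) then 1 else 0)"
  have notin: "Suc n \<notin> odd_primes_upto (real n)" by (simp add: odd_primes_upto_def)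
  have 1: "recip_sum (real (Suc n)) = recip_sum (real n) + d / (real n + 1)"
    using notin unfolding recip_sum_def odd_primes_upto_Suc d_def by (auto simp: add.commute)
  have 2: "opi (real (Suc n)) = opi (real n) + d"
    using notin unfolding opi_def odd_primes_upto_Suc d_def by auto
  define N where "N = real n"
  have N: "N \<ge> 0" by (simp add: N_def)
  have "opi (N + 1) / ((N + 1) * (N + 2)) + opi (N + 1) / (N + 2) = opi (N + 1) / (N + 1)"
    using N by (simp add: divide_simps) (simp add: algebra_simps)
  then show ?case using 2 unfolding 1 Suc by (simp add: N_def[symmetric] add_divide_distrib add_ac)
qed

text \<open>In the Abel sum, opi(j) / (j (j + 1)) agrees with the increment of ln ln up to O(1 / (j
  (ln j)^(49/48))). The exponent exceeds 1, so these differences form a convergent series.\<close>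

lemma mertens_second: "(\<lambda>x. recip_sum x - ln (ln x)) \<in> O(\<lambda>_. 1)"
proof -
  define f where "f = (\<lambda>j::nat. opi (real j) / (real j * (real j + 1)) - (ln (ln (real j + 1)) - ln (ln (real j))))"
  have "f \<in> O(\<lambda>j. 1 / (real j * ln (real j) powr (49/48)))"
  proof -
    have "(\<lambda>j. opi (real j) - real j / ln (real j)) \<in> O(\<lambda>j. real j * ln (real j) powr (-49/48))"
      using opi_asymp filterlim_real_sequentially by (rule landau_o.big.compose)
    then have "(\<lambda>j. (opi (real j) - real j / ln (real j)) * (1 / (real j * (real j + 1)))) \<in> O(\<lambda>j. real j * ln (real j) powr (-49/48) * (1 / (real j * (real j + 1))))"
      by (intro landau_o.big.mult landau_o.big_refl)
    also have "(\<lambda>j. real j * ln (real j) powr (-49/48) * (1 / (real j * (real j + 1)))) \<in> O(\<lambda>j. 1 / (real j * ln (real j) powr (49/48)))"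
      by real_asymp
    finally have "(\<lambda>j. (opi (real j) - real j / ln (real j)) * (1 / (real j * (real j + 1)))) \<in> O(\<lambda>j. 1 / (real j * ln (real j) powr (49/48)))" .
    moreover have "(\<lambda>j. real j / ln (real j) * (1 / (real j * (real j + 1))) - (ln (ln (real j + 1)) - ln (ln (real j)))) \<in> O(\<lambda>j. 1 / (real j * ln (real j) powr (49/48)))"
      by real_asymp
    ultimately have "(\<lambda>j. (opi (real j) - real j / ln (real j)) * (1 / (real j * (real j + 1))) + 
        (real j / ln (real j) * (1 / (real j * (real j + 1))) - (ln (ln (real j + 1)) - ln (ln (real j))))) \<in> O(\<lambda>j. 1 / (real j * ln (real j) powr (49/48)))"
      by (rule sum_in_bigo)
    moreover have "(a - b) * (1 / c) + (b * (1 / c) - d) = a / c - d" for a b c d :: real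
      by (simp add: diff_divide_distrib)
    ultimately show ?thesis unfolding f_def by (simp only:)
  qed
  \<comment> \<open>The increments of (ln j)^(-1/48) have this order and telescope to a convergent
    sum, so they serve as the majorant.\<close>
  also have "(\<lambda>j. 1 / (real j * ln (real j) powr (49/48))) \<in> O(\<lambda>j. ln (real j) powr (-1/48) - ln (real (Suc j)) powr (-1/48))"
    by real_asymp
  finally have f_bigo: "f \<in> O(\<lambda>j. ln (real j) powr (-1/48) - ln (real (Suc j)) powr (-1/48))" .
  have "(\<lambda>j. ln (real j) powr (-1/48)) \<longlonglongrightarrow> 0" by real_asymp
  then have tel: "summable (\<lambda>j. ln (real j) powr (-1/48) - ln (real (Suc j)) powr (-1/48))"
    by (rule telescope_summable')
  have "summable (\<lambda>j. norm (ln (real (j + 2)) powr (-1/48) - ln (real (Suc (j + 2))) powr (-1/48)))"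
  proof -
    have "norm (ln (real (j + 2)) powr (-1/48) - ln (real (Suc (j + 2))) powr (-1/48)) = ln (real (j + 2)) powr (-1/48) - ln (real (Suc (j + 2))) powr (-1/48)" for j
      using powr_mono2'[of "-1/48" "ln (real (j + 2))" "ln (real (Suc (j + 2)))"] by simp
    then show ?thesis using tel by (subst (asm) summable_iff_shift[of _ 2, symmetric]) simp
  qed
  then have "summable (\<lambda>j. norm (ln (real j) powr (-1/48) - ln (real (Suc j)) powr (-1/48)))"
    by (subst (asm) summable_iff_shift)
  then have "summable f" by (rule summable_comparison_test_bigo[OF _ f_bigo])
  then have "Bseq (\<lambda>n. \<Sum>j<n. f j)" by (simp add: summable_iff_convergent convergent_imp_Bseq)
  then obtain B where B: "B > 0" "\<And>n. \<bar>\<Sum>j<n. f j\<bar> \<le> B" by (auto simp: Bseq_def)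
  \<comment> \<open>For j \<le> 1 the terms of \<open>f\<close> involve the default value of
    \<open>ln\<close> at 0. All terms with j < 3 are therefore collected in a constant, together
    with the lower end ln (ln 3) of the telescoping sum.\<close>
  define c where "c = \<bar>\<Sum>j<3. f j\<bar> + \<bar>\<Sum>j=1..2. opi (real j) / (real j * (real j + 1))\<bar> + \<bar>ln (ln 3)\<bar>"
  have nat_bound: "\<bar>recip_sum (real n) - ln (ln (real n + 1))\<bar> \<le> B + c + 1" if n: "n \<ge> 3" for n
  proof -
    have "(\<Sum>j=3..n. ln (ln (real j + 1)) - ln (ln (real j))) = ln (ln (real (Suc n))) - ln (ln (real 3))"
      using sum_Suc_diff[of 3 n "\<lambda>j. ln (ln (real j))"] n by (simp add: add.commute)
    moreover have "(\<Sum>j=3..n. f j) = (\<Sum>j=3..n. opi (real j) / (real j * (real j + 1))) - (\<Sum>j=3..n. ln (ln (real j + 1)) - ln (ln (real j)))"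
      unfolding f_def by (rule sum_subtractf)
    moreover have "(\<Sum>j<Suc n. f j) = (\<Sum>j<3. f j) + (\<Sum>j=3..n. f j)"
    proof -
      have "{..<Suc n} = {..<3} \<union> {3..n}" using n by auto
      then show ?thesis by (simp only:) (rule sum.union_disjoint; force)
    qed
    moreover have "(\<Sum>j=1..n. opi (real j) / (real j * (real j + 1))) = (\<Sum>j=1..2. opi (real j) / (real j * (real j + 1))) + (\<Sum>j=3..n. opi (real j) / (real j * (real j + 1)))"
    proof -
      have "{1..n} = {1..2} \<union> {3..n}" using n by auto
      then show ?thesis by (simp only:) (rule sum.union_disjoint; force)
    qed
    moreover have "0 \<le> opi (real n) / (real n + 1)" "opi (real n) / (real n + 1) \<le> 1"
      using opi_le[of "real n"] opi_nonneg[of "real n"] by (simp_all add: divide_le_eq_1)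
    ultimately have "recip_sum (real n) - ln (ln (real n + 1)) = 
       (\<Sum>j<Suc n. f j) - (\<Sum>j<3. f j) + (\<Sum>j=1..2. opi (real j) / (real j * (real j + 1))) - ln (ln 3) + opi (real n) / (real n + 1)"
      unfolding recip_sum_abel by (simp add: add.commute)
    moreover note B(2)[of "Suc n"] \<open>0 \<le> opi (real n) / (real n + 1)\<close> \<open>opi (real n) / (real n + 1) \<le> 1\<close>
    ultimately show ?thesis unfolding c_def by linarith
  qed
  have ev: "\<forall>\<^sub>F x::real in at_top. ln (ln (x + 1)) - ln (ln x) \<le> 1" by real_asymp
  have "\<forall>\<^sub>F x in at_top. norm (recip_sum x - ln (ln x)) \<le> (B + c + 2) * norm (1::real)"
    using ev eventually_ge_at_top[of 3]
  proof eventually_elim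
    case (elim x)
    define n where "n = nat \<lfloor>x\<rfloor>"
    have n: "n \<ge> 3" "real n \<le> x" "x \<le> real n + 1" using elim by (simp_all add: n_def le_nat_floor)
    have "recip_sum x = recip_sum (real n)"
      unfolding recip_sum_def n_def using odd_primes_upto_floor[of x] elim by simp
    moreover have "1 < x" using elim by simp
    then have "ln (ln x) \<le> ln (ln (real n + 1))" "ln (ln (real n + 1)) \<le> ln (ln (x + 1))"
      using n by (auto simp: ln_gt_zero)
    ultimately show ?case using nat_bound[OF n(1)] elim by (simp add: abs_le_iff)
  qed
  then show ?thesis by (rule bigoI)
qed

lemma card_multiples:
  assumes "p > 0"
  shows "card {m\<in>{1..n}. p dvd m} = n div p"
proof -
  have "bij_betw (\<lambda>k. p * k) {1..n div p} {m\<in>{1..n}. p dvd m}"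
  proof (rule bij_betw_imageI)
    show "inj_on (\<lambda>k. p * k) {1..n div p}" using assms by (auto simp: inj_on_def)
    show "(\<lambda>k. p * k) ` {1..n div p} = {m\<in>{1..n}. p dvd m}"
    proof (intro equalityI subsetI)
      fix m assume "m \<in> {m\<in>{1..n}. p dvd m}"
      then obtain k where k: "m = p * k" "1 \<le> m" "m \<le> n" by auto
      then have "k \<le> n div p" "1 \<le> k" using assms by (auto simp: less_eq_div_iff_mult_less_eq mult.commute intro: Nat.gr0I)
      then show "m \<in> (\<lambda>k. p * k) ` {1..n div p}" using k by auto
    next
      fix m assume "m \<in> (\<lambda>k. p * k) ` {1..n div p}"
      then obtain k where k: "m = p * k" "k \<in> {1..n div p}" by (rule imageE)
      have "1 \<le> k" using k(2) unfolding atLeastAtMost_iff by (rule conjunct1)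
      moreover have "p * k \<le> n" using assms k(2) by (simp add: less_eq_div_iff_mult_less_eq mult.commute)
      ultimately show "m \<in> {m\<in>{1..n}. p dvd m}" using k(1) assms by auto
    qed
  qed
  from bij_betw_same_card[OF this] show ?thesis by simp
qed

text \<open>A crude half of Mertens' first theorem. Writing ln (n!) through \<Lambda> shows that the
  sum of ln q times the integer part of n / q is at most n ln n; restoring n / q costs at most the
  sum of ln q, again at most n ln n. This explains the factor 2.\<close>

lemma sum_ln_over_prime:
  assumes x: "x \<ge> 1"
  shows "(\<Sum>q\<in>odd_primes_upto x. ln (real q) / real q) \<le> 2 * ln x"
proof -
  define n where "n = nat \<lfloor>x\<rfloor>"
  have n: "n \<ge> 1" "real n \<le> x" using x by (simp_all add: n_def le_nat_floor)
  define Q where "Q = odd_primes_upto (real n)"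
  have Q: "prime q" "q > 0" "q \<le> n" if "q \<in> Q" for q
    using that by (auto simp: Q_def odd_primes_upto_def prime_gt_0_nat)
  have Q_ln: "ln (real q) \<le> ln (real n)" if "q \<in> Q" for q
    using Q[OF that] by (subst ln_le_cancel_iff) auto
  have finQ: "finite Q" by (simp add: Q_def)
  have cardQ: "card Q \<le> n" using opi_le[of "real n"] by (simp add: opi_def Q_def)
  have "(\<Sum>q\<in>Q. ln (real q) * real (n div q)) = (\<Sum>q\<in>Q. \<Sum>m | m \<in> {1..n} \<and> q dvd m. ln (real q))"
    using Q card_multiples by (intro sum.cong refl) (simp add: mult.commute)
  also have "\<dots> = (\<Sum>m\<in>{1..n}. \<Sum>q | q \<in> Q \<and> q dvd m. ln (real q))"
    by (rule sum.swap_restrict) (auto simp: finQ)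
  also have "\<dots> \<le> (\<Sum>m\<in>{1..n}. ln (real m))"
  proof (rule sum_mono)
    fix m assume m: "m \<in> {1..n}"
    have "(\<Sum>q | q \<in> Q \<and> q dvd m. ln (real q)) = (\<Sum>q | q \<in> Q \<and> q dvd m. mangoldt q)"
      using Q by (intro sum.cong) auto
    also have "\<dots> \<le> (\<Sum>q | q dvd m. mangoldt q)"
      using m by (intro sum_mono2) (auto simp: mangoldt_nonneg)
    also have "\<dots> = ln (real m)" using m mangoldt_sum[of m, where 'a = real] by simp
    finally show "(\<Sum>q | q \<in> Q \<and> q dvd m. ln (real q)) \<le> ln (real m)" .
  qed
  also have "\<dots> \<le> (\<Sum>m\<in>{1..n}. ln (real n))" by (intro sum_mono) auto
  finally have 1: "(\<Sum>q\<in>Q. ln (real q) * real (n div q)) \<le> real n * ln (real n)" by simp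
  have "(\<Sum>q\<in>Q. ln (real q)) \<le> (\<Sum>q\<in>Q. ln (real n))" using Q by (intro sum_mono) (simp add: Q_ln)
  also have "\<dots> \<le> real n * ln (real n)" using cardQ n by (simp add: mult_right_mono)
  finally have 2: "(\<Sum>q\<in>Q. ln (real q)) \<le> real n * ln (real n)" .
  have "real n * (\<Sum>q\<in>Q. ln (real q) / real q) = (\<Sum>q\<in>Q. ln (real q) * (real n / real q))"
    by (simp add: sum_distrib_left mult_ac)
  also have "\<dots> \<le> (\<Sum>q\<in>Q. ln (real q) * real (n div q) + ln (real q))"
  proof (rule sum_mono)
    fix q assume "q \<in> Q"
    note q = Q[OF this]
    have "real n / real q \<le> real (n div q) + 1" 
    proof -
      have "n = (n div q) * q + n mod q" by simp
      also have "\<dots> \<le> (n div q) * q + q" using q by (intro add_left_mono) (simp add: less_imp_le)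
      finally have "n \<le> (n div q + 1) * q" by simp
      then have "real n \<le> (real (n div q) + 1) * real q"
        by (metis of_nat_1 of_nat_add of_nat_le_iff of_nat_mult)
      then show ?thesis using q by (simp add: pos_divide_le_eq)
    qed
    then have "ln (real q) * (real n / real q) \<le> ln (real q) * (real (n div q) + 1)"
      using q by (intro mult_left_mono) auto
    then show "ln (real q) * (real n / real q) \<le> ln (real q) * real (n div q) + ln (real q)"
      by (simp add: distrib_left)
  qed
  also have "\<dots> \<le> real n * (2 * ln (real n))" using 1 2 by (simp add: sum.distrib)
  finally have "(\<Sum>q\<in>Q. ln (real q) / real q) \<le> 2 * ln (real n)" using n by simp
  also have "\<dots> \<le> 2 * ln x" using n x by simp
  finally show ?thesis using odd_primes_upto_floor[of x] x by (simp add: Q_def n_def)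
qed

lemma opi_upper:
  obtains C x0 where "C > 0" "x0 \<ge> 3" "\<And>x. x \<ge> x0 \<Longrightarrow> opi x \<le> C * x / ln x"
proof -
  obtain C x0 where C: "C > 0" "x0 \<ge> 3"
    "\<And>x y. \<lbrakk>x \<ge> x0; 0 \<le> y; y \<le> x\<rbrakk> \<Longrightarrow> \<bar>opi y - y / ln x\<bar> \<le> C * x * ln x powr (-49/48)"
    using opi_uniform by blast
  show ?thesis
  proof
    show "C + 1 > 0" "x0 \<ge> 3" using C by auto
    fix x assume x: "x \<ge> x0"
    have "exp 1 \<le> x" using x C exp_le by linarith
    then have lx: "ln x \<ge> 1" using x C by (subst ln_ge_iff) auto
    have "opi x \<le> x / ln x + C * x * ln x powr (-49/48)"
      using C(3)[OF x, of x] x C(2) by linarith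
    also have "C * x * ln x powr (-49/48) \<le> C * x * ln x powr (-1)"
      using C x lx by (intro mult_left_mono powr_mono) auto
    also have "ln x powr (-1) = 1 / ln x" using lx by (simp add: powr_minus_divide)
    finally show "opi x \<le> (C + 1) * x / ln x" by (simp add: distrib_right add_divide_distrib)
  qed
qed

text \<open>As n - r is the number of integers j with r \<le> j < n, exchanging the summations
  yields a discrete integral of \<open>opi\<close>.\<close>

lemma sum_opi_below: "(\<Sum>r\<in>odd_primes_upto (real n). real n - real r) = (\<Sum>j<n. opi (real j))"
proof -
  define Q where "Q = odd_primes_upto (real n)"
  have finQ: "finite Q" by (simp add: Q_def)
  have "(\<Sum>r\<in>Q. real n - real r) = (\<Sum>r\<in>Q. \<Sum>j | j \<in> {..<n} \<and> r \<le> j. 1)"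
  proof (rule sum.cong)
    fix r assume "r \<in> Q"
    then have r: "r \<le> n" by (simp add: Q_def odd_primes_upto_def)
    have "{j. j \<in> {..<n} \<and> r \<le> j} = {r..<n}" by auto
    then show "real n - real r = (\<Sum>j | j \<in> {..<n} \<and> r \<le> j. 1)" using r by (simp add: of_nat_diff)
  qed simp
  also have "\<dots> = (\<Sum>j\<in>{..<n}. \<Sum>r | r \<in> Q \<and> r \<le> j. 1)"
    by (rule sum.swap_restrict) (auto simp: finQ)
  also have "\<dots> = (\<Sum>j<n. opi (real j))"
  proof (rule sum.cong)
    fix j assume "j \<in> {..<n}"
    then have "{r. r \<in> Q \<and> r \<le> j} = odd_primes_upto (real j)"
      by (auto simp: Q_def odd_primes_upto_def)
    then show "(\<Sum>r | r \<in> Q \<and> r \<le> j. 1) = opi (real j)" by (simp add: opi_def)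
  qed simp
  finally show ?thesis by (simp add: Q_def)
qed

text \<open>Up to O(y) this is the sum of opi(j) over j below the integer part of y. By
  \<open>opi_uniform\<close> each term may be replaced by j / ln y with the same logarithm, which
  leaves an arithmetic series.\<close>

lemma sum_diff_primes:
  obtains C y0 where "C > 0" "y0 \<ge> 3"
    "\<And>y. y \<ge> y0 \<Longrightarrow> \<bar>(\<Sum>r\<in>odd_primes_upto y. y - real r) - y\<^sup>2 / (2 * ln y)\<bar> \<le> C * y\<^sup>2 * ln y powr (-49/48)"
proof -
  obtain C x0 where C: "C > 0" "x0 \<ge> 3"
    "\<And>x y. \<lbrakk>x \<ge> x0; 0 \<le> y; y \<le> x\<rbrakk> \<Longrightarrow> \<bar>opi y - y / ln x\<bar> \<le> C * x * ln x powr (-49/48)"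
    using opi_uniform by blast
  have "\<forall>\<^sub>F y::real in at_top. 3 * y \<le> y\<^sup>2 * ln y powr (-49/48)" by real_asymp
  then obtain x1 where x1: "\<And>y::real. y \<ge> x1 \<Longrightarrow> 3 * y \<le> y\<^sup>2 * ln y powr (-49/48)"
    unfolding eventually_at_top_linorder by blast
  show ?thesis
  proof
    show "C + 1 > 0" "max x0 x1 \<ge> 3" using C by auto
    fix y assume y: "y \<ge> max x0 x1"
    define E where "E = y\<^sup>2 * ln y powr (-49/48)"
    define n where "n = nat \<lfloor>y\<rfloor>"
    have y3: "y \<ge> 3" using y C by simp
    have n: "n \<ge> 3" "real n \<le> y" "y \<le> real n + 1" using y3 by (simp_all add: n_def le_nat_floor)
    have "exp 1 \<le> y" using y3 exp_le by linarith
    then have ly: "ln y \<ge> 1" using y3 by (subst ln_ge_iff) auto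
    have "(\<Sum>r\<in>odd_primes_upto y. y - real r) = (\<Sum>r\<in>odd_primes_upto (real n). (y - real n) + (real n - real r))"
      unfolding n_def using odd_primes_upto_floor[of y] y3 by simp
    also have "\<dots> = (y - real n) * opi (real n) + (\<Sum>j<n. opi (real j))"
      unfolding sum.distrib sum_opi_below by (simp add: opi_def mult.commute)
    finally have eq: "(\<Sum>r\<in>odd_primes_upto y. y - real r) = (y - real n) * opi (real n) + (\<Sum>j<n. opi (real j))" .
    have "(y - real n) * opi (real n) \<le> 1 * y"
      using n opi_le[of "real n"] opi_nonneg[of "real n"] by (intro mult_mono) auto
    moreover have "(y - real n) * opi (real n) \<ge> 0" using n opi_nonneg by auto
    moreover have "\<bar>(\<Sum>j<n. opi (real j)) - (\<Sum>j<n. real j / ln y)\<bar> \<le> C * E"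
    proof -
      have "\<bar>(\<Sum>j<n. opi (real j)) - (\<Sum>j<n. real j / ln y)\<bar> \<le> (\<Sum>j<n. \<bar>opi (real j) - real j / ln y\<bar>)"
        unfolding sum_subtractf[symmetric] by (rule sum_abs)
      also have "\<dots> \<le> (\<Sum>j<n. C * y * ln y powr (-49/48))"
        using y n by (intro sum_mono C(3)) auto
      also have "\<dots> = real n * (C * y * ln y powr (-49/48))" by simp
      also have "\<dots> \<le> y * (C * y * ln y powr (-49/48))"
        using n C y3 by (intro mult_right_mono) auto
      also have "\<dots> = C * E" by (simp add: E_def power2_eq_square)
      finally show ?thesis .
    qed
    moreover have "(\<Sum>j<n. real j / ln y) = real n * (real n - 1) / 2 / ln y"
    proof -
      have "(\<Sum>j<m. real j) = real m * (real m - 1) / 2" for m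
        by (induction m) (auto simp: field_simps)
      then show ?thesis by (simp only: sum_divide_distrib[symmetric])
    qed
    moreover have "real n * (real n - 1) / 2 / ln y \<le> y\<^sup>2 / (2 * ln y)"
    proof -
      have "real n * (real n - 1) \<le> y * y" using n by (intro mult_mono) auto
      then show ?thesis using ly by (simp add: power2_eq_square divide_right_mono)
    qed
    moreover have "y\<^sup>2 / (2 * ln y) - real n * (real n - 1) / 2 / ln y \<le> 2 * y"
    proof -
      have "(y - 1) * (y - 2) \<le> real n * (real n - 1)" using n y3 by (intro mult_mono) auto
      then have "y\<^sup>2 - real n * (real n - 1) \<le> 3 * y" by (simp add: power2_eq_square algebra_simps)
      then have "(y\<^sup>2 - real n * (real n - 1)) / (2 * ln y) \<le> 3 * y / (2 * 1)"
        using ly y3 by (intro frac_le) auto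
      also have "\<dots> \<le> 2 * y" using y3 by simp
      finally show ?thesis by (simp add: diff_divide_distrib)
    qed
    moreover have "3 * y \<le> E" unfolding E_def using y by (intro x1) auto
    ultimately have "\<bar>(\<Sum>r\<in>odd_primes_upto y. y - real r) - y\<^sup>2 / (2 * ln y)\<bar> \<le> C * E + E"
      unfolding eq by (simp add: abs_le_iff)
    then show "\<bar>(\<Sum>r\<in>odd_primes_upto y. y - real r) - y\<^sup>2 / (2 * ln y)\<bar> \<le> (C + 1) * y\<^sup>2 * ln y powr (-49/48)"
      by (simp add: E_def algebra_simps)
  qed
qed

section \<open>Counting triples of odd primes\<close>

text \<open>For fixed q, opi(x - q r) is replaced by (x - q r) / ln x, uniformly in r; then x - q r
  = q (y - r) with y = x / q leads to \<open>sum_diff_primes\<close>. In the error, the factor 1 /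
  (q ln x) comes from the number of r, which is O(y / ln y), and q \<le> sqrt x ensures ln y \<ge>
  (ln x) / 2.\<close>

lemma inner_sum_estimate:
  obtains C x0 where "C > 0" "x0 \<ge> 3"
    "\<And>x q. \<lbrakk>x \<ge> x0; 1 \<le> q; q \<le> sqrt x\<rbrakk> \<Longrightarrow>
      \<bar>(\<Sum>r\<in>odd_primes_upto (x / q). opi (x - q * real r)) - x\<^sup>2 / (2 * q * ln x * ln (x / q))\<bar>
        \<le> C * x\<^sup>2 * ln x powr (-49/48) / (q * ln x)"
proof -
  obtain C1 x1 where C1: "C1 > 0" "x1 \<ge> 3"
    "\<And>x y. \<lbrakk>x \<ge> x1; 0 \<le> y; y \<le> x\<rbrakk> \<Longrightarrow> \<bar>opi y - y / ln x\<bar> \<le> C1 * x * ln x powr (-49/48)"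
    using opi_uniform by blast
  obtain C2 x2 where C2: "C2 > 0" "x2 \<ge> 3" "\<And>x. x \<ge> x2 \<Longrightarrow> opi x \<le> C2 * x / ln x"
    using opi_upper by blast
  obtain C3 x3 where C3: "C3 > 0" "x3 \<ge> 3"
    "\<And>y. y \<ge> x3 \<Longrightarrow> \<bar>(\<Sum>r\<in>odd_primes_upto y. y - real r) - y\<^sup>2 / (2 * ln y)\<bar> \<le> C3 * y\<^sup>2 * ln y powr (-49/48)"
    using sum_diff_primes by blast
  define P where "P = 1 / 2 powr (-49/48 :: real)"
  have P: "P > 0" by (simp add: P_def)
  show ?thesis
  proof
    show "2 * C1 * C2 + C3 * P > 0" using C1 C2 C3 P by (intro add_pos_pos) auto
    \<comment> \<open>The thresholds for y are squared because only y \<ge> sqrt x is known.\<close>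
    show "max x1 (max (x2\<^sup>2) (x3\<^sup>2)) \<ge> 3" using C1 by simp
    fix x q :: real
    assume xq: "x \<ge> max x1 (max (x2\<^sup>2) (x3\<^sup>2))" "1 \<le> q" "q \<le> sqrt x"
    define y where "y = x / q"
    define E where "E = x\<^sup>2 * ln x powr (-49/48) / (q * ln x)"
    have x: "x \<ge> 3" "x \<ge> x1" using xq C1 by auto
    have "exp 1 \<le> x" using x exp_le by linarith
    then have lx: "ln x \<ge> 1" using x by (subst ln_ge_iff) auto
    have "sqrt x * q \<le> sqrt x * sqrt x" using xq x by (intro mult_left_mono) auto
    then have y: "y \<ge> sqrt x" using xq x by (simp add: y_def pos_le_divide_eq)
    have "sqrt x \<ge> sqrt (x2\<^sup>2)" "sqrt x \<ge> sqrt (x3\<^sup>2)" using xq by (intro real_sqrt_le_mono; simp)+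
    then have y23: "y \<ge> x2" "y \<ge> x3" using y C2 C3 by auto
    have y0: "y \<ge> 3" using y23 C2 by simp
    have "sqrt x > 0" using x by simp
    then have "ln (sqrt x) \<le> ln y" using y y0 by (subst ln_le_cancel_iff) auto
    then have ly: "ln y \<ge> ln x / 2" using x by (simp add: ln_sqrt)
    have xqy: "x = q * y" using xq by (simp add: y_def)
    have "\<bar>(\<Sum>r\<in>odd_primes_upto y. opi (x - q * real r)) - (\<Sum>r\<in>odd_primes_upto y. (x - q * real r) / ln x)\<bar>
       \<le> (\<Sum>r\<in>odd_primes_upto y. \<bar>opi (x - q * real r) - (x - q * real r) / ln x\<bar>)"
      unfolding sum_subtractf[symmetric] by (rule sum_abs)
    also have "\<dots> \<le> (\<Sum>r\<in>odd_primes_upto y. C1 * x * ln x powr (-49/48))"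
    proof (intro sum_mono C1(3) x(2))
      fix r assume "r \<in> odd_primes_upto y"
      then have "real r \<le> y" by (simp add: odd_primes_upto_def)
      then show "0 \<le> x - q * real r" using xq unfolding xqy by simp
      show "x - q * real r \<le> x" using xq by simp
    qed
    also have "\<dots> = opi y * (C1 * x * ln x powr (-49/48))" by (simp add: opi_def)
    also have "\<dots> \<le> (2 * C2 * y / ln x) * (C1 * x * ln x powr (-49/48))"
    proof (rule mult_right_mono)
      have "opi y \<le> C2 * y / ln y" by (rule C2(3)[OF y23(1)])
      also have "\<dots> \<le> C2 * y / (ln x / 2)"
        using ly lx y0 C2 by (intro divide_left_mono) auto
      finally show "opi y \<le> 2 * C2 * y / ln x" by (simp add: mult_ac)
    qed (use C1 x in auto)
    also have "\<dots> = 2 * C1 * C2 * E" by (simp add: E_def y_def power2_eq_square)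
    finally have A: "\<bar>(\<Sum>r\<in>odd_primes_upto y. opi (x - q * real r)) - (\<Sum>r\<in>odd_primes_upto y. (x - q * real r) / ln x)\<bar> \<le> 2 * C1 * C2 * E" .
    have B1: "(\<Sum>r\<in>odd_primes_upto y. (x - q * real r) / ln x) = q / ln x * (\<Sum>r\<in>odd_primes_upto y. y - real r)"
      unfolding sum_distrib_left
    proof (intro sum.cong refl)
      have "x - q * real r = q * (y - real r)" for r by (simp only: right_diff_distrib xqy[symmetric])
      then show "(x - q * real r) / ln x = q / ln x * (y - real r)" for r by simp
    qed
    have B2: "x\<^sup>2 / (2 * q * ln x * ln y) = q / ln x * (y\<^sup>2 / (2 * ln y))"
      using xq by (simp add: y_def power2_eq_square)
    have "\<bar>q / ln x * (\<Sum>r\<in>odd_primes_upto y. y - real r) - q / ln x * (y\<^sup>2 / (2 * ln y))\<bar> 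
      = q / ln x * \<bar>(\<Sum>r\<in>odd_primes_upto y. y - real r) - y\<^sup>2 / (2 * ln y)\<bar>"
    proof -
      have "q / ln x \<ge> 0" using xq lx by simp
      then show ?thesis by (simp only: right_diff_distrib[symmetric] abs_mult abs_of_nonneg)
    qed
    also have "\<dots> \<le> q / ln x * (C3 * y\<^sup>2 * ln y powr (-49/48))"
      using xq lx by (intro mult_left_mono C3(3) y23) auto
    also have "\<dots> \<le> q / ln x * (C3 * y\<^sup>2 * (P * ln x powr (-49/48)))"
    proof -
      have "ln y powr (-49/48) \<le> (ln x / 2) powr (-49/48)" using ly lx by (intro powr_mono2') auto
      also have "\<dots> = P * ln x powr (-49/48)" using lx by (simp add: powr_divide P_def)
      finally show ?thesis using xq lx C3 by (intro mult_left_mono) auto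
    qed
    also have "\<dots> = C3 * P * E" using xq by (simp add: E_def y_def power2_eq_square mult_ac)
    finally have B: "\<bar>(\<Sum>r\<in>odd_primes_upto y. (x - q * real r) / ln x) - x\<^sup>2 / (2 * q * ln x * ln y)\<bar> \<le> C3 * P * E"
      unfolding B1 B2 .
    have "\<bar>(\<Sum>r\<in>odd_primes_upto y. opi (x - q * real r)) - x\<^sup>2 / (2 * q * ln x * ln y)\<bar> \<le> (2 * C1 * C2 + C3 * P) * E"
      using A B unfolding distrib_right by linarith
    then show "\<bar>(\<Sum>r\<in>odd_primes_upto (x / q). opi (x - q * real r)) - x\<^sup>2 / (2 * q * ln x * ln (x / q))\<bar>
        \<le> (2 * C1 * C2 + C3 * P) * x\<^sup>2 * ln x powr (-49/48) / (q * ln x)"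
      by (simp add: E_def y_def)
  qed
qed

text \<open>Since ln q \<le> (ln x) / 2, replacing 1 / ln (x / q) by 1 / ln x costs at most 2 ln q /
  (ln x)^2, and the sum of ln q / q over q \<le> sqrt x is at most ln x.\<close>

lemma weighted_recip_sum:
  assumes x: "x \<ge> 9"
  shows "(\<Sum>q\<in>odd_primes_upto (sqrt x). 1 / (real q * ln (x / real q))) \<ge> recip_sum (sqrt x) / ln x"
    and "(\<Sum>q\<in>odd_primes_upto (sqrt x). 1 / (real q * ln (x / real q))) \<le> recip_sum (sqrt x) / ln x + 2 / ln x"
proof -
  have "exp 1 \<le> x" using x exp_le by linarith
  then have lx: "ln x \<ge> 1" using x by (subst ln_ge_iff) auto
  have bd: "1 / real q / ln x \<le> 1 / (real q * ln (x / real q))" (is ?A)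
      "1 / (real q * ln (x / real q)) \<le> 1 / real q / ln x + 2 / (ln x)\<^sup>2 * (ln (real q) / real q)" (is ?B)
    if "q \<in> odd_primes_upto (sqrt x)" for q
  proof -
    have q: "q > 0" "real q \<le> sqrt x" using that by (auto simp: odd_primes_upto_def prime_gt_0_nat)
    then have "ln (real q) \<le> ln (sqrt x)" using x by (subst ln_le_cancel_iff) auto
    then have lq: "ln (real q) \<le> ln x / 2" using x by (simp add: ln_sqrt)
    have lq0: "ln (real q) \<ge> 0" using q by simp
    have lxq: "ln (x / real q) = ln x - ln (real q)" using x q by (simp add: ln_div)
    define d where "d = ln x - ln (real q)"
    have d: "d \<ge> ln x / 2" "d > 0" "d \<le> ln x" using lq lq0 lx by (auto simp: d_def)
    have "1 / ln x \<le> 1 / d" using d by (intro divide_left_mono) auto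
    then have "1 / real q * (1 / ln x) \<le> 1 / real q * (1 / d)" by (intro mult_left_mono) auto
    then show ?A unfolding lxq d_def[symmetric] by simp
    have "1 / d - 1 / ln x = ln (real q) / (d * ln x)"
      using d lx by (simp add: divide_simps) (simp add: d_def)
    also have "\<dots> \<le> ln (real q) / (ln x / 2 * ln x)"
      using d lx lq0 by (intro divide_left_mono mult_right_mono mult_pos_pos) auto
    also have "\<dots> = 2 / (ln x)\<^sup>2 * ln (real q)" by (simp add: power2_eq_square)
    finally have "1 / real q * (1 / d) \<le> 1 / real q * (1 / ln x + 2 / (ln x)\<^sup>2 * ln (real q))"
      by (intro mult_left_mono) auto
    then show ?B unfolding lxq d_def[symmetric] by (simp add: distrib_left mult_ac)
  qed
  show "(\<Sum>q\<in>odd_primes_upto (sqrt x). 1 / (real q * ln (x / real q))) \<ge> recip_sum (sqrt x) / ln x"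
    unfolding recip_sum_def sum_divide_distrib by (intro sum_mono bd)
  have "(\<Sum>q\<in>odd_primes_upto (sqrt x). 1 / (real q * ln (x / real q))) \<le>
      (\<Sum>q\<in>odd_primes_upto (sqrt x). 1 / real q / ln x + 2 / (ln x)\<^sup>2 * (ln (real q) / real q))"
    by (intro sum_mono bd)
  also have "\<dots> = recip_sum (sqrt x) / ln x + 2 / (ln x)\<^sup>2 * (\<Sum>q\<in>odd_primes_upto (sqrt x). ln (real q) / real q)"
    unfolding recip_sum_def sum_divide_distrib sum_distrib_left sum.distrib ..
  also have "(\<Sum>q\<in>odd_primes_upto (sqrt x). ln (real q) / real q) \<le> 2 * ln (sqrt x)"
    using x by (intro sum_ln_over_prime) auto
  also have "2 * ln (sqrt x) = ln x" using x by (simp add: ln_sqrt)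
  finally have "(\<Sum>q\<in>odd_primes_upto (sqrt x). 1 / (real q * ln (x / real q))) \<le> recip_sum (sqrt x) / ln x + 2 / (ln x)\<^sup>2 * ln x"
    using lx by (simp add: mult_left_mono divide_right_mono)
  then show "(\<Sum>q\<in>odd_primes_upto (sqrt x). 1 / (real q * ln (x / real q))) \<le> recip_sum (sqrt x) / ln x + 2 / ln x"
    using lx by (simp add: power2_eq_square)
qed

text \<open>Here q \<le> sqrt x, while r may be smaller than q. The inner sums are then complete, as
  \<open>inner_sum_estimate\<close> evaluates them; the surplus is bounded in
  \<open>card_triples_ordered_count\<close>.\<close>

definition ordered_count :: "real \<Rightarrow> real" where
  "ordered_count x = (\<Sum>q\<in>odd_primes_upto (sqrt x). \<Sum>r\<in>odd_primes_upto (x / real q). opi (x - real q * real r))"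

lemma ordered_count_asymp:
  "(\<lambda>x. ordered_count x - x\<^sup>2 * ln (ln x) / (2 * (ln x)\<^sup>2)) \<in> O(\<lambda>x. x\<^sup>2 / (ln x)\<^sup>2)"
proof -
  obtain C x0 where C: "C > 0" "x0 \<ge> 3"
    "\<And>x q. \<lbrakk>x \<ge> x0; 1 \<le> q; q \<le> sqrt x\<rbrakk> \<Longrightarrow>
      \<bar>(\<Sum>r\<in>odd_primes_upto (x / q). opi (x - q * real r)) - x\<^sup>2 / (2 * q * ln x * ln (x / q))\<bar>
        \<le> C * x\<^sup>2 * ln x powr (-49/48) / (q * ln x)"
    using inner_sum_estimate by blast
  have "filterlim (sqrt :: real \<Rightarrow> real) at_top at_top" by real_asymp
  with mertens_second have "(\<lambda>x. recip_sum (sqrt x) - ln (ln (sqrt x))) \<in> O(\<lambda>_. 1)"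
    by (rule landau_o.big.compose)
  moreover have "(\<lambda>x::real. ln (ln (sqrt x)) - ln (ln x)) \<in> O(\<lambda>_. 1)" by real_asymp
  ultimately have "(\<lambda>x. (recip_sum (sqrt x) - ln (ln (sqrt x))) + (ln (ln (sqrt x)) - ln (ln x))) \<in> O(\<lambda>_. 1)"
    by (rule sum_in_bigo)
  then have "(\<lambda>x. recip_sum (sqrt x) - ln (ln x)) \<in> O(\<lambda>_. 1)" by simp
  then obtain B where B: "B > 0" "\<forall>\<^sub>F x in at_top. norm (recip_sum (sqrt x) - ln (ln x)) \<le> B * norm (1::real)"
    by (auto elim!: landau_o.bigE)
  \<comment> \<open>The errors of the inner sums add up to a multiple of (ln x)^(-49/48) times the
    sum of 1 / q, which is at most ln ln x + B. The saving beyond 1 / ln x absorbs ln ln x; a prime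
    number theorem without a rate would not suffice here.\<close>
  have small: "\<forall>\<^sub>F x::real in at_top. ln x powr (-49/48) * (ln (ln x) + B) \<le> 1 / ln x"
    by real_asymp
  have "\<forall>\<^sub>F x in at_top. norm (ordered_count x - x\<^sup>2 * ln (ln x) / (2 * (ln x)\<^sup>2)) \<le> (C + B + 1) * norm (x\<^sup>2 / (ln x)\<^sup>2)"
    using B(2) small eventually_ge_at_top[of x0] eventually_ge_at_top[of 9]
  proof eventually_elim
    case (elim x)
    have "exp 1 \<le> x" using elim exp_le by linarith
    then have lx: "ln x \<ge> 1" using elim by (subst ln_ge_iff) auto
    define R where "R = recip_sum (sqrt x)"
    define S where "S = (\<Sum>q\<in>odd_primes_upto (sqrt x). 1 / (real q * ln (x / real q)))"
    define M where "M = x\<^sup>2 / (2 * ln x)"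
    have R: "\<bar>R - ln (ln x)\<bar> \<le> B" using elim(1) by (simp add: R_def)
    have M: "M > 0" using lx elim by (simp add: M_def)
    have "\<bar>ordered_count x - M * S\<bar> \<le> (\<Sum>q\<in>odd_primes_upto (sqrt x).
       \<bar>(\<Sum>r\<in>odd_primes_upto (x / real q). opi (x - real q * real r)) - M * (1 / (real q * ln (x / real q)))\<bar>)"
      unfolding ordered_count_def S_def sum_distrib_left sum_subtractf[symmetric] by (rule sum_abs)
    also have "\<dots> \<le> (\<Sum>q\<in>odd_primes_upto (sqrt x). C * x\<^sup>2 * ln x powr (-49/48) / (real q * ln x))"
    proof (rule sum_mono)
      fix q assume "q \<in> odd_primes_upto (sqrt x)"
      then have q: "1 \<le> real q" "real q \<le> sqrt x" by (auto simp: odd_primes_upto_def Suc_le_eq prime_gt_0_nat)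
      have "x\<^sup>2 / (2 * real q * ln x * ln (x / real q)) = M * (1 / (real q * ln (x / real q)))"
        by (simp add: M_def mult_ac)
      with C(3)[OF elim(3) q] show "\<bar>(\<Sum>r\<in>odd_primes_upto (x / real q). opi (x - real q * real r)) - M * (1 / (real q * ln (x / real q)))\<bar>
        \<le> C * x\<^sup>2 * ln x powr (-49/48) / (real q * ln x)" by simp
    qed
    also have "\<dots> = C * (x\<^sup>2 / ln x) * (ln x powr (-49/48) * R)"
      unfolding R_def recip_sum_def sum_distrib_left by (intro sum.cong) (auto simp: mult_ac)
    also have "\<dots> \<le> C * (x\<^sup>2 / ln x) * (ln x powr (-49/48) * (ln (ln x) + B))"
      using R C lx elim by (intro mult_left_mono) auto
    also have "\<dots> \<le> C * (x\<^sup>2 / ln x) * (1 / ln x)"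
      using elim C lx by (intro mult_left_mono) auto
    finally have 1: "\<bar>ordered_count x - M * S\<bar> \<le> C * (x\<^sup>2 / (ln x)\<^sup>2)" by (simp add: power2_eq_square)
    have S: "R / ln x \<le> S" "S \<le> R / ln x + 2 / ln x"
      using weighted_recip_sum[OF elim(4)] by (simp_all add: R_def S_def)
    have "\<bar>S - ln (ln x) / ln x\<bar> \<le> (B + 2) / ln x"
    proof -
      have "\<bar>R - ln (ln x)\<bar> / ln x \<le> B / ln x" using R lx by (intro divide_right_mono) auto
      then have "\<bar>R / ln x - ln (ln x) / ln x\<bar> \<le> B / ln x"
        using lx by (simp flip: diff_divide_distrib)
      then show ?thesis using S lx unfolding add_divide_distrib by (simp add: abs_le_iff)
    qed
    then have "M * \<bar>S - ln (ln x) / ln x\<bar> \<le> M * ((B + 2) / ln x)" using M by (intro mult_left_mono) auto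
    also have "\<dots> \<le> (B + 1) * (x\<^sup>2 / (ln x)\<^sup>2)"
    proof -
      have "M * ((B + 2) / ln x) = (B / 2 + 1) * (x\<^sup>2 / (ln x)\<^sup>2)"
        by (simp add: M_def power2_eq_square field_simps)
      also have "\<dots> \<le> (B + 1) * (x\<^sup>2 / (ln x)\<^sup>2)" using B by (intro mult_right_mono) auto
      finally show ?thesis .
    qed
    finally have "\<bar>M * S - M * (ln (ln x) / ln x)\<bar> \<le> (B + 1) * (x\<^sup>2 / (ln x)\<^sup>2)"
      using M by (simp only: right_diff_distrib[symmetric] abs_mult abs_of_pos)
    moreover have "M * (ln (ln x) / ln x) = x\<^sup>2 * ln (ln x) / (2 * (ln x)\<^sup>2)"
      by (simp add: M_def power2_eq_square)
    ultimately have "\<bar>ordered_count x - x\<^sup>2 * ln (ln x) / (2 * (ln x)\<^sup>2)\<bar> \<le> (C + B + 1) * (x\<^sup>2 / (ln x)\<^sup>2)"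
      using 1 unfolding distrib_right by linarith
    then show ?case by simp
  qed
  then show ?thesis by (rule bigoI)
qed

section \<open>Reduction of the semiprime and Goldbach counts\<close>

definition triples :: "nat \<Rightarrow> (nat \<times> nat \<times> nat) set" where
  "triples x = {(p, q, r). prime p \<and> odd p \<and> prime q \<and> odd q \<and> prime r \<and> odd r \<and> q \<le> r \<and> p + q * r \<le> x}"

lemma odd_semiprime_iff:
  "odd_semiprime m \<longleftrightarrow> (\<exists>q r. prime q \<and> prime r \<and> odd q \<and> odd r \<and> q \<le> r \<and> m = q * r)"
  unfolding odd_semiprime_def by (metis linorder_linear mult.commute)

lemma prime_product_unique:
  fixes q r q' r' :: nat
  assumes "prime q" "prime r" "prime q'" "prime r'" "q \<le> r" "q' \<le> r'" "q * r = q' * r'"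
  shows "q = q' \<and> r = r'"
proof -
  have q0: "q > 0" "q' > 0" "r > 0" "r' > 0" using assms prime_gt_0_nat by auto
  have "q dvd q' * r'" using assms(7) by (metis dvd_triv_left)
  then have "q = q' \<or> q = r'" using assms by (auto simp: prime_dvd_mult_iff primes_dvd_imp_eq)
  then show ?thesis
  proof
    assume "q = q'"
    then show ?thesis using assms(7) q0 by simp
  next
    assume *: "q = r'"
    then have "r = q'" using assms(7) q0 by (simp add: mult.commute)
    then show ?thesis using * assms(5,6) by simp
  qed
qed

text \<open>Parity turns the restriction to even totals into the oddness of p: as q r is odd, p + q
  r is even exactly when p is odd. Unique factorisation with q \<le> r makes (p, q, r) \<mapsto> (p,
  q r) injective.\<close>

lemma sum_semiprime_count:
  "(\<Sum>i=1..x div 2. semiprime_count (2 * i)) = card (triples x)"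
proof -
  define S where "S = (\<lambda>i. {(p, m). prime p \<and> odd_semiprime m \<and> p + m = 2 * i})"
  have finS: "finite (S i)" for i
    by (rule finite_subset[of _ "{..2 * i} \<times> {..2 * i}"]) (auto simp: S_def)
  have "(\<Sum>i=1..x div 2. semiprime_count (2 * i)) = (\<Sum>i=1..x div 2. card (S i))"
    by (simp add: semiprime_count_def S_def)
  also have "\<dots> = card (\<Union>i\<in>{1..x div 2}. S i)"
    by (rule card_UN_disjoint[symmetric]) (auto simp: finS, auto simp: S_def)
  also have "(\<Union>i\<in>{1..x div 2}. S i) = (\<lambda>(p, q, r). (p, q * r)) ` triples x"
  proof (intro equalityI subsetI)
    fix z assume "z \<in> (\<Union>i\<in>{1..x div 2}. S i)"
    then obtain p m i where z: "z = (p, m)" "prime p" "odd_semiprime m" "p + m = 2 * i" "i \<le> x div 2"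
      by (auto simp: S_def)
    from z(3) obtain q r where qr: "prime q" "prime r" "odd q" "odd r" "q \<le> r" "m = q * r"
      unfolding odd_semiprime_iff by blast
    have "odd m" using qr by simp
    then have "odd p" using z(4) by (metis even_add even_mult_iff even_numeral)
    moreover have "p + q * r \<le> x" using z qr by simp
    ultimately show "z \<in> (\<lambda>(p, q, r). (p, q * r)) ` triples x"
      using z qr by (auto simp: triples_def intro!: image_eqI[of _ _ "(p, q, r)"])
  next
    fix z assume "z \<in> (\<lambda>(p, q, r). (p, q * r)) ` triples x"
    then obtain p q r where z: "z = (p, q * r)" "(p, q, r) \<in> triples x" by auto
    then have t: "prime p" "odd p" "prime q" "odd q" "prime r" "odd r" "q \<le> r" "p + q * r \<le> x"
      by (auto simp: triples_def)
    have "even (p + q * r)" using t by simp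
    then obtain i where i: "p + q * r = 2 * i" by (rule evenE)
    have "p > 0" using t prime_gt_0_nat by simp
    then have "i \<in> {1..x div 2}" using i t by auto
    moreover have "z \<in> S i" using i t z unfolding S_def odd_semiprime_iff by auto
    ultimately show "z \<in> (\<Union>i\<in>{1..x div 2}. S i)" by blast
  qed
  also have "card ((\<lambda>(p, q, r). (p, q * r)) ` triples x) = card (triples x)"
  proof (rule card_image, rule inj_onI)
    fix a b assume ab: "a \<in> triples x" "b \<in> triples x" "(case a of (p, q, r) \<Rightarrow> (p, q * r)) = (case b of (p, q, r) \<Rightarrow> (p, q * r))"
    obtain p q r p' q' r' where "a = (p, q, r)" "b = (p', q', r')" by (metis prod_cases3)
    then show "a = b" using ab prime_product_unique[of q r q' r'] by (auto simp: triples_def)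
  qed
  finally show ?thesis .
qed

text \<open>A pair determines its total, so each pair of primes up to x is counted at most once; the
  added 1 stands for the prime 2.\<close>

lemma sum_goldbach_count:
  "real (\<Sum>i=1..x div 2. goldbach_count (2 * i)) \<le> (opi (real x) + 1)\<^sup>2"
proof -
  define S where "S = (\<lambda>i. {(p, q). prime p \<and> prime q \<and> p \<le> q \<and> p + q = 2 * (i::nat)})"
  define Q where "Q = insert 2 (odd_primes_upto (real x))"
  have finQ: "finite Q" by (simp add: Q_def)
  have finS: "finite (S i)" for i
    by (rule finite_subset[of _ "{..2 * i} \<times> {..2 * i}"]) (auto simp: S_def)
  have "(\<Sum>i=1..x div 2. goldbach_count (2 * i)) = (\<Sum>i=1..x div 2. card (S i))"
    by (simp add: goldbach_count_def S_def)
  also have "\<dots> = card (\<Union>i\<in>{1..x div 2}. S i)"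
    by (rule card_UN_disjoint[symmetric]) (auto simp: finS, auto simp: S_def)
  also have "\<dots> \<le> card (Q \<times> Q)"
  proof (rule card_mono)
    have "p \<in> Q" if "prime p" "p \<le> x" for p
      using that primes_dvd_imp_eq[of 2 p] by (auto simp: Q_def odd_primes_upto_def)
    then show "(\<Union>i\<in>{1..x div 2}. S i) \<subseteq> Q \<times> Q"
      by (auto simp: S_def)
  qed (simp add: finQ)
  also have "\<dots> = card Q * card Q" by (simp add: card_cartesian_product)
  finally have "real (\<Sum>i=1..x div 2. goldbach_count (2 * i)) \<le> real (card Q) * real (card Q)"
    by (metis of_nat_le_iff of_nat_mult)
  also have "real (card Q) = opi (real x) + 1"
    by (simp add: Q_def opi_def odd_primes_upto_def)
  finally show ?thesis by (simp add: power2_eq_square)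
qed

text \<open>The limit sqrt x for q comes from q^2 \<le> q r \<le> x.\<close>

lemma card_triples:
  "real (card (triples x)) = (\<Sum>q\<in>odd_primes_upto (sqrt (real x)). \<Sum>r | r \<in> odd_primes_upto (real x / real q) \<and> q \<le> r. opi (real x - real q * real r))"
proof -
  define A where "A = odd_primes_upto (sqrt (real x))"
  define B where "B = (\<lambda>q. {r. r \<in> odd_primes_upto (real x / real q) \<and> q \<le> r})"
  define D where "D = (\<lambda>q r. odd_primes_upto (real x - real q * real r))"
  have fin: "finite A" "finite (B q)" "finite (D q r)" for q r by (auto simp: A_def B_def D_def)
  have "bij_betw (\<lambda>(q, r, p). (p, q, r)) (SIGMA q:A. SIGMA r:B q. D q r) (triples x)"
  proof (rule bij_betwI[where g = "\<lambda>(p, q, r). (q, r, p)"])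
    show "(\<lambda>(q, r, p). (p, q, r)) \<in> (SIGMA q:A. SIGMA r:B q. D q r) \<rightarrow> triples x"
    proof (clarsimp simp: A_def B_def D_def odd_primes_upto_def triples_def)
      fix p q r assume "real p \<le> real x - real q * real r"
      then have "real (p + q * r) \<le> real x" by simp
      then show "p + q * r \<le> x" by (simp only: of_nat_le_iff)
    qed
    show "(\<lambda>(p, q, r). (q, r, p)) \<in> triples x \<rightarrow> (SIGMA q:A. SIGMA r:B q. D q r)"
    proof (clarsimp simp: A_def B_def D_def odd_primes_upto_def triples_def)
      fix p q r assume *: "prime q" "q \<le> r" "p + q * r \<le> x"
      then have le: "real p + real q * real r \<le> real x" by (metis of_nat_add of_nat_le_iff of_nat_mult)
      have q: "real q > 0" using * prime_gt_0_nat by simp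
      have "real q * real q \<le> real q * real r" using * by (intro mult_left_mono) auto
      then have "(real q)\<^sup>2 \<le> real x" using le by (simp add: power2_eq_square)
      then have "real q \<le> sqrt (real x)" by (rule real_le_rsqrt)
      moreover have "real r \<le> real x / real q" using le q by (simp add: pos_le_divide_eq mult.commute)
      ultimately show "real q \<le> sqrt (real x) \<and> real r \<le> real x / real q \<and> real p \<le> real x - real q * real r"
        using le by simp
    qed
  qed auto
  then have "card (triples x) = card (SIGMA q:A. SIGMA r:B q. D q r)"
    by (rule bij_betw_same_card[symmetric])
  also have "\<dots> = (\<Sum>q\<in>A. \<Sum>r\<in>B q. card (D q r))"
    using fin by (subst card_SigmaI) (auto intro!: finite_SigmaI sum.cong card_SigmaI)
  finally show ?thesis by (simp add: A_def B_def D_def opi_def)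
qed

text \<open>The surplus consists of triples with r < q \<le> sqrt x. There are at most opi(sqrt x)^2
  such pairs, and p is counted trivially by x; with Chebyshev's bound for the pairs this is O(x^2 /
  (ln x)^2).\<close>

lemma card_triples_ordered_count:
  "ordered_count (real x) - (opi (sqrt (real x)))\<^sup>2 * real x \<le> real (card (triples x))"
  "real (card (triples x)) \<le> ordered_count (real x)"
proof -
  define A where "A = odd_primes_upto (sqrt (real x))"
  define B where "B = (\<lambda>q. odd_primes_upto (real x / real q))"
  define g where "g = (\<lambda>q r. opi (real x - real q * real r))"
  define D where "D = (\<Sum>q\<in>A. \<Sum>r | r \<in> B q \<and> \<not> q \<le> r. g q r)"
  have g0: "g q r \<ge> 0" for q r by (simp add: g_def opi_nonneg)
  have "(\<Sum>r\<in>B q. g q r) = (\<Sum>r | r \<in> B q \<and> q \<le> r. g q r) + (\<Sum>r | r \<in> B q \<and> \<not> q \<le> r. g q r)" for q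
    by (subst sum.union_disjoint[symmetric]) (auto simp: B_def intro!: sum.cong)
  then have eq: "ordered_count (real x) = real (card (triples x)) + D"
    unfolding ordered_count_def card_triples D_def A_def B_def g_def by (simp add: sum.distrib)
  have "D \<ge> 0" unfolding D_def by (intro sum_nonneg g0)
  then show "real (card (triples x)) \<le> ordered_count (real x)" using eq by simp
  have "D \<le> (\<Sum>q\<in>A. \<Sum>r\<in>A. real x)"
    unfolding D_def
  proof (rule sum_mono)
    fix q assume q: "q \<in> A"
    have "(\<Sum>r | r \<in> B q \<and> \<not> q \<le> r. g q r) \<le> (\<Sum>r | r \<in> B q \<and> \<not> q \<le> r. real x)"
    proof (rule sum_mono)
      fix r
      have "g q r \<le> opi (real x)" unfolding g_def by (intro opi_mono) simp
      also have "\<dots> \<le> real x" by (rule opi_le) simp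
      finally show "g q r \<le> real x" .
    qed
    also have "\<dots> \<le> (\<Sum>r\<in>A. real x)"
      using q by (intro sum_mono2) (auto simp: A_def B_def odd_primes_upto_def)
    finally show "(\<Sum>r | r \<in> B q \<and> \<not> q \<le> r. g q r) \<le> (\<Sum>r\<in>A. real x)" .
  qed
  also have "\<dots> = (opi (sqrt (real x)))\<^sup>2 * real x" by (simp add: A_def opi_def power2_eq_square)
  finally show "ordered_count (real x) - (opi (sqrt (real x)))\<^sup>2 * real x \<le> real (card (triples x))"
    using eq by simp
qed

lemma opi_bigo: "opi \<in> O(\<lambda>x. x / ln x)"
proof -
  obtain C x0 where C: "C > 0" "x0 \<ge> 3" "\<And>x. x \<ge> x0 \<Longrightarrow> opi x \<le> C * x / ln x"
    using opi_upper by blast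
  show ?thesis
  proof (rule bigoI[of _ C], rule eventually_mono[OF eventually_ge_at_top[of x0]])
    fix x assume "x \<ge> x0"
    then show "norm (opi x) \<le> C * norm (x / ln x)" using C opi_nonneg[of x] by simp
  qed
qed

text \<open>Compared with \<open>ordered_count\<close>, the sum gains the Goldbach pairs and loses
  the triples with r < q. Both corrections are absorbed by the error term, each through the bound
  O(x / ln x) for \<open>opi\<close>, taken at x for the pairs and at sqrt x for the
  triples.\<close>

lemma sum_chen_count_asymp:
  "(\<lambda>x::nat. real (\<Sum>i=1..x div 2. chen_count (2 * i))
      - (real x)^2 * ln (ln (real x)) / (2 * (ln (real x))^2))
   \<in> O(\<lambda>x::nat. (real x)^2 / (ln (real x))^2)"
proof -
  have real: "filterlim real at_top at_top" by (rule filterlim_real_sequentially)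
  have main: "(\<lambda>x::nat. ordered_count (real x) - (real x)^2 * ln (ln (real x)) / (2 * (ln (real x))^2)) \<in> O(\<lambda>x. (real x)^2 / (ln (real x))^2)"
    using landau_o.big.compose[OF ordered_count_asymp real] .
  have "(\<lambda>x. (opi x + 1)\<^sup>2) \<in> O(\<lambda>x. (x / ln x)\<^sup>2)"
  proof (rule landau_o.big_power, rule sum_in_bigo(1)[OF opi_bigo])
    show "(\<lambda>x::real. 1 :: real) \<in> O(\<lambda>x. x / ln x)" by real_asymp
  qed
  from landau_o.big.compose[OF this real]
  have gold: "(\<lambda>x::nat. (opi (real x) + 1)\<^sup>2) \<in> O(\<lambda>x. (real x)^2 / (ln (real x))^2)" by (simp add: power_divide)
  have "filterlim (sqrt :: real \<Rightarrow> real) at_top at_top" by real_asymp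
  with opi_bigo have "(\<lambda>x. opi (sqrt x)) \<in> O(\<lambda>x. sqrt x / ln (sqrt x))" by (rule landau_o.big.compose)
  then have "(\<lambda>x. (opi (sqrt x))\<^sup>2 * x) \<in> O(\<lambda>x. (sqrt x / ln (sqrt x))\<^sup>2 * x)"
    by (intro landau_o.big.mult landau_o.big_power landau_o.big_refl)
  also have "(\<lambda>x::real. (sqrt x / ln (sqrt x))\<^sup>2 * x) \<in> O(\<lambda>x. x\<^sup>2 / (ln x)\<^sup>2)" by real_asymp
  finally have "(\<lambda>x. (opi (sqrt x))\<^sup>2 * x) \<in> O(\<lambda>x. x\<^sup>2 / (ln x)\<^sup>2)" .
  from landau_o.big.compose[OF this real]
  have diag: "(\<lambda>x::nat. (opi (sqrt (real x)))\<^sup>2 * real x) \<in> O(\<lambda>x. (real x)^2 / (ln (real x))^2)" .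
  have "(\<lambda>x::nat. real (\<Sum>i=1..x div 2. chen_count (2 * i)) - ordered_count (real x)) \<in> O(\<lambda>x. (opi (real x) + 1)\<^sup>2 + (opi (sqrt (real x)))\<^sup>2 * real x)"
  proof (rule bigoI[of _ 1], rule always_eventually, rule allI)
    fix x :: nat
    have eq: "real (\<Sum>i=1..x div 2. chen_count (2 * i)) = real (\<Sum>i=1..x div 2. goldbach_count (2 * i)) + real (card (triples x))"
      unfolding sum_semiprime_count[symmetric] by (simp add: chen_count_def sum.distrib)
    have "0 \<le> real (\<Sum>i=1..x div 2. goldbach_count (2 * i))" by (rule of_nat_0_le_iff)
    moreover have "0 \<le> (opi (real x) + 1)\<^sup>2" "0 \<le> (opi (sqrt (real x)))\<^sup>2 * real x" by auto
    ultimately have "\<bar>real (\<Sum>i=1..x div 2. chen_count (2 * i)) - ordered_count (real x)\<bar> \<le> (opi (real x) + 1)\<^sup>2 + (opi (sqrt (real x)))\<^sup>2 * real x"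
      unfolding eq using sum_goldbach_count[of x] card_triples_ordered_count[of x] by (simp only: abs_le_iff) linarith
    then show "norm (real (\<Sum>i=1..x div 2. chen_count (2 * i)) - ordered_count (real x)) \<le> 1 * norm ((opi (real x) + 1)\<^sup>2 + (opi (sqrt (real x)))\<^sup>2 * real x)"
      unfolding real_norm_def mult_1 by (rule order_trans[OF _ abs_ge_self])
  qed
  also have "(\<lambda>x. (opi (real x) + 1)\<^sup>2 + (opi (sqrt (real x)))\<^sup>2 * real x) \<in> O(\<lambda>x::nat. (real x)^2 / (ln (real x))^2)"
    by (rule sum_in_bigo(1)[OF gold diag])
  finally have "(\<lambda>x::nat. (real (\<Sum>i=1..x div 2. chen_count (2 * i)) - ordered_count (real x))
     + (ordered_count (real x) - (real x)^2 * ln (ln (real x)) / (2 * (ln (real x))^2))) \<in> O(\<lambda>x::nat. (real x)^2 / (ln (real x))^2)"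
    by (rule sum_in_bigo(1)[OF _ main])
  then show ?thesis by (simp only: diff_add_cancel add_diff_eq)
qed

theorem theorem5:
  "(\<lambda>x::nat. real (\<Sum>i=1..x div 2. chen_count (2 * i))
      - (real x)^2 * ln (ln (real x)) / (2 * (ln (real x))^2))
   \<in> O[inf at_top (principal {x. even x})](\<lambda>x::nat. (real x)^2 / (ln (real x))^2)"
  by (rule landau_o.big.filter_mono[OF _ sum_chen_count_asymp]) simp

end
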